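(* Let $(W,\sigma)$ be a symplectic vector space, $T:W\to W$ a linear map with $T+T^{\sigma}$ an isomorphism, $1\le p,q\le\infty$ and $u\in\mathcal{S}'(W)$. Then: (a) $u\in M^{p,q}(W)$ if and only if $\Lambda^{w}_{\sigma,T}u\in M^{p,q}(W)$. (b) The operator $\Lambda^{w}_{\sigma,T}:M^{p,q}(W)\to M^{p,q}(W)$ is a bounded isomorphism.
   Context: $(W,\sigma)$ is a real vector space of finite dimension $2n$ with a non-degenerate antisymmetric bilinear form $\sigma$. $T^{\sigma}$ is defined by $\sigma(T^{\sigma}\xi,\eta)=\sigma(\xi,T\eta)$. $\mathrm{d}^{\sigma}\xi$ is the unique Haar measure on $W$ such that the symplectic Fourier transform $(\mathcal{F}_{\sigma}a)(\xi)=\int_W\mathrm{e}^{-\mathrm{i}\sigma(\xi,\eta)}a(\eta)\,\mathrm{d}^{\sigma}\eta$ is involutive and unitary on $L^2(W)$; it is extended to $\mathcal{S}'(W)$. Let $\lambda_{\sigma,T}(\xi)=\mathrm{e}^{-\frac{\mathrm{i}}{2}\sigma(\xi,T\xi)}$ and $\lambda_{\sigma,T}(D_{\sigma})=\mathcal{F}_{\sigma}\circ\mathrm{M}_{\lambda_{\sigma,T}}\circ\mathcal{F}_{\sigma}$, with $\mathrm{M}_{\lambda}$ multiplication by $\lambda$. The map $\Lambda^{w}_{\sigma,T}:\mathcal{S}'(W)\to\mathcal{S}'(W)$ (which sends the $T$-Weyl symbol of an operator to its standard Weyl symbol) is given by $$\Lambda^{w}_{\sigma,T}(a)=\big(\lambda_{\sigma,T}(D_{\sigma})(a)\big)\circ(T+T^{\sigma}).$$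 Modulation spaces: for $1\le p,q\le\infty$, a distribution $u$ on $\mathbb{R}^N$ is in $M^{p,q}(\mathbb{R}^N)$ if for some (equivalently every) $\chi\in\mathcal{C}_0^{\infty}(\mathbb{R}^N)\setminus0$ the function $U_{\chi,p}(\xi)=\big\|y\mapsto\widehat{u\,\tau_y\chi}(\xi)\big\|_{L^p(\mathbb{R}^N_y)}$ belongs to $L^q(\mathbb{R}^N)$, where $\tau_y\chi=\chi(\cdot-y)$; the norm is $\|U_{\chi,p}\|_{L^q}$ for a fixed $\chi$ (equivalent for different $\chi$). $M^{p,q}(W)$ is defined through a linear identification $W\cong\mathbb{R}^{2n}$. *)

theory Defs
  imports "HOL-Analysis.Analysis" "HOL-Probability.Essential_Supremum"
begin

section \<open>Schwartz functions, test functions and tempered distributions\<close>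

text \<open>Iterated partial derivatives \<open>\<partial>\<^bsub>v1\<^esub> \<dots> \<partial>\<^bsub>vk\<^esub> f\<close>
  along a list of vectors. With entries in \<^const>\<open>Basis\<close> the lists play the role of
  multi-indices, the order being the length of the list.\<close>

primrec iter_deriv :: "'a::euclidean_space list \<Rightarrow> ('a \<Rightarrow> complex) \<Rightarrow> 'a \<Rightarrow> complex" where
  "iter_deriv [] f = f"
| "iter_deriv (v # vs) f = (\<lambda>x. frechet_derivative (iter_deriv vs f) (at x) v)"

definition smooth :: "('a::euclidean_space \<Rightarrow> complex) \<Rightarrow> bool" where
  "smooth f \<longleftrightarrow> (\<forall>vs\<in>lists Basis. \<forall>x. iter_deriv vs f differentiable (at x))"

definition schwartz :: "('a::euclidean_space \<Rightarrow> complex) set" where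
  "schwartz = {f. smooth f \<and>
     (\<forall>k. \<forall>vs\<in>lists Basis. bounded (range (\<lambda>x. (1 + norm x) ^ k * norm (iter_deriv vs f x))))}"

definition test_functions :: "('a::euclidean_space \<Rightarrow> complex) set" where
  "test_functions = {f. smooth f \<and> compact (closure {x. f x \<noteq> 0})}"

definition schwartz_norm :: "nat \<Rightarrow> ('a::euclidean_space \<Rightarrow> complex) \<Rightarrow> real" where
  "schwartz_norm m f = (\<Sum>vs\<in>{vs. set vs \<subseteq> Basis \<and> length vs \<le> m}.
     (SUP x. (1 + norm x) ^ m * norm (iter_deriv vs f x)))"

text \<open>A tempered distribution is a functional on Schwartz functions. As functions on the whole
  HOL type, such functionals are made unique by the value 0 outside of \<^const>\<open>schwartz\<close>,
  so that equality and the vector space operations are the pointwise ones. The last clause is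
  continuity for the Frechet topology of the norms \<^const>\<open>schwartz_norm\<close>.\<close>

type_synonym 'a functional = "('a \<Rightarrow> complex) \<Rightarrow> complex"

definition tempered :: "'a::euclidean_space functional set" where
  "tempered = {u.
     (\<forall>f. f \<notin> schwartz \<longrightarrow> u f = 0) \<and>
     (\<forall>f\<in>schwartz. \<forall>g\<in>schwartz. u (\<lambda>x. f x + g x) = u f + u g) \<and>
     (\<forall>c. \<forall>f\<in>schwartz. u (\<lambda>x. c * f x) = c * u f) \<and>
     (\<exists>C m. \<forall>f\<in>schwartz. norm (u f) \<le> C * schwartz_norm m f)}"

text \<open>The operations below extend operations on functions, where a function \<open>a\<close> is identified
  with the distribution \<open>\<phi> \<mapsto> \<integral> a \<phi>\<close> (a bilinear pairing, no complex conjugation).\<close>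

definition dist_mult :: "('a::euclidean_space \<Rightarrow> complex) \<Rightarrow> 'a functional \<Rightarrow> 'a functional" where
  "dist_mult m u = (\<lambda>\<phi>. if \<phi> \<in> schwartz then u (\<lambda>x. m x * \<phi> x) else 0)"

text \<open>\<open>|det S|\<close> for a linear map, as the volume of the image of the unit cube; unlike a
  determinant this also makes sense between two different Euclidean spaces.\<close>

definition jacobian :: "('a::euclidean_space \<Rightarrow> 'b::euclidean_space) \<Rightarrow> real" where
  "jacobian S = measure lborel (S ` cbox 0 One)"

text \<open>The composition \<open>u \<circ> S\<close> for a linear bijection \<open>S\<close>, from
  \<open>\<integral> u(S x) \<phi>(x) dx = |det S|\<^sup>-\<^sup>1 \<integral> u(y) \<phi>(S\<^sup>-\<^sup>1 y) dy\<close>.\<close>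

definition dist_comp ::
  "'b::euclidean_space functional \<Rightarrow> ('a::euclidean_space \<Rightarrow> 'b) \<Rightarrow> 'a functional" where
  "dist_comp u S = (\<lambda>\<phi>. if \<phi> \<in> schwartz
     then complex_of_real (1 / jacobian S) * u (\<phi> \<circ> inv S) else 0)"

section \<open>Symplectic Fourier transform\<close>

definition symplectic_form :: "('a::euclidean_space \<Rightarrow> 'a \<Rightarrow> real) \<Rightarrow> bool" where
  "symplectic_form \<sigma> \<longleftrightarrow> bilinear \<sigma> \<and> (\<forall>\<xi> \<eta>. \<sigma> \<xi> \<eta> = - \<sigma> \<eta> \<xi>) \<and>
     (\<forall>\<xi>. (\<forall>\<eta>. \<sigma> \<xi> \<eta> = 0) \<longrightarrow> \<xi> = 0)"

definition sympl_adjoint ::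
  "('a::euclidean_space \<Rightarrow> 'a \<Rightarrow> real) \<Rightarrow> ('a \<Rightarrow> 'a) \<Rightarrow> 'a \<Rightarrow> 'a" where
  "sympl_adjoint \<sigma> T = (THE T'. \<forall>\<xi> \<eta>. \<sigma> (T' \<xi>) \<eta> = \<sigma> \<xi> (T \<eta>))"

definition haar_measure :: "'a::euclidean_space measure \<Rightarrow> bool" where
  "haar_measure \<mu> \<longleftrightarrow> sets \<mu> = sets borel \<and> (\<forall>v. distr \<mu> borel (\<lambda>x. v + x) = \<mu>) \<and>
     (\<forall>K. compact K \<longrightarrow> emeasure \<mu> K < \<infinity>) \<and> emeasure \<mu> UNIV \<noteq> 0"

definition sympl_fourier_wrt ::
  "'a::euclidean_space measure \<Rightarrow> ('a \<Rightarrow> 'a \<Rightarrow> real) \<Rightarrow> ('a \<Rightarrow> complex) \<Rightarrow> 'a \<Rightarrow> complex" where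
  "sympl_fourier_wrt \<mu> \<sigma> a \<xi> =
     (LINT \<eta>|\<mu>. exp (- (\<i> * complex_of_real (\<sigma> \<xi> \<eta>))) * a \<eta>)"

text \<open>The Haar measure for which the symplectic Fourier transform is involutive and unitary on
  \<open>L\<^sup>2\<close>. Both properties are expressed on the dense subspace of Schwartz functions, from which
  the transform is extended to \<open>L\<^sup>2\<close> by continuity.\<close>

definition sympl_measure :: "('a::euclidean_space \<Rightarrow> 'a \<Rightarrow> real) \<Rightarrow> 'a measure" where
  "sympl_measure \<sigma> = (THE \<mu>. haar_measure \<mu> \<and>
     (\<forall>a\<in>schwartz. sympl_fourier_wrt \<mu> \<sigma> (sympl_fourier_wrt \<mu> \<sigma> a) = a) \<and>
     (\<forall>a\<in>schwartz. \<forall>b\<in>schwartz.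
        (LINT \<xi>|\<mu>. sympl_fourier_wrt \<mu> \<sigma> a \<xi> * cnj (sympl_fourier_wrt \<mu> \<sigma> b \<xi>)) =
        (LINT \<xi>|\<mu>. a \<xi> * cnj (b \<xi>))))"

definition sympl_fourier ::
  "('a::euclidean_space \<Rightarrow> 'a \<Rightarrow> real) \<Rightarrow> ('a \<Rightarrow> complex) \<Rightarrow> 'a \<Rightarrow> complex" where
  "sympl_fourier \<sigma> = sympl_fourier_wrt (sympl_measure \<sigma>) \<sigma>"

text \<open>Since \<open>\<sigma>\<close> is antisymmetric, the transpose of the symplectic Fourier transform for the
  bilinear pairing is its composition with the reflection:
  \<open>\<integral> (F a)(\<xi>) \<phi>(\<xi>) d\<xi> = \<integral> a(\<eta>) (F \<phi>)(- \<eta>) d\<eta>\<close>.\<close>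

definition dist_sympl_fourier ::
  "('a::euclidean_space \<Rightarrow> 'a \<Rightarrow> real) \<Rightarrow> 'a functional \<Rightarrow> 'a functional" where
  "dist_sympl_fourier \<sigma> u =
     (\<lambda>\<phi>. if \<phi> \<in> schwartz then u (\<lambda>\<eta>. sympl_fourier \<sigma> \<phi> (- \<eta>)) else 0)"

definition lambda_fun ::
  "('a::euclidean_space \<Rightarrow> 'a \<Rightarrow> real) \<Rightarrow> ('a \<Rightarrow> 'a) \<Rightarrow> 'a \<Rightarrow> complex" where
  "lambda_fun \<sigma> T \<xi> = exp (- (\<i> / 2) * complex_of_real (\<sigma> \<xi> (T \<xi>)))"

definition lambda_D ::
  "('a::euclidean_space \<Rightarrow> 'a \<Rightarrow> real) \<Rightarrow> ('a \<Rightarrow> 'a) \<Rightarrow> 'a functional \<Rightarrow> 'a functional" where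
  "lambda_D \<sigma> T = dist_sympl_fourier \<sigma> \<circ> dist_mult (lambda_fun \<sigma> T) \<circ> dist_sympl_fourier \<sigma>"

definition Lambda_w ::
  "('a::euclidean_space \<Rightarrow> 'a \<Rightarrow> real) \<Rightarrow> ('a \<Rightarrow> 'a) \<Rightarrow> 'a functional \<Rightarrow> 'a functional" where
  "Lambda_w \<sigma> T a = dist_comp (lambda_D \<sigma> T a) (\<lambda>\<xi>. T \<xi> + sympl_adjoint \<sigma> T \<xi>)"

section \<open>Modulation spaces\<close>

definition ennreal_powr :: "ennreal \<Rightarrow> real \<Rightarrow> ennreal" where
  "ennreal_powr x r = (if x = \<infinity> then \<infinity> else ennreal (enn2real x powr r))"

definition Lp_norm :: "ennreal \<Rightarrow> 'a measure \<Rightarrow> ('a \<Rightarrow> ennreal) \<Rightarrow> ennreal" where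
  "Lp_norm p M f = (if p = \<infinity> then esssup M f
     else ennreal_powr (\<integral>\<^sup>+ x. ennreal_powr (f x) (enn2real p) \<partial>M) (1 / enn2real p))"

text \<open>The Fourier transform at \<open>\<xi>\<close> of the compactly supported distribution \<open>u \<tau>\<^sub>y w\<close>, i.e. its
  value on the function \<open>x \<mapsto> exp (- i \<langle>x, \<xi>\<rangle>)\<close>.\<close>

definition windowed_fourier ::
  "('a::euclidean_space \<Rightarrow> complex) \<Rightarrow> 'a functional \<Rightarrow> 'a \<Rightarrow> 'a \<Rightarrow> complex" where
  "windowed_fourier w u y \<xi> =
     u (\<lambda>x. w (x - y) * exp (- (\<i> * complex_of_real (x \<bullet> \<xi>))))"

definition modulation_norm ::
  "('a::euclidean_space \<Rightarrow> complex) \<Rightarrow> ennreal \<Rightarrow> ennreal \<Rightarrow> 'a functional \<Rightarrow> ennreal" where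
  "modulation_norm w p q u = Lp_norm q lborel
     (\<lambda>\<xi>. Lp_norm p lborel (\<lambda>y. ennreal (norm (windowed_fourier w u y \<xi>))))"

definition modulation_space :: "ennreal \<Rightarrow> ennreal \<Rightarrow> 'a::euclidean_space functional set" where
  "modulation_space p q = {u \<in> tempered.
     \<exists>w \<in> test_functions. w \<noteq> (\<lambda>x. 0) \<and> modulation_norm w p q u < \<infinity>}"

text \<open>Transport of the norm and of the space along a linear identification
  \<open>J : W \<rightarrow> \<real>\<^sup>N\<close>.\<close>

definition modulation_norm_via ::
  "('a::euclidean_space \<Rightarrow> 'b::euclidean_space) \<Rightarrow> ('b \<Rightarrow> complex) \<Rightarrow>
     ennreal \<Rightarrow> ennreal \<Rightarrow> 'a functional \<Rightarrow> ennreal" where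
  "modulation_norm_via J w p q u = modulation_norm w p q (dist_comp u (inv J))"

definition modulation_space_via ::
  "('a::euclidean_space \<Rightarrow> 'b::euclidean_space) \<Rightarrow> ennreal \<Rightarrow> ennreal \<Rightarrow> 'a functional set" where
  "modulation_space_via J p q = {u \<in> tempered. dist_comp u (inv J) \<in> modulation_space p q}"

text \<open>Bounded (complex) linear bijections of a space \<open>V\<close> of functionals with norm \<open>N\<close>, having a
  bounded inverse.\<close>

definition bounded_isomorphism_on ::
  "'a functional set \<Rightarrow> ('a functional \<Rightarrow> ennreal) \<Rightarrow> ('a functional \<Rightarrow> 'a functional) \<Rightarrow> bool"
  where
  "bounded_isomorphism_on V N L \<longleftrightarrow>
     (\<forall>u\<in>V. \<forall>v\<in>V. L (\<lambda>\<phi>. u \<phi> + v \<phi>) = (\<lambda>\<phi>. L u \<phi> + L v \<phi>)) \<and>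
     (\<forall>c. \<forall>u\<in>V. L (\<lambda>\<phi>. c * u \<phi>) = (\<lambda>\<phi>. c * L u \<phi>)) \<and>
     bij_betw L V V \<and>
     (\<exists>C::real. \<forall>u\<in>V. N (L u) \<le> ennreal C * N u) \<and>
     (\<exists>C::real. \<forall>u\<in>V. N u \<le> ennreal C * N (L u))"

end

theory Submission
  imports Defs "HOL-Probability.Probability"
begin

text \<open>The windowed Fourier transform pairs \<open>u\<close> with the time-frequency shifts of a window. The map
  \<open>\<Lambda>\<close> is the transpose of an operator \<open>A\<close> on the Schwartz space composed of Fourier transforms, a
  chirp and a linear substitution; it carries the shift by \<open>(y, \<xi>)\<close> to a phase times the shift by
  \<open>(L y + D \<xi>, N \<xi>)\<close>, with linear bijections \<open>L\<close> and \<open>N\<close>. Hence the transform of \<open>\<Lambda> u\<close> with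
  window \<open>w\<close> is, up to phases, the transform of \<open>u\<close> with window \<open>A w\<close> at \<open>(L y + D \<xi>, N \<xi>)\<close>. For
  fixed \<open>\<xi>\<close> the translation by \<open>D \<xi>\<close> does not affect the \<open>L\<^sup>p\<close> norm in \<open>y\<close>, so the mixed norms agree
  up to a constant. Finally, all nonzero Schwartz windows give equivalent norms: expanding one window
  in the shifts of another one bounds one transform of \<open>u\<close> by the convolution of the other one with
  an integrable kernel, and Minkowski's inequality applies.\<close>

section \<open>Haar measures and linear substitutions\<close>

text \<open>The order of the two norms is decisive: the inner norm is taken in position at a fixed
  frequency, so a shear of position by a function of frequency is invisible to it. A chirp alone
  shears frequency by position; it is harmless here only because it stands between two Fourier
  transforms. The transformed window \<open>A w\<close> need not have compact support, so the
  comparison of windows has to cover all nonzero Schwartz functions. It expands one window as an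
  integral of shifts of the other, and the analytic obstacle is to move a functional, known only to
  be linear and bounded by a seminorm, under that integral. The constants of linear substitutions
  and of Fourier inversion are not evaluated: uniqueness of Haar measure and a comparison of norms
  give their existence and positivity. The nonzero Schwartz function from which the Fourier
  normalisation is obtained is derived from the window \<open>w\<close> of the theorem.\<close>

lemma haar_measure_translation:
  assumes "haar_measure \<mu>" "f \<in> borel_measurable borel"
  shows "(\<integral>\<^sup>+x. f (v + x) \<partial>\<mu>) = (\<integral>\<^sup>+x. f x \<partial>\<mu>)"
proof -
  have s: "sets \<mu> = sets borel" and d: "distr \<mu> borel (\<lambda>x. v + x) = \<mu>"
    using assms(1) by (auto simp: haar_measure_def)
  have m: "(\<lambda>x. v + x) \<in> measurable \<mu> borel"
    using s by (simp add: measurable_cong_sets[OF s refl])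
  have "(\<integral>\<^sup>+x. f x \<partial>\<mu>) = (\<integral>\<^sup>+x. f x \<partial>distr \<mu> borel (\<lambda>x. v + x))"
    using d by simp
  also have "\<dots> = (\<integral>\<^sup>+x. f (v + x) \<partial>\<mu>)"
    by (rule nn_integral_distr[OF m]) (use assms(2) in simp)
  finally show ?thesis ..
qed

lemma haar_measure_lborel: "haar_measure lborel"
  using emeasure_bounded_finite[OF compact_imp_bounded]
  by (auto simp: haar_measure_def lborel_distr_plus)

text \<open>Supplies Fubini for the uniqueness proof: closed balls of integer radius are compact,
  hence of finite measure, and exhaust the space.\<close>

lemma sigma_finite_haar_measure:
  fixes \<mu> :: "'a::euclidean_space measure"
  assumes "haar_measure \<mu>"
  shows "sigma_finite_measure \<mu>"
proof
  have s: "sets \<mu> = sets borel" using assms by (auto simp: haar_measure_def)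
  have sp: "space \<mu> = UNIV" using sets_eq_imp_space_eq[OF s] by simp
  have "x \<in> (\<Union>n::nat. cball 0 (real n))" for x :: 'a
    using real_arch_simple[of "norm x"] by auto
  moreover have "emeasure \<mu> (cball 0 (real n)) < \<infinity>" for n
    using assms compact_cball unfolding haar_measure_def by blast
  ultimately show "\<exists>A. countable A \<and> A \<subseteq> sets \<mu> \<and> \<Union>A = space \<mu> \<and> (\<forall>a\<in>A. emeasure \<mu> a \<noteq> \<infinity>)"
    unfolding s sp
    by (intro exI[of _ "range (\<lambda>n::nat. cball 0 (real n))"]) (auto simp: less_top[symmetric])
qed

text \<open>Fubini for \<open>\<mu>\<close> and Lebesgue measure \<open>\<lambda>\<close>, applied to the indicator of
  \<open>x + y \<in> A \<and> y \<in> B\<close>, gives \<open>\<mu>(A) \<lambda>(B) = \<lambda>(A) \<mu>(- B)\<close>.\<close>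

lemma haar_measure_eq_lborel:
  fixes \<mu> :: "'a::euclidean_space measure"
  assumes h: "haar_measure \<mu>"
  obtains C :: real where "0 < C" "\<mu> = density lborel (\<lambda>_. ennreal C)"
proof -
  have s[measurable_cong]: "sets \<mu> = sets borel" using h by (auto simp: haar_measure_def)
  have sp: "space \<mu> = UNIV" using sets_eq_imp_space_eq[OF s] by simp
  interpret sigma_finite_measure \<mu> by (rule sigma_finite_haar_measure[OF h])
  interpret pair_sigma_finite \<mu> "lborel :: 'a measure" ..
  \<comment> \<open>A set of Lebesgue measure 1, so that the factor belonging to \<open>B\<close>
    can be inserted freely; \<open>c\<close> is then the measure of its reflection.\<close>
  define B where "B = cbox 0 (One::'a)"
  have [measurable]: "B \<in> sets borel" by (simp add: B_def)
  have B1: "emeasure lborel B = 1" by (simp add: B_def emeasure_lborel_cbox_eq)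
  define c where "c = (\<integral>\<^sup>+x. indicator B (- x) \<partial>\<mu>)"
  have key: "emeasure \<mu> A = c * emeasure lborel A" if A[measurable]: "A \<in> sets borel" for A
  proof -
    have "emeasure \<mu> A = emeasure \<mu> A * emeasure lborel B" using B1 by simp
    also have "\<dots> = (\<integral>\<^sup>+y. emeasure \<mu> A * indicator B y \<partial>lborel)"
      by (simp add: nn_integral_cmult)
    also have "\<dots> = (\<integral>\<^sup>+y. (\<integral>\<^sup>+x. indicator A (y + x) * indicator B y \<partial>\<mu>) \<partial>lborel)"
    proof (rule nn_integral_cong)
      fix y :: 'a
      have "(\<integral>\<^sup>+x. indicator A (y + x) * indicator B y \<partial>\<mu>)
          = (\<integral>\<^sup>+x. indicator A (y + x) \<partial>\<mu>) * indicator B y"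
        by (simp add: nn_integral_multc)
      also have "(\<integral>\<^sup>+x. indicator A (y + x) \<partial>\<mu>) = (\<integral>\<^sup>+x. indicator A x \<partial>\<mu>)"
        by (rule haar_measure_translation[OF h]) simp
      finally show "emeasure \<mu> A * indicator B y = (\<integral>\<^sup>+x. indicator A (y + x) * indicator B y \<partial>\<mu>)"
        by (simp add: s)
    qed
    also have "\<dots> = (\<integral>\<^sup>+x. (\<integral>\<^sup>+y. indicator A (y + x) * indicator B y \<partial>lborel) \<partial>\<mu>)"
      by (rule Fubini') measurable
    \<comment> \<open>Invariance of Lebesgue measure moves \<open>x\<close> from \<open>A\<close> to
      \<open>B\<close>; after another exchange of integrals, invariance of \<open>\<mu>\<close>
      removes \<open>y\<close>.\<close>
    also have "\<dots> = (\<integral>\<^sup>+x. (\<integral>\<^sup>+y. indicator A y * indicator B (y - x) \<partial>lborel) \<partial>\<mu>)"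
    proof (rule nn_integral_cong)
      fix x :: 'a
      show "(\<integral>\<^sup>+y. indicator A (y + x) * indicator B y \<partial>lborel)
         = (\<integral>\<^sup>+y. indicator A y * indicator B (y - x) \<partial>(lborel::'a measure))"
        using haar_measure_translation[OF haar_measure_lborel,
            of "\<lambda>y. indicator A y * indicator B (y - x)" x]
        by (simp add: add.commute)
    qed
    also have "\<dots> = (\<integral>\<^sup>+y. (\<integral>\<^sup>+x. indicator A y * indicator B (y - x) \<partial>\<mu>) \<partial>lborel)"
      by (rule Fubini'[symmetric]) measurable
    also have "\<dots> = (\<integral>\<^sup>+y. indicator A y * c \<partial>lborel)"
    proof (rule nn_integral_cong)
      fix y :: 'a
      have "(\<integral>\<^sup>+x. indicator B (y - x) \<partial>\<mu>) = c" unfolding c_def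
        using haar_measure_translation[OF h, of "\<lambda>x. indicator B (y - x)" y] by simp
      then show "(\<integral>\<^sup>+x. indicator A y * indicator B (y - x) \<partial>\<mu>) = indicator A y * c"
        by (simp add: nn_integral_cmult)
    qed
    also have "\<dots> = c * emeasure lborel A" by (subst nn_integral_multc) (auto simp: mult.commute)
    finally show ?thesis .
  qed
  have "c = emeasure \<mu> (uminus ` B)"
  proof -
    have "indicator B (- x) = (indicator (uminus ` B) x :: ennreal)" for x
      by (auto simp: indicator_def image_iff)
    moreover have "compact (uminus ` B)" unfolding B_def
      by (intro compact_continuous_image continuous_intros compact_cbox)
    ultimately show ?thesis unfolding c_def
      using s by (simp add: borel_compact)
  qed
  also have "\<dots> < \<infinity>"
  proof -
    have "compact (uminus ` B)" unfolding B_def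
      by (intro compact_continuous_image continuous_intros compact_cbox)
    then show ?thesis using h unfolding haar_measure_def by blast
  qed
  finally have cf: "c < \<infinity>" .
  \<comment> \<open>\<open>c = 0\<close> would make \<open>\<mu>\<close> vanish on the whole
    space.\<close>
  have "c \<noteq> 0" using key[of UNIV] h by (auto simp: haar_measure_def)
  then have pos: "0 < enn2real c" and ce: "ennreal (enn2real c) = c"
    using cf by (auto simp: enn2real_positive_iff less_top zero_less_iff_neq_zero)
  have "\<mu> = density lborel (\<lambda>_. ennreal (enn2real c))"
    by (rule measure_eqI) (use s key ce in \<open>auto simp: emeasure_density_const\<close>)
  with pos show thesis by (rule that)
qed

text \<open>Admits the normalised multiple of Lebesgue measure as a candidate in the definite
  description \<open>sympl_measure\<close>.\<close>

lemma haar_measure_density: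
  assumes "0 < C"
  shows "haar_measure (density lborel (\<lambda>_::'a::euclidean_space. ennreal C))"
proof -
  have "distr (density lborel (\<lambda>_. ennreal C)) borel (\<lambda>x. v + x)
      = density lborel (\<lambda>_. ennreal C)" for v :: 'a
  proof (rule measure_eqI)
    fix A assume "A \<in> sets (distr (density lborel (\<lambda>_. ennreal C)) borel (\<lambda>x. v + x))"
    then have A: "A \<in> sets borel" by simp
    then have A': "(\<lambda>x. v + x) -` A \<in> sets borel"
      using measurable_sets[of "\<lambda>x. v + x" borel borel A] by simp
    have "emeasure lborel A = emeasure (distr lborel borel ((+) v)) A"
      by (simp add: lborel_distr_plus)
    also have "\<dots> = emeasure lborel ((\<lambda>x. v + x) -` A)"
      using A by (simp add: emeasure_distr)
    finally show "emeasure (distr (density lborel (\<lambda>_. ennreal C)) borel (\<lambda>x. v + x)) A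
        = emeasure (density lborel (\<lambda>_. ennreal C)) A"
      using A A' by (simp add: emeasure_distr emeasure_density_const)
  qed simp
  moreover have "emeasure (density lborel (\<lambda>_. ennreal C)) K < \<infinity>" if "compact K" for K :: "'a set"
    using that emeasure_bounded_finite[OF compact_imp_bounded[OF that]]
    by (simp add: emeasure_density_const borel_compact ennreal_mult_less_top)
  ultimately show ?thesis using assms
    by (auto simp: haar_measure_def emeasure_density_const emeasure_lborel_UNIV ennreal_top_mult
        ennreal_mult_eq_top_iff)
qed

lemma linear_borel_measurable:
  fixes S :: "'a::euclidean_space \<Rightarrow> 'b::euclidean_space"
  assumes "linear S"
  shows "S \<in> borel_measurable borel"
  using assms by (simp add: borel_measurable_continuous_onI linear_continuous_on linear_conv_bounded_linear)

lemma linear_inv: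
  fixes S :: "'a::euclidean_space \<Rightarrow> 'b::euclidean_space"
  assumes "linear S" "bij S"
  shows "linear (inv S)"
  using assms by (metis linear_injective_left_inverse bij_is_inj bij_is_surj
      inv_unique_comp linear_inj_imp_surj surj_iff inj_iff o_assoc comp_id id_comp)

text \<open>The image measure is again translation invariant, because
  \<open>v + S x = S (inv S v + x)\<close>, and finite on compact sets. Uniqueness of Haar measure
  then yields the factor without determinants, also between different Euclidean types.\<close>

lemma distr_lborel_linear:
  fixes S :: "'a::euclidean_space \<Rightarrow> 'b::euclidean_space"
  assumes lin: "linear S" and bij: "bij S"
  obtains C :: real where "0 < C" "distr lborel borel S = density lborel (\<lambda>_. ennreal C)"
proof -
  have [measurable]: "S \<in> borel_measurable borel" by (rule linear_borel_measurable[OF lin])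
  have "haar_measure (distr lborel borel S)"
    unfolding haar_measure_def
  proof (intro conjI allI impI)
    show "sets (distr lborel borel S) = sets borel" by simp
    show "distr (distr lborel borel S) borel ((+) v) = distr lborel borel S" for v
    proof -
      have S: "S (inv S v) = v" using bij by (simp add: bij_is_surj surj_f_inv_f)
      have "distr (distr lborel borel S) borel ((+) v) = distr lborel borel (\<lambda>x. v + S x)"
        by (simp add: distr_distr comp_def)
      also have "(\<lambda>x. v + S x) = S \<circ> ((+) (inv S v))"
        by (auto simp: fun_eq_iff linear_add[OF lin] S)
      also have "distr lborel borel (S \<circ> ((+) (inv S v))) = distr (distr lborel borel ((+) (inv S v))) borel S"
        by (simp add: distr_distr)
      also have "\<dots> = distr lborel borel S" by (simp add: lborel_distr_plus)
      finally show ?thesis .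
    qed
    show "emeasure (distr lborel borel S) K < \<infinity>" if K: "compact K" for K
    proof -
      have "S -` K = inv S ` K" using bij by (simp add: bij_vimage_eq_inv_image)
      moreover have "compact (inv S ` K)"
        using K linear_inv[OF lin bij]
        by (intro compact_continuous_image) (simp_all add: linear_continuous_on linear_conv_bounded_linear)
      ultimately show ?thesis using K emeasure_bounded_finite[OF compact_imp_bounded]
        by (simp add: emeasure_distr borel_compact)
    qed
    show "emeasure (distr lborel borel S) UNIV \<noteq> 0"
      by (simp add: emeasure_distr emeasure_lborel_UNIV)
  qed
  then show thesis using that by (rule haar_measure_eq_lborel)
qed

text \<open>One constant serves nonnegative and complex integrals, so a value read off from the
  measure of a set is also the factor for complex integrands.\<close>

lemma lborel_linear_substitution:
  fixes S :: "'a::euclidean_space \<Rightarrow> 'b::euclidean_space"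
  assumes lin: "linear S" and bij: "bij S"
  obtains C :: real where "0 < C"
    "\<And>f. f \<in> borel_measurable borel \<Longrightarrow> (\<integral>\<^sup>+x. f (S x) \<partial>lborel) = ennreal C * (\<integral>\<^sup>+x. f x \<partial>lborel)"
    "\<And>f::'b \<Rightarrow> complex. f \<in> borel_measurable borel \<Longrightarrow> (LINT x|lborel. f (S x)) = complex_of_real C * (LINT x|lborel. f x)"
proof -
  have [measurable]: "S \<in> borel_measurable borel" by (rule linear_borel_measurable[OF lin])
  obtain C :: real where C: "0 < C" "distr lborel borel S = density lborel (\<lambda>_. ennreal C)"
    using distr_lborel_linear[OF lin bij] .
  show thesis
  proof
    show "0 < C" by fact
    show "(\<integral>\<^sup>+x. f (S x) \<partial>lborel) = ennreal C * (\<integral>\<^sup>+x. f x \<partial>lborel)" if [measurable]: "f \<in> borel_measurable borel" for f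
    proof -
      have "(\<integral>\<^sup>+x. f (S x) \<partial>lborel) = (\<integral>\<^sup>+x. f x \<partial>distr lborel borel S)"
        by (simp add: nn_integral_distr)
      also have "\<dots> = ennreal C * (\<integral>\<^sup>+x. f x \<partial>lborel)"
        unfolding C(2) by (simp add: nn_integral_density nn_integral_cmult)
      finally show ?thesis .
    qed
    show "(LINT x|lborel. f (S x)) = complex_of_real C * (LINT x|lborel. f x)"
      if [measurable]: "f \<in> borel_measurable borel" for f :: "'b \<Rightarrow> complex"
    proof -
      have "(LINT x|lborel. f (S x)) = (LINT x|distr lborel borel S. f x)"
        by (simp add: integral_distr)
      also have "\<dots> = (LINT x|lborel. C *\<^sub>R f x)"
        unfolding C(2) using C(1) by (simp add: integral_density)
      finally show ?thesis by (simp add: scaleR_conv_of_real)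
    qed
  qed
qed

text \<open>As \<open>measure\<close> sends infinite values to 0, positivity needs finiteness of the
  volume as well. Both are contained in the density constant of \<open>inv S\<close>, since the
  image of the cube is its preimage under \<open>inv S\<close>.\<close>

lemma jacobian_pos:
  fixes S :: "'a::euclidean_space \<Rightarrow> 'b::euclidean_space"
  assumes lin: "linear S" and bij: "bij S"
  shows "0 < jacobian S"
proof -
  have lin': "linear (inv S)" by (rule linear_inv[OF lin bij])
  have [measurable]: "inv S \<in> borel_measurable borel" by (rule linear_borel_measurable[OF lin'])
  obtain C :: real where C: "0 < C" "distr lborel borel (inv S) = density lborel (\<lambda>_. ennreal C)"
    using distr_lborel_linear[OF lin' bij_imp_bij_inv[OF bij]] .
  have "S ` cbox 0 One = inv S -` cbox 0 One"
    using bij by (metis bij_imp_bij_inv bij_vimage_eq_inv_image inv_inv_eq)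
  then have "emeasure lborel (S ` cbox 0 One) = emeasure (distr lborel borel (inv S)) (cbox 0 One)"
    by (simp add: emeasure_distr)
  also have "\<dots> = C" unfolding C(2)
    by (simp add: emeasure_density_const emeasure_lborel_cbox_eq)
  finally show ?thesis using C(1) by (simp add: jacobian_def measure_def)
qed


section \<open>Mixed Lebesgue norms\<close>

lemma ennreal_powr_measurable [measurable]:
  assumes [measurable]: "f \<in> borel_measurable M"
  shows "(\<lambda>x. ennreal_powr (f x) r) \<in> borel_measurable M"
  unfolding ennreal_powr_def by measurable

lemma ennreal_powr_ennreal: "0 \<le> x \<Longrightarrow> ennreal_powr (ennreal x) r = ennreal (x powr r)"
  by (simp add: ennreal_powr_def)

lemma ennreal_powr_top [simp]: "ennreal_powr top r = top"
  by (simp add: ennreal_powr_def)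

lemma ennreal_powr_0 [simp]: "ennreal_powr 0 r = 0"
  by (simp add: ennreal_powr_def)

lemma ennreal_powr_mono: "x \<le> y \<Longrightarrow> 0 \<le> r \<Longrightarrow> ennreal_powr x r \<le> ennreal_powr y r"
  by (cases x; cases y)
    (auto simp: ennreal_powr_ennreal powr_mono2 top_unique)

lemma ennreal_powr_mult:
  assumes "0 < r"
  shows "ennreal_powr (x * y) r = ennreal_powr x r * ennreal_powr y r"
proof (cases x; cases y)
  fix a b :: real
  assume "x = ennreal a" "y = ennreal b" "0 \<le> a" "0 \<le> b"
  then show ?thesis
    by (simp add: ennreal_powr_ennreal powr_mult flip: ennreal_mult)
qed (use assms in \<open>auto simp: ennreal_powr_ennreal ennreal_mult_top ennreal_top_mult\<close>)

lemma ennreal_powr_powr: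
  assumes "0 < r" "0 < s"
  shows "ennreal_powr (ennreal_powr x r) s = ennreal_powr x (r * s)"
  by (cases x) (auto simp: ennreal_powr_ennreal powr_powr)

lemma ennreal_powr_one [simp]: "ennreal_powr x 1 = x"
  by (cases x) (auto simp: ennreal_powr_ennreal)

lemma Lp_norm_top: "Lp_norm top M f = esssup M f"
  by (simp add: Lp_norm_def)

lemma Lp_norm_finite:
  "p \<noteq> top \<Longrightarrow> Lp_norm p M f
     = ennreal_powr (\<integral>\<^sup>+ x. ennreal_powr (f x) (enn2real p) \<partial>M) (1 / enn2real p)"
  by (simp add: Lp_norm_def)

lemma enn2real_ge_1: "1 \<le> p \<Longrightarrow> p \<noteq> top \<Longrightarrow> 1 \<le> enn2real p"
  by (cases p) auto

lemma Lp_norm_mono: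
  assumes "f \<in> borel_measurable M" "\<And>x. f x \<le> g x" "1 \<le> p"
  shows "Lp_norm p M f \<le> Lp_norm p M g"
proof (cases "p = top")
  case True
  then show ?thesis using assms by (simp add: Lp_norm_top esssup_mono)
next
  case False
  then show ?thesis using assms enn2real_ge_1[OF assms(3)]
    by (auto simp: Lp_norm_finite intro!: ennreal_powr_mono nn_integral_mono)
qed

lemma esssup_le_iff:
  fixes f :: "'a \<Rightarrow> ennreal"
  assumes "f \<in> borel_measurable M"
  shows "esssup M f \<le> c \<longleftrightarrow> (AE x in M. f x \<le> c)"
proof
  assume "esssup M f \<le> c"
  then show "AE x in M. f x \<le> c" using esssup_AE[of f M] by (auto elim: order_trans)
qed (use assms in auto)

lemma Lp_norm_cmult:
  assumes [measurable]: "f \<in> borel_measurable M" and "1 \<le> p" "0 < c"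
  shows "Lp_norm p M (\<lambda>x. ennreal c * f x) = ennreal c * Lp_norm p M f"
proof (cases "p = top")
  case True
  \<comment> \<open>Scaling by \<open>c\<close> is undone by scaling with \<open>1 / c\<close>, so
    the upper bounds of the two essential suprema correspond.\<close>
  have iff: "ennreal c * x \<le> y \<longleftrightarrow> x \<le> ennreal (1 / c) * y" for x y :: ennreal
  proof -
    have one: "ennreal c * ennreal (1 / c) = 1" "ennreal (1 / c) * ennreal c = 1"
      using \<open>0 < c\<close> by (simp_all flip: ennreal_mult)
    have "x \<le> ennreal (1 / c) * y" if "ennreal c * x \<le> y"
      using mult_left_mono[OF that, of "ennreal (1 / c)"] one by (simp add: mult.assoc[symmetric])
    moreover have "ennreal c * x \<le> y" if "x \<le> ennreal (1 / c) * y"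
      using mult_left_mono[OF that, of "ennreal c"] one by (simp add: mult.assoc[symmetric])
    ultimately show ?thesis by blast
  qed
  have "esssup M (\<lambda>x. ennreal c * f x) \<le> y \<longleftrightarrow> ennreal c * esssup M f \<le> y" for y
    by (simp add: esssup_le_iff iff)
  then show ?thesis unfolding True Lp_norm_top by (meson antisym order_refl)
next
  case False
  define r where "r = enn2real p"
  have r: "1 \<le> r" using enn2real_ge_1[OF assms(2) False] by (simp add: r_def)
  then show ?thesis using False
    by (simp add: Lp_norm_finite ennreal_powr_mult nn_integral_cmult ennreal_powr_powr flip: r_def)
qed

text \<open>For infinite \<open>p\<close>, a sublevel set of the essential supremum is the set where
  the integral of the indicator of \<open>f x y > c\<close> vanishes, and that integral is
  measurable in \<open>x\<close> by Tonelli.\<close>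

lemma (in sigma_finite_measure) Lp_norm_measurable:
  assumes [measurable]: "(\<lambda>(x, y). f x y) \<in> borel_measurable (N \<Otimes>\<^sub>M M)"
  shows "(\<lambda>x. Lp_norm p M (f x)) \<in> borel_measurable N"
proof (cases "p = top")
  case True
  have "{x \<in> space N. esssup M (f x) \<le> c} \<in> sets N" for c
  proof -
    have "{x \<in> space N. esssup M (f x) \<le> c} = {x \<in> space N. (\<integral>\<^sup>+y. (if f x y \<le> c then 0 else 1) \<partial>M) = 0}"
    proof (intro Collect_cong conj_cong refl)
      fix x assume "x \<in> space N"
      then have [measurable]: "f x \<in> borel_measurable M" by measurable
      show "(esssup M (f x) \<le> c) = ((\<integral>\<^sup>+y. (if f x y \<le> c then 0 else 1) \<partial>M) = 0)"
        by (subst nn_integral_0_iff_AE) (auto simp: esssup_le_iff intro!: AE_cong)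
    qed
    also have "\<dots> \<in> sets N" by measurable
    finally show ?thesis .
  qed
  then show ?thesis unfolding True Lp_norm_top by (rule borel_measurableI_le)
next
  case False
  then show ?thesis unfolding Lp_norm_finite[OF False] by measurable
qed

text \<open>The convex power function lies above its tangent at \<open>\<rho>\<close>; the constant
  term is moved to the other side to avoid subtraction of extended reals. For \<open>1 < r\<close>
  this is Young's inequality with the conjugate exponents \<open>r\<close> and
  \<open>r / (r - 1)\<close>.\<close>

lemma powr_tangent:
  fixes t :: ennreal
  assumes r: "1 \<le> r" and \<rho>: "0 < \<rho>"
  shows "ennreal (r * \<rho> powr (r - 1)) * t \<le> ennreal_powr t r + ennreal ((r - 1) * \<rho> powr r)"
proof (cases t)
  case (real x)
  have "r * \<rho> powr (r - 1) * x \<le> x powr r + (r - 1) * \<rho> powr r"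
  proof (cases "r = 1")
    case False
    then have r1: "1 < r" using r by simp
    have "x * \<rho> powr (r - 1) \<le> x powr r / r + (\<rho> powr (r - 1)) powr (r / (r - 1)) / (r / (r - 1))"
      by (rule Youngs_inequality) (use r1 real in \<open>auto simp: field_simps\<close>)
    also have "(\<rho> powr (r - 1)) powr (r / (r - 1)) = \<rho> powr r"
      using r1 by (simp add: powr_powr)
    finally have "r * (x * \<rho> powr (r - 1)) \<le> r * (x powr r / r + \<rho> powr r / (r / (r - 1)))"
      using r1 by (intro mult_left_mono) auto
    also have "\<dots> = x powr r + (r - 1) * \<rho> powr r"
      using r1 by (simp add: distrib_left)
    finally show ?thesis by (simp add: mult_ac)
  qed (use real \<rho> in simp)
  then show ?thesis using real r
    by (simp add: ennreal_powr_ennreal flip: ennreal_mult ennreal_plus)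
next
  case top
  then show ?thesis by simp
qed

text \<open>Convexity in the form of \<open>powr_tangent\<close> at \<open>\<rho> = G / A\<close> replaces the usual duality
  argument: with \<open>N s\<close> the norm of \<open>F(\<cdot>, s)\<close> and \<open>A = \<integral> N\<close>, the measure \<open>N / A\<close> is a
  probability, and Jensen's inequality bounds \<open>(G / A)\<^sup>r\<close> by the average of \<open>(F / N)\<^sup>r\<close>.\<close>

lemma (in pair_sigma_finite) Lp_norm_nn_integral_le:
  assumes F[measurable]: "(\<lambda>(x, s). F x s) \<in> borel_measurable (M1 \<Otimes>\<^sub>M M2)" and p: "1 \<le> p"
  shows "Lp_norm p M1 (\<lambda>x. \<integral>\<^sup>+s. F x s \<partial>M2) \<le> (\<integral>\<^sup>+s. Lp_norm p M1 (\<lambda>x. F x s) \<partial>M2)"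
proof -
  have F'[measurable]: "(\<lambda>(s, x). F x s) \<in> borel_measurable (M2 \<Otimes>\<^sub>M M1)"
    using measurable_compose[OF measurable_pair_swap' F] by (simp add: split_beta' comp_def)
  define N where "N s = Lp_norm p M1 (\<lambda>x. F x s)" for s
  have N[measurable]: "N \<in> borel_measurable M2"
    unfolding N_def by (rule M1.Lp_norm_measurable) (rule F')
  define A where "A = (\<integral>\<^sup>+s. N s \<partial>M2)"
  define G where "G x = (\<integral>\<^sup>+s. F x s \<partial>M2)" for x
  have G[measurable]: "G \<in> borel_measurable M1" unfolding G_def by measurable
  have cancel: "x / y * y = x" if "y \<noteq> 0" "y \<noteq> top" for x y :: ennreal
    using that ennreal_mult_divide_eq[of y x]
    by (simp add: divide_ennreal_def mult.assoc mult.commute[of "inverse y"] less_top)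
  have "Lp_norm p M1 G \<le> A"
  proof (cases "p = top")
    case True
    \<comment> \<open>Both orders of the two almost-everywhere quantifiers describe a null set of
      the product, so the bound holds for almost all \<open>s\<close> at almost every
      \<open>x\<close>.\<close>
    have "AE s in M2. AE x in M1. F x s \<le> N s"
      unfolding N_def True Lp_norm_top by (intro AE_I2 esssup_AE)
    then have "AE x in M1. AE s in M2. F x s \<le> N s"
      by (subst AE_commute) (auto simp: measurable_split_conv)
    then have "AE x in M1. G x \<le> A"
      by eventually_elim (auto simp: G_def A_def intro!: nn_integral_mono_AE)
    then show ?thesis unfolding True Lp_norm_top by (intro esssup_I) auto
  next
    case False
    define r where "r = enn2real p"
    have r: "1 \<le> r" using enn2real_ge_1[OF p False] by (simp add: r_def)
    have Np: "ennreal_powr (N s) r = (\<integral>\<^sup>+x. ennreal_powr (F x s) r \<partial>M1)" for s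
      using r by (simp add: N_def Lp_norm_finite[OF False] ennreal_powr_powr flip: r_def)
    \<comment> \<open>The quotient \<open>F x s / N s\<close> is useless where
      \<open>N s = 0\<close>; the numerator vanishes there for almost every \<open>x\<close>, so
      cancellation still holds.\<close>
    have "AE s in M2. AE x in M1. N s = 0 \<longrightarrow> F x s = 0"
    proof (rule AE_I2)
      fix s assume s: "s \<in> space M2"
      have [measurable]: "(\<lambda>x. F x s) \<in> borel_measurable M1" using s by measurable
      show "AE x in M1. N s = 0 \<longrightarrow> F x s = 0"
      proof (cases "N s = 0")
        case True
        then have "(\<integral>\<^sup>+x. ennreal_powr (F x s) r \<partial>M1) = 0" using Np[of s] by simp
        then have "AE x in M1. ennreal_powr (F x s) r = 0"
          by (simp add: nn_integral_0_iff_AE)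
        then show ?thesis
        proof eventually_elim
          case (elim x)
          then show ?case
            by (cases "F x s") (auto simp: ennreal_powr_ennreal)
        qed
      qed simp
    qed
    then have zero: "AE x in M1. AE s in M2. N s = 0 \<longrightarrow> F x s = 0"
      by (subst AE_commute) (auto simp: measurable_split_conv)
    consider "A = top" | "A = 0" | "A \<noteq> 0" "A \<noteq> top" by blast
    then show ?thesis
    proof cases
      case 2
      then have "AE s in M2. N s = 0" by (simp add: A_def nn_integral_0_iff_AE)
      then have "AE x in M1. AE s in M2. F x s = 0"
        using zero by (auto elim: eventually_mono)
      then have "AE x in M1. G x = 0"
        by eventually_elim (simp add: G_def nn_integral_0_iff_AE cong: nn_integral_cong_AE)
      then have "(\<integral>\<^sup>+x. ennreal_powr (G x) r \<partial>M1) = (\<integral>\<^sup>+x. 0 \<partial>M1)"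
        by (intro nn_integral_cong_AE) auto
      then show ?thesis using r by (simp add: Lp_norm_finite[OF False] flip: r_def)
    next
      case 3
      then obtain a where a: "A = ennreal a" "0 < a"
        by (cases A) (auto simp: less_le)
      have fin: "AE s in M2. N s \<noteq> top"
        using nn_integral_PInf_AE[of N M2] 3 by (auto simp: A_def)
      have jensen: "AE x in M1. ennreal_powr (G x / A) r * A
          \<le> (\<integral>\<^sup>+s. ennreal_powr (F x s / N s) r * N s \<partial>M2)"
        using zero AE_space
      proof eventually_elim
        case (elim x)
        have [measurable]: "F x \<in> borel_measurable M2" using elim(2) by measurable
        define I where "I = (\<integral>\<^sup>+s. ennreal_powr (F x s / N s) r * N s \<partial>M2)"
        \<comment> \<open>The tangent at \<open>\<rho>\<close>, multiplied by \<open>N s\<close> and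
          integrated over \<open>s\<close>. A real \<open>\<rho>\<close> not exceeding
          \<open>G x / A\<close> replaces the quotient itself, which may be infinite.\<close>
        have bound: "ennreal (\<rho> powr r) * A \<le> I" if \<rho>: "0 < \<rho>" "ennreal \<rho> \<le> G x / A" for \<rho>
        proof -
          have "ennreal (r * \<rho> powr r) * A = ennreal (r * \<rho> powr (r - 1)) * (ennreal \<rho> * A)"
            using r \<rho> by (simp add: mult.assoc[symmetric] powr_diff flip: ennreal_mult)
          also have "\<dots> \<le> ennreal (r * \<rho> powr (r - 1)) * (G x / A * A)"
            by (intro mult_left_mono mult_right_mono \<rho>) auto
          also have "G x / A * A = G x" by (rule cancel) (use 3 in auto)
          also have "ennreal (r * \<rho> powr (r - 1)) * G x
              = (\<integral>\<^sup>+s. ennreal (r * \<rho> powr (r - 1)) * F x s \<partial>M2)"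
            by (simp add: G_def nn_integral_cmult)
          also have "\<dots> \<le> (\<integral>\<^sup>+s. ennreal_powr (F x s / N s) r * N s
              + ennreal ((r - 1) * \<rho> powr r) * N s \<partial>M2)"
          proof (rule nn_integral_mono_AE)
            show "AE s in M2. ennreal (r * \<rho> powr (r - 1)) * F x s
              \<le> ennreal_powr (F x s / N s) r * N s + ennreal ((r - 1) * \<rho> powr r) * N s"
              using elim(1) fin
            proof eventually_elim
              case (elim s)
              have "F x s = F x s / N s * N s"
                using elim cancel[of "N s" "F x s"] by (cases "N s = 0") auto
              then have "ennreal (r * \<rho> powr (r - 1)) * F x s
                = ennreal (r * \<rho> powr (r - 1)) * (F x s / N s) * N s" by (simp add: mult.assoc)
              also have "\<dots> \<le> (ennreal_powr (F x s / N s) r + ennreal ((r - 1) * \<rho> powr r)) * N s"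
                by (intro mult_right_mono powr_tangent r \<rho>) auto
              finally show ?case by (simp add: distrib_right)
            qed
          qed
          also have "\<dots> = I + ennreal ((r - 1) * \<rho> powr r) * A"
            by (simp add: nn_integral_add nn_integral_cmult I_def A_def)
          finally have le: "ennreal (r * \<rho> powr r) * A \<le> I + ennreal ((r - 1) * \<rho> powr r) * A" .
          have "ennreal (\<rho> powr r) * A + ennreal ((r - 1) * \<rho> powr r) * A = ennreal (r * \<rho> powr r) * A"
          proof -
            have "ennreal (\<rho> powr r) + ennreal ((r - 1) * \<rho> powr r) = ennreal (r * \<rho> powr r)"
              by (subst ennreal_plus[symmetric]) (use r mult_right_mono[OF r, of "\<rho> powr r"] in \<open>auto simp: left_diff_distrib\<close>)
            then show ?thesis by (simp add: distrib_right[symmetric])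
          qed
          with le have "ennreal ((r - 1) * \<rho> powr r) * A + ennreal (\<rho> powr r) * A
              \<le> ennreal ((r - 1) * \<rho> powr r) * A + I" by (simp add: add.commute)
          then show ?thesis
            using 3 by (simp add: ennreal_add_left_cancel_le ennreal_mult_eq_top_iff)
        qed
        show ?case
        proof (cases "G x / A")
          case (real g)
          then show ?thesis using bound[of g]
            by (cases "g = 0") (auto simp: ennreal_powr_ennreal I_def)
        next
          case top
          have "I = top"
          proof (rule ccontr)
            assume "I \<noteq> top"
            then obtain i where i: "I = ennreal i" "0 \<le> i" by (cases I) auto
            \<comment> \<open>Chosen so that \<open>\<rho> * a = i + a\<close> exceeds
              \<open>i\<close>, while \<open>\<rho> powr r\<close> is at least \<open>\<rho>\<close>
              because \<open>\<rho>\<close> is at least 1.\<close>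
            define \<rho> where "\<rho> = (i / a + 1)"
            have \<rho>: "1 \<le> \<rho>" using i a by (simp add: \<rho>_def)
            have "ennreal (\<rho> powr r) * A \<le> I" using bound[of \<rho>] \<rho> top by simp
            then have "\<rho> powr r * a \<le> i"
              using i a by (simp flip: ennreal_mult)
            moreover have "\<rho> powr 1 \<le> \<rho> powr r" using \<rho> r by (intro powr_mono) auto
            ultimately have "\<rho> * a \<le> i"
              using a \<rho> by (metis less_le_not_le mult_right_mono order_trans powr_one zero_le_one)
            moreover have "\<rho> * a = i + a" using a by (simp add: \<rho>_def field_simps)
            ultimately show False using a by simp
          qed
          then show ?thesis by (simp add: I_def)
        qed
      qed
      have "(\<integral>\<^sup>+x. ennreal_powr (G x / A) r \<partial>M1) * A
          = (\<integral>\<^sup>+x. ennreal_powr (G x / A) r * A \<partial>M1)"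
        by (simp add: nn_integral_multc)
      also have "\<dots> \<le> (\<integral>\<^sup>+x. (\<integral>\<^sup>+s. ennreal_powr (F x s / N s) r * N s \<partial>M2) \<partial>M1)"
        by (rule nn_integral_mono_AE) (rule jensen)
      also have "\<dots> = (\<integral>\<^sup>+s. (\<integral>\<^sup>+x. ennreal_powr (F x s / N s) r * N s \<partial>M1) \<partial>M2)"
        by (rule Fubini'[symmetric]) measurable
      \<comment> \<open>For fixed \<open>s\<close>, the integral over \<open>x\<close> of the r-th
        power of \<open>F x s\<close> is the r-th power of \<open>N s\<close>, which the denominator
        cancels.\<close>
      also have "\<dots> \<le> (\<integral>\<^sup>+s. N s \<partial>M2)"
      proof (rule nn_integral_mono_AE)
        show "AE s in M2. (\<integral>\<^sup>+x. ennreal_powr (F x s / N s) r * N s \<partial>M1) \<le> N s"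
          using fin AE_space
        proof eventually_elim
          case (elim s)
          have [measurable]: "(\<lambda>x. F x s) \<in> borel_measurable M1" using elim(2) by measurable
          show ?case
          proof (cases "N s = 0")
            case False
            have "(\<integral>\<^sup>+x. ennreal_powr (F x s / N s) r * N s \<partial>M1)
               = (\<integral>\<^sup>+x. ennreal_powr (F x s) r \<partial>M1) * (ennreal_powr (inverse (N s)) r * N s)"
              using r by (simp add: divide_ennreal_def ennreal_powr_mult mult.assoc nn_integral_multc)
            also have "\<dots> = ennreal_powr (N s * inverse (N s)) r * N s"
              using r by (simp add: Np[symmetric] ennreal_powr_mult mult.assoc)
            also have "N s * inverse (N s) = 1"
              using False elim(1) by (simp add: ennreal_divide_self less_top flip: divide_ennreal_def)
            also have "ennreal_powr 1 r = 1"
              using ennreal_powr_ennreal[of 1 r] by simp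
            finally show ?thesis by simp
          qed simp
        qed
      qed
      finally have "(\<integral>\<^sup>+x. ennreal_powr (G x / A) r \<partial>M1) * A \<le> A" by (simp add: A_def)
      \<comment> \<open>Division by \<open>A\<close> shows that the r-th power of
        \<open>G / A\<close> has integral at most 1; homogeneity then restores the factor
        \<open>A\<close>.\<close>
      then have "(\<integral>\<^sup>+x. ennreal_powr (G x / A) r \<partial>M1) * A / A \<le> A / A"
        by (rule divide_right_mono_ennreal)
      then have le1: "(\<integral>\<^sup>+x. ennreal_powr (G x / A) r \<partial>M1) \<le> 1"
        using 3 by (simp add: ennreal_mult_divide_eq ennreal_divide_self less_top)
      have "G x = A * (G x / A)" for x
        using 3 cancel[of A "G x"] by (simp add: mult.commute)
      then have "ennreal_powr (G x) r = ennreal_powr A r * ennreal_powr (G x / A) r" for x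
        using r by (metis ennreal_powr_mult less_le_trans zero_less_one)
      then have "(\<integral>\<^sup>+x. ennreal_powr (G x) r \<partial>M1)
          = ennreal_powr A r * (\<integral>\<^sup>+x. ennreal_powr (G x / A) r \<partial>M1)"
        by (simp add: nn_integral_cmult)
      also have "\<dots> \<le> ennreal_powr A r * 1" by (intro mult_left_mono le1) auto
      finally have "Lp_norm p M1 G \<le> ennreal_powr (ennreal_powr A r) (1 / r)"
        using r by (auto simp: Lp_norm_finite[OF False] intro!: ennreal_powr_mono simp flip: r_def)
      then show ?thesis using r by (simp add: ennreal_powr_powr)
    qed simp
  qed
  then show ?thesis by (simp add: G_def[abs_def] A_def N_def)
qed

text \<open>The factor is fixed before \<open>f\<close> and \<open>v\<close>: in the application
  \<open>v\<close> depends on the frequency, and only a uniform factor can be taken out of the outer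
  norm. It is the substitution constant to the power \<open>1 / p\<close>, and 1 for infinite
  \<open>p\<close> because null sets are preserved.\<close>

lemma Lp_norm_affine:
  fixes S :: "'a::euclidean_space \<Rightarrow> 'b::euclidean_space"
  assumes lin: "linear S" and bij: "bij S" and p: "1 \<le> p"
  obtains C :: real where "0 < C" "\<And>f v. f \<in> borel_measurable borel \<Longrightarrow>
     Lp_norm p lborel (\<lambda>x. f (S x + v)) = ennreal C * Lp_norm p lborel f"
proof -
  have [measurable]: "S \<in> borel_measurable borel" by (rule linear_borel_measurable[OF lin])
  obtain C :: real where C: "0 < C"
    and nn: "\<And>f. f \<in> borel_measurable borel \<Longrightarrow> (\<integral>\<^sup>+x. f (S x) \<partial>lborel) = ennreal C * (\<integral>\<^sup>+x. f x \<partial>lborel)"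
    using lborel_linear_substitution[OF lin bij] by metis
  have nn': "(\<integral>\<^sup>+x. f (S x + v) \<partial>lborel) = ennreal C * (\<integral>\<^sup>+x. f x \<partial>lborel)"
    if [measurable]: "f \<in> borel_measurable borel" for f v
    using nn[of "\<lambda>x. f (x + v)"] haar_measure_translation[OF haar_measure_lborel, of f v]
    by (simp add: add.commute)
  show thesis
  proof (cases "p = top")
    case True
    have "Lp_norm p lborel (\<lambda>x. f (S x + v)) = ennreal 1 * Lp_norm p lborel f"
      if [measurable]: "f \<in> borel_measurable borel" for f v
    proof -
      have "(AE x in lborel. f (S x + v) \<le> c) \<longleftrightarrow> (AE x in lborel. f x \<le> c)" for c
      proof -
        have "(AE x in lborel. f (S x + v) \<le> c)
            \<longleftrightarrow> (\<integral>\<^sup>+x. (if f (S x + v) \<le> c then 0 else 1) \<partial>lborel) = 0"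
          by (subst nn_integral_0_iff_AE) (auto intro!: AE_cong)
        also have "\<dots> \<longleftrightarrow> (\<integral>\<^sup>+x. (if f x \<le> c then 0 else 1) \<partial>lborel) = 0"
          using nn'[of "\<lambda>x. if f x \<le> c then 0 else 1" v] C by simp
        also have "\<dots> \<longleftrightarrow> (AE x in lborel. f x \<le> c)"
          by (subst nn_integral_0_iff_AE) (auto intro!: AE_cong)
        finally show ?thesis .
      qed
      then have "esssup lborel (\<lambda>x. f (S x + v)) \<le> c \<longleftrightarrow> esssup lborel f \<le> c" for c
        by (simp add: esssup_le_iff)
      then have "esssup lborel (\<lambda>x. f (S x + v)) = esssup lborel f" by (meson antisym order_refl)
      then show ?thesis using True by (simp add: Lp_norm_top)
    qed
    then show thesis by (rule that[OF zero_less_one])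
  next
    case False
    define r where "r = enn2real p"
    have r: "1 \<le> r" using enn2real_ge_1[OF p False] by (simp add: r_def)
    show thesis
    proof
      show "0 < C powr (1 / r)" using C by simp
      show "Lp_norm p lborel (\<lambda>x. f (S x + v)) = ennreal (C powr (1 / r)) * Lp_norm p lborel f"
        if [measurable]: "f \<in> borel_measurable borel" for f v
        using nn'[of "\<lambda>x. ennreal_powr (f x) r" v] r C
        by (simp add: Lp_norm_finite[OF False] ennreal_powr_mult ennreal_powr_ennreal flip: r_def)
    qed
  qed
qed

section \<open>Dominated families of Schwartz functions\<close>

definition partial_deriv :: "'a::euclidean_space \<Rightarrow> ('a \<Rightarrow> complex) \<Rightarrow> 'a \<Rightarrow> complex" where
  "partial_deriv v f = (\<lambda>x. frechet_derivative f (at x) v)"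

lemma iter_deriv_Cons: "iter_deriv (v # vs) f = partial_deriv v (iter_deriv vs f)"
  by (simp add: partial_deriv_def)

lemma iter_deriv_append: "iter_deriv (vs @ ws) f = iter_deriv vs (iter_deriv ws f)"
  by (induction vs) auto

lemma partial_deriv_eqI: "(f has_derivative f') (at x) \<Longrightarrow> partial_deriv v f x = f' v"
  by (simp add: partial_deriv_def frechet_derivative_at[symmetric])

lemma has_derivative_partial_deriv:
  "f differentiable (at x) \<Longrightarrow> (f has_derivative (\<lambda>v. partial_deriv v f x)) (at x)"
  by (simp add: partial_deriv_def frechet_derivative_works[symmetric])

lemma partial_deriv_add:
  "f differentiable (at x) \<Longrightarrow> g differentiable (at x) \<Longrightarrow>
   partial_deriv v (\<lambda>x. f x + g x) x = partial_deriv v f x + partial_deriv v g x"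
  by (intro partial_deriv_eqI derivative_intros has_derivative_partial_deriv)

lemma partial_deriv_mult:
  "f differentiable (at x) \<Longrightarrow> g differentiable (at x) \<Longrightarrow>
   partial_deriv v (\<lambda>x. f x * g x) x = f x * partial_deriv v g x + partial_deriv v f x * g x"
  by (rule partial_deriv_eqI[OF has_derivative_mult]) (auto intro: has_derivative_partial_deriv)

lemma partial_deriv_cmult:
  "f differentiable (at x) \<Longrightarrow> partial_deriv v (\<lambda>x. c * f x) x = c * partial_deriv v f x"
  by (rule partial_deriv_eqI[OF has_derivative_mult_right[OF has_derivative_partial_deriv]])

lemma partial_deriv_expand:
  assumes "f differentiable (at x)"
  shows "partial_deriv v f x = (\<Sum>b\<in>Basis. complex_of_real (v \<bullet> b) * partial_deriv b f x)"
proof -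
  interpret linear "\<lambda>v. partial_deriv v f x"
    using has_derivative_partial_deriv[OF assms] by (rule has_derivative_linear)
  have "partial_deriv v f x = partial_deriv (\<Sum>b\<in>Basis. (v \<bullet> b) *\<^sub>R b) f x"
    by (simp add: euclidean_representation)
  also have "\<dots> = (\<Sum>b\<in>Basis. (v \<bullet> b) *\<^sub>R partial_deriv b f x)"
    by (simp add: sum scale)
  finally show ?thesis by (simp add: scaleR_conv_of_real)
qed

lemma has_derivative_inner_of_real:
  "((\<lambda>x. complex_of_real (x \<bullet> v)) has_derivative (\<lambda>h. complex_of_real (h \<bullet> v))) (at x)"
  by (intro derivative_intros)

section \<open>Cones of weights and dominated families\<close>

definition weight_cone :: "('i \<Rightarrow> real) set \<Rightarrow> bool" where
  "weight_cone W \<longleftrightarrow> (\<forall>M\<in>W. \<forall>N\<in>W. (\<lambda>i. M i + N i) \<in> W) \<and> (\<forall>c\<ge>0. \<forall>N\<in>W. (\<lambda>i. c * N i) \<in> W)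
     \<and> (\<lambda>i. 0) \<in> W"

lemma weight_cone_add: "weight_cone W \<Longrightarrow> M \<in> W \<Longrightarrow> N \<in> W \<Longrightarrow> (\<lambda>i. M i + N i) \<in> W"
  by (auto simp: weight_cone_def)

lemma weight_cone_cmult: "weight_cone W \<Longrightarrow> N \<in> W \<Longrightarrow> 0 \<le> c \<Longrightarrow> (\<lambda>i. c * N i) \<in> W"
  by (auto simp: weight_cone_def)

lemma weight_cone_sum:
  assumes "weight_cone W" "finite A" "\<And>a. a \<in> A \<Longrightarrow> N a \<in> W"
  shows "(\<lambda>i. \<Sum>a\<in>A. N a i) \<in> W"
  using assms(2,3,1) by (induction A rule: finite_induct) (auto simp: weight_cone_def)

lemma weight_cone_UNIV [simp]: "weight_cone UNIV"
  by (simp add: weight_cone_def)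

text \<open>Continuous operators on the Schwartz space, continuity in a parameter and growth in a
  parameter are all instances of the following, for suitable cones \<open>W\<close> of weights.\<close>

definition dominated :: "('i \<Rightarrow> real) set \<Rightarrow> 'i set \<Rightarrow> ('i \<Rightarrow> 'a::euclidean_space \<Rightarrow> complex) \<Rightarrow> bool" where
  "dominated W I F \<longleftrightarrow> (\<forall>i\<in>I. smooth (F i)) \<and>
     (\<forall>k. \<forall>vs\<in>lists Basis. \<exists>N\<in>W. \<forall>i\<in>I. \<forall>x. (1 + norm x) ^ k * norm (iter_deriv vs (F i) x) \<le> N i)"

lemma dominated_bound:
  assumes "dominated W I F" "vs \<in> lists Basis"
  obtains N where "N \<in> W" "\<And>i x. i \<in> I \<Longrightarrow> (1 + norm x) ^ k * norm (iter_deriv vs (F i) x) \<le> N i"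
  using assms by (auto simp: dominated_def) blast

lemma dominated_schwartz:
  fixes F :: "'i \<Rightarrow> 'b::euclidean_space \<Rightarrow> complex"
  assumes "dominated W I F" "i \<in> I"
  shows "F i \<in> schwartz"
proof -
  have "bounded (range (\<lambda>x. (1 + norm x) ^ k * norm (iter_deriv vs (F i) x)))"
    if vs: "vs \<in> lists Basis" for k vs
  proof -
    obtain N where "\<And>i x. i \<in> I \<Longrightarrow> (1 + norm x) ^ k * norm (iter_deriv vs (F i) x) \<le> N i"
      using dominated_bound[OF assms(1) vs] by metis
    then have "\<forall>y\<in>range (\<lambda>x. (1 + norm x) ^ k * norm (iter_deriv vs (F i) x)). norm y \<le> N i"
      using assms(2) by (auto simp: abs_mult)
    then show ?thesis unfolding bounded_iff by blast
  qed
  then show ?thesis using assms by (auto simp: dominated_def schwartz_def)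
qed

text \<open>A single function is a family over one index with arbitrary weights, so each closure
  property of \<open>dominated\<close> specialises to \<open>schwartz\<close>.\<close>

lemma schwartz_iff_dominated: "f \<in> schwartz \<longleftrightarrow> dominated UNIV UNIV (\<lambda>_::unit. f)"
proof
  assume f: "f \<in> schwartz"
  have "\<exists>N. \<forall>x. (1 + norm x) ^ k * norm (iter_deriv vs f x) \<le> N" if "vs \<in> lists Basis" for k vs
  proof -
    have "bounded (range (\<lambda>x. (1 + norm x) ^ k * norm (iter_deriv vs f x)))"
      using f that by (auto simp: schwartz_def)
    then show ?thesis unfolding bounded_iff by (auto dest: abs_le_D1)
  qed
  then have "\<exists>N\<in>UNIV. \<forall>i\<in>UNIV. \<forall>x. (1 + norm x) ^ k * norm (iter_deriv vs f x) \<le> N (i :: unit)"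
    if "vs \<in> lists Basis" for k vs using that by fastforce
  then show "dominated UNIV UNIV (\<lambda>_::unit. f)"
    using f by (simp add: dominated_def schwartz_def)
qed (auto dest: dominated_schwartz)

lemma schwartz_smooth: "f \<in> schwartz \<Longrightarrow> smooth f"
  by (simp add: schwartz_def)

lemma smooth_differentiable: "smooth f \<Longrightarrow> vs \<in> lists Basis \<Longrightarrow> iter_deriv vs f differentiable (at x)"
  by (simp add: smooth_def)

lemma schwartz_differentiable [intro]: "f \<in> schwartz \<Longrightarrow> f differentiable (at x)"
  using smooth_differentiable[of f "[]"] by (simp add: schwartz_smooth)

lemma schwartz_iter_deriv: "f \<in> schwartz \<Longrightarrow> vs \<in> lists Basis \<Longrightarrow> iter_deriv vs f \<in> schwartz"
  by (auto simp: schwartz_def smooth_def simp flip: iter_deriv_append)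

lemma schwartz_partial_deriv:
  "f \<in> schwartz \<Longrightarrow> b \<in> Basis \<Longrightarrow> partial_deriv b f \<in> schwartz"
  using schwartz_iter_deriv[of f "[b]"] by (simp add: partial_deriv_def)

lemma schwartz_bound:
  assumes "f \<in> schwartz" "vs \<in> lists Basis"
  obtains C where "0 \<le> C" "\<And>x. (1 + norm x) ^ k * norm (iter_deriv vs f x) \<le> C"
proof -
  have "dominated UNIV UNIV (\<lambda>_::unit. f)" using assms(1) by (simp add: schwartz_iff_dominated)
  from dominated_bound[OF this assms(2), of k] obtain N :: "unit \<Rightarrow> real"
    where N: "\<And>x. (1 + norm x) ^ k * norm (iter_deriv vs f x) \<le> N ()"
    by (metis UNIV_I)
  show thesis
  proof
    show "0 \<le> N ()" by (rule order_trans[OF _ N[of 0]]) simp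
  qed (rule N)
qed

lemma schwartz_decay:
  assumes "f \<in> schwartz"
  obtains C where "0 \<le> C" "\<And>x. (1 + norm x) ^ k * norm (f x) \<le> C"
  using schwartz_bound[OF assms, of "[]" k] by auto

lemma schwartz_bounded:
  assumes "f \<in> schwartz"
  obtains C where "0 \<le> C" "\<And>x. norm (f x) \<le> C"
  using schwartz_decay[OF assms, of 0] by auto

lemma schwartz_continuous [intro]: "f \<in> schwartz \<Longrightarrow> continuous_on A f"
  by (meson schwartz_differentiable continuous_at_imp_continuous_on differentiable_imp_continuous_within)

lemma schwartz_measurable: "f \<in> schwartz \<Longrightarrow> f \<in> borel_measurable borel"
  by (intro borel_measurable_continuous_onI schwartz_continuous)

section \<open>Coinductive criteria for rapid decay\<close>

lemma norm_le_sum_coords: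
  "(1 + norm x) * norm (z::complex)
     \<le> norm z + (\<Sum>b\<in>Basis. norm (complex_of_real (x \<bullet> b) * z))"
proof -
  have "norm x * norm z \<le> (\<Sum>b\<in>Basis. \<bar>x \<bullet> b\<bar>) * norm z"
    by (intro mult_right_mono norm_le_l1) auto
  then show ?thesis by (simp add: distrib_right norm_mult sum_distrib_right)
qed

text \<open>By \<open>norm_le_sum_coords\<close>, one more factor \<open>1 + norm x\<close> costs
  finitely many coordinate multiples, which are again members of \<open>X\<close>. Plain boundedness
  of all members therefore controls every polynomial weight.\<close>

lemma weighted_bound_coinduct:
  fixes F :: "'i \<Rightarrow> 'a::euclidean_space \<Rightarrow> complex"
  assumes W: "weight_cone W" and F: "F \<in> X"
    and bd: "\<And>F. F \<in> X \<Longrightarrow> \<exists>N\<in>W. \<forall>i\<in>I. \<forall>x. norm (F i x) \<le> N i"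
    and mul: "\<And>F b. F \<in> X \<Longrightarrow> b \<in> Basis \<Longrightarrow> \<exists>G\<in>X. \<forall>i\<in>I. \<forall>x. G i x = complex_of_real (x \<bullet> b) * F i x"
  shows "\<exists>N\<in>W. \<forall>i\<in>I. \<forall>x. (1 + norm x) ^ k * norm (F i x) \<le> N i"
  using F
proof (induction k arbitrary: F)
  case 0
  then show ?case using bd[of F] by simp
next
  case (Suc k)
  obtain M where M: "M \<in> W" "\<And>i x. i \<in> I \<Longrightarrow> (1 + norm x) ^ k * norm (F i x) \<le> M i"
    using Suc by blast
  have "\<exists>N\<in>W. \<forall>i\<in>I. \<forall>x. (1 + norm x) ^ k * norm (complex_of_real (x \<bullet> b) * F i x) \<le> N i"
    if b: "b \<in> Basis" for b
  proof -
    obtain G where G: "G \<in> X" "\<And>i x. i \<in> I \<Longrightarrow> G i x = complex_of_real (x \<bullet> b) * F i x"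
      using mul[OF Suc.prems b] by blast
    show ?thesis using Suc.IH[OF G(1)] G(2) by simp
  qed
  then obtain N where N: "\<And>b. b \<in> Basis \<Longrightarrow> N b \<in> W"
      "\<And>b i x. b \<in> Basis \<Longrightarrow> i \<in> I \<Longrightarrow> (1 + norm x) ^ k * norm (complex_of_real (x \<bullet> b) * F i x) \<le> N b i"
    by metis
  show ?case
  proof (intro bexI ballI allI)
    fix i x assume i: "i \<in> I"
    have "(1 + norm x) ^ Suc k * norm (F i x) = (1 + norm x) ^ k * ((1 + norm x) * norm (F i x))"
      by simp
    also have "\<dots> \<le> (1 + norm x) ^ k * (norm (F i x) + (\<Sum>b\<in>Basis. norm (complex_of_real (x \<bullet> b) * F i x)))"
      by (intro mult_left_mono norm_le_sum_coords) auto
    also have "\<dots> \<le> M i + (\<Sum>b\<in>Basis. N b i)"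
      unfolding distrib_left sum_distrib_left using i M N by (intro add_mono sum_mono) auto
    finally show "(1 + norm x) ^ Suc k * norm (F i x) \<le> M i + (\<Sum>b\<in>Basis. N b i)" .
  next
    show "(\<lambda>i. M i + (\<Sum>b\<in>Basis. N b i)) \<in> W"
      by (intro weight_cone_add weight_cone_sum W M N) auto
  qed
qed

text \<open>\<open>X\<close> plays the role of an invariant: bounds of order zero for all its
  members, together with closure under derivatives and coordinates, give all seminorm bounds at
  once. Leibniz formulas of higher order never have to be expanded.\<close>

lemma dominated_coinduct:
  fixes F :: "'i \<Rightarrow> 'a::euclidean_space \<Rightarrow> complex"
  assumes W: "weight_cone W" and F: "F \<in> X"
    and bd: "\<And>F. F \<in> X \<Longrightarrow> \<exists>N\<in>W. \<forall>i\<in>I. \<forall>x. norm (F i x) \<le> N i"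
    and diff: "\<And>F i x. F \<in> X \<Longrightarrow> i \<in> I \<Longrightarrow> F i differentiable (at x)"
    and der: "\<And>F b. F \<in> X \<Longrightarrow> b \<in> Basis \<Longrightarrow> \<exists>G\<in>X. \<forall>i\<in>I. \<forall>x. G i x = partial_deriv b (F i) x"
    and mul: "\<And>F b. F \<in> X \<Longrightarrow> b \<in> Basis \<Longrightarrow> \<exists>G\<in>X. \<forall>i\<in>I. \<forall>x. G i x = complex_of_real (x \<bullet> b) * F i x"
  shows "dominated W I F"
proof -
  have ex: "\<exists>G\<in>X. \<forall>i\<in>I. G i = iter_deriv vs (F i)" if "vs \<in> lists Basis" for vs
    using that
  proof (induction vs rule: list.induct)
    case Nil
    then show ?case using F by auto
  next
    case (Cons v vs)
    then obtain G where G: "G \<in> X" "\<And>i. i \<in> I \<Longrightarrow> G i = iter_deriv vs (F i)" by auto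
    have v: "v \<in> Basis" using Cons.prems by auto
    obtain H where "H \<in> X" "\<forall>i\<in>I. \<forall>x. H i x = partial_deriv v (G i) x"
      using der[OF G(1) v] by blast
    then show ?case using G(2) by (intro bexI[of _ H]) (auto simp: partial_deriv_def)
  qed
  show ?thesis unfolding dominated_def
  proof (intro conjI ballI allI)
    fix i assume "i \<in> I"
    then show "smooth (F i)" unfolding smooth_def using ex diff by metis
  next
    fix k and vs :: "'a list" assume "vs \<in> lists Basis"
    then obtain G where G: "G \<in> X" "\<And>i. i \<in> I \<Longrightarrow> G i = iter_deriv vs (F i)" using ex by blast
    show "\<exists>N\<in>W. \<forall>i\<in>I. \<forall>x. (1 + norm x) ^ k * norm (iter_deriv vs (F i) x) \<le> N i"
      using weighted_bound_coinduct[OF W G(1) bd mul, of k] G(2) by simp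
  qed
qed

text \<open>Product rules yield two terms of the previous shape rather than one. Passing from
  \<open>X\<close> to its finite sums reduces this to \<open>dominated_coinduct\<close>.\<close>

lemma dominated_coinduct_sum:
  fixes F :: "'i \<Rightarrow> 'a::euclidean_space \<Rightarrow> complex"
  assumes W: "weight_cone W" and F: "F \<in> X"
    and bd: "\<And>F. F \<in> X \<Longrightarrow> \<exists>N\<in>W. \<forall>i\<in>I. \<forall>x. norm (F i x) \<le> N i"
    and diff: "\<And>F i x. F \<in> X \<Longrightarrow> i \<in> I \<Longrightarrow> F i differentiable (at x)"
    and der: "\<And>F b. F \<in> X \<Longrightarrow> b \<in> Basis \<Longrightarrow>
      \<exists>G\<in>X. \<exists>H\<in>X. \<forall>i\<in>I. \<forall>x. partial_deriv b (F i) x = G i x + H i x"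
    and mul: "\<And>F b. F \<in> X \<Longrightarrow> b \<in> Basis \<Longrightarrow>
      \<exists>G\<in>X. \<exists>H\<in>X. \<forall>i\<in>I. \<forall>x. complex_of_real (x \<bullet> b) * F i x = G i x + H i x"
  shows "dominated W I F"
proof -
  \<comment> \<open>Sums over lists: appending gives sums of sums, and the empty list gives
    zero.\<close>
  define Y where "Y = {\<lambda>i x. \<Sum>F\<leftarrow>Fs. F i x | Fs. Fs \<in> lists X}"
  have Y_add: "(\<lambda>i x. G i x + H i x) \<in> Y" if GH: "G \<in> Y" "H \<in> Y" for G H
  proof -
    obtain Gs where Gs: "Gs \<in> lists X" "G = (\<lambda>i x. \<Sum>F\<leftarrow>Gs. F i x)" using GH(1) unfolding Y_def by blast
    obtain Hs where Hs: "Hs \<in> lists X" "H = (\<lambda>i x. \<Sum>F\<leftarrow>Hs. F i x)" using GH(2) unfolding Y_def by blast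
    show ?thesis unfolding Y_def
      using Gs Hs by (intro CollectI exI[of _ "Gs @ Hs"]) auto
  qed
  have Y_X: "G \<in> Y" if "G \<in> X" for G
    unfolding Y_def using that by (intro CollectI exI[of _ "[G]"]) auto
  have Y_0: "(\<lambda>i x. 0) \<in> Y" unfolding Y_def by (intro CollectI exI[of _ "[]"]) auto
  have Y_induct: "P G" if Y: "G \<in> Y" and zero: "P (\<lambda>i x. 0)"
    and step: "\<And>G H. G \<in> X \<Longrightarrow> H \<in> Y \<Longrightarrow> P H \<Longrightarrow> P (\<lambda>i x. G i x + H i x)" for P G
  proof -
    obtain Gs where Gs: "Gs \<in> lists X" "G = (\<lambda>i x. \<Sum>F\<leftarrow>Gs. F i x)" using Y unfolding Y_def by blast
    have "P (\<lambda>i x. \<Sum>F\<leftarrow>Gs. F i x)" using Gs(1)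
    proof (induction Gs rule: list.induct)
      case (Cons G Gs)
      then have G: "G \<in> X" and Gs: "Gs \<in> lists X" by auto
      have "(\<lambda>i x. \<Sum>F\<leftarrow>Gs. F i x) \<in> Y" unfolding Y_def using Gs by blast
      from step[OF G this Cons.IH[OF Gs]] show ?case by simp
    qed (simp add: zero)
    then show ?thesis using Gs by simp
  qed
  have Ydiff: "\<forall>i\<in>I. \<forall>x. F i differentiable (at x)" if "F \<in> Y" for F
    using that by (rule Y_induct) (auto simp: diff)
  show ?thesis
  proof (rule dominated_coinduct[OF W Y_X[OF F]])
    fix F assume "F \<in> Y"
    then show "\<exists>N\<in>W. \<forall>i\<in>I. \<forall>x. norm (F i x) \<le> N i"
    proof (rule Y_induct)
      show "\<exists>N\<in>W. \<forall>i\<in>I. \<forall>x::'a. cmod 0 \<le> N i"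
        using W by (intro bexI[of _ "\<lambda>i. 0"]) (auto simp: weight_cone_def)
    next
      fix G H :: "'i \<Rightarrow> 'a \<Rightarrow> complex" assume GH: "G \<in> X" "\<exists>N\<in>W. \<forall>i\<in>I. \<forall>x. norm (H i x) \<le> N i"
      then obtain M N where "M \<in> W" "N \<in> W" "\<forall>i\<in>I. \<forall>x. norm (G i x) \<le> M i" "\<forall>i\<in>I. \<forall>x. norm (H i x) \<le> N i"
        using bd by blast
      then show "\<exists>N\<in>W. \<forall>i\<in>I. \<forall>x. norm (G i x + H i x) \<le> N i"
        by (intro bexI[of _ "\<lambda>i. M i + N i"] weight_cone_add W) (auto intro!: norm_triangle_mono)
    qed
  next
    fix F i x assume "F \<in> Y" "i \<in> I"
    then show "F i differentiable (at x)" using Ydiff by blast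
  next
    fix F and b :: 'a assume F: "F \<in> Y" and b: "b \<in> Basis"
    show "\<exists>G\<in>Y. \<forall>i\<in>I. \<forall>x. G i x = partial_deriv b (F i) x"
      using F
    proof (rule Y_induct)
      show "\<exists>G\<in>Y. \<forall>i\<in>I. \<forall>x. G i x = partial_deriv b (\<lambda>x. 0) x"
        using Y_0 by (intro bexI[of _ "\<lambda>i x. 0"]) (auto simp: partial_deriv_def)
    next
      fix G H :: "'i \<Rightarrow> 'a \<Rightarrow> complex" assume GH: "G \<in> X" "H \<in> Y" "\<exists>K\<in>Y. \<forall>i\<in>I. \<forall>x. K i x = partial_deriv b (H i) x"
      then obtain K where K: "K \<in> Y" "\<And>i x. i \<in> I \<Longrightarrow> K i x = partial_deriv b (H i) x" by blast
      obtain A B where AB: "A \<in> X" "B \<in> X" "\<And>i x. i \<in> I \<Longrightarrow> partial_deriv b (G i) x = A i x + B i x"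
        using der[OF GH(1) b] by blast
      then show "\<exists>K\<in>Y. \<forall>i\<in>I. \<forall>x. K i x = partial_deriv b (\<lambda>x. G i x + H i x) x"
        using K GH Ydiff diff
        by (intro bexI[OF _ Y_add[OF Y_add[OF Y_X[OF AB(1)] Y_X[OF AB(2)]] K(1)]])
          (auto simp: partial_deriv_add AB(3))
    qed
  next
    fix F and b :: 'a assume F: "F \<in> Y" and b: "b \<in> Basis"
    show "\<exists>G\<in>Y. \<forall>i\<in>I. \<forall>x. G i x = complex_of_real (x \<bullet> b) * F i x"
      using F
    proof (rule Y_induct)
      show "\<exists>G\<in>Y. \<forall>i\<in>I. \<forall>x. G i x = complex_of_real (x \<bullet> b) * 0"
        using Y_0 by (intro bexI[of _ "\<lambda>i x. 0"]) auto
    next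
      fix G H :: "'i \<Rightarrow> 'a \<Rightarrow> complex" assume GH: "G \<in> X" "H \<in> Y" "\<exists>K\<in>Y. \<forall>i\<in>I. \<forall>x. K i x = complex_of_real (x \<bullet> b) * H i x"
      then obtain K where K: "K \<in> Y" "\<And>i x. i \<in> I \<Longrightarrow> K i x = complex_of_real (x \<bullet> b) * H i x" by blast
      obtain A B where AB: "A \<in> X" "B \<in> X" "\<And>i x. i \<in> I \<Longrightarrow> complex_of_real (x \<bullet> b) * G i x = A i x + B i x"
        using mul[OF GH(1) b] by blast
      then show "\<exists>K\<in>Y. \<forall>i\<in>I. \<forall>x. K i x = complex_of_real (x \<bullet> b) * (G i x + H i x)"
        using K
        by (intro bexI[OF _ Y_add[OF Y_add[OF Y_X[OF AB(1)] Y_X[OF AB(2)]] K(1)]])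
          (auto simp: distrib_left AB(3))
    qed
  qed
qed

lemma schwartz_coinduct_sum:
  fixes f :: "'a::euclidean_space \<Rightarrow> complex"
  assumes "f \<in> X"
    and "\<And>f. f \<in> X \<Longrightarrow> \<exists>C. \<forall>x. norm (f x) \<le> C"
    and "\<And>f x. f \<in> X \<Longrightarrow> f differentiable (at x)"
    and der: "\<And>f b. f \<in> X \<Longrightarrow> b \<in> Basis \<Longrightarrow>
      \<exists>g\<in>X. \<exists>h\<in>X. \<forall>x. partial_deriv b f x = g x + h x"
    and mul: "\<And>f b. f \<in> X \<Longrightarrow> b \<in> Basis \<Longrightarrow>
      \<exists>g\<in>X. \<exists>h\<in>X. \<forall>x. complex_of_real (x \<bullet> b) * f x = g x + h x"
  shows "f \<in> schwartz"
  unfolding schwartz_iff_dominated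
proof (rule dominated_coinduct_sum[where X = "(\<lambda>f _. f) ` X"])
  show "(\<lambda>_. f) \<in> (\<lambda>f _. f) ` X" using assms(1) by blast
next
  fix F :: "unit \<Rightarrow> 'a \<Rightarrow> complex" and x :: 'a and i assume "F \<in> (\<lambda>f _. f) ` X"
  then show "F i differentiable (at x)" using assms(3) by auto
next
  fix F :: "unit \<Rightarrow> 'a \<Rightarrow> complex" assume "F \<in> (\<lambda>f _. f) ` X"
  then obtain f where f: "f \<in> X" "F = (\<lambda>_. f)" by blast
  obtain C where "\<forall>x. norm (f x) \<le> C" using assms(2)[OF f(1)] by blast
  then show "\<exists>N\<in>UNIV. \<forall>i\<in>UNIV. \<forall>x. cmod (F i x) \<le> N i"
    using f by (intro bexI[of _ "\<lambda>_. C"]) auto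
next
  fix F :: "unit \<Rightarrow> 'a \<Rightarrow> complex" and b :: 'a assume "F \<in> (\<lambda>f _. f) ` X" and b: "b \<in> Basis"
  then obtain f where f: "f \<in> X" "F = (\<lambda>_. f)" by blast
  obtain g h where "g \<in> X" "h \<in> X" "\<forall>x. partial_deriv b f x = g x + h x" using der[OF f(1) b] by blast
  then show "\<exists>G\<in>(\<lambda>f _. f) ` X. \<exists>H\<in>(\<lambda>f _. f) ` X. \<forall>i\<in>UNIV. \<forall>x. partial_deriv b (F i) x = G i x + H i x"
    using f by (intro bexI[of _ "\<lambda>_. g"] bexI[of _ "\<lambda>_. h"]) auto
next
  fix F :: "unit \<Rightarrow> 'a \<Rightarrow> complex" and b :: 'a assume "F \<in> (\<lambda>f _. f) ` X" and b: "b \<in> Basis"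
  then obtain f where f: "f \<in> X" "F = (\<lambda>_. f)" by blast
  obtain g h where "g \<in> X" "h \<in> X" "\<forall>x. complex_of_real (x \<bullet> b) * f x = g x + h x" using mul[OF f(1) b] by blast
  then show "\<exists>G\<in>(\<lambda>f _. f) ` X. \<exists>H\<in>(\<lambda>f _. f) ` X. \<forall>i\<in>UNIV. \<forall>x. complex_of_real (x \<bullet> b) * F i x = G i x + H i x"
    using f by (intro bexI[of _ "\<lambda>_. g"] bexI[of _ "\<lambda>_. h"]) auto
qed simp

section \<open>Linear combinations of dominated families\<close>

lemma dominated_cong:
  assumes "\<And>i. i \<in> I \<Longrightarrow> F i = G i"
  shows "dominated W I F = dominated W I G"
  using assms by (simp add: dominated_def)

lemma iter_deriv_cmult:
  assumes "smooth f" "vs \<in> lists Basis"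
  shows "iter_deriv vs (\<lambda>x. c * f x) = (\<lambda>x. c * iter_deriv vs f x)"
  using assms(2)
proof (induction vs)
  case (Cons v vs)
  then show ?case
    using smooth_differentiable[OF assms(1), of vs]
    by (auto simp: iter_deriv_Cons partial_deriv_cmult simp del: iter_deriv.simps(2))
qed simp

lemma smooth_cmult: "smooth f \<Longrightarrow> smooth (\<lambda>x. c * f x)"
  by (auto simp: smooth_def iter_deriv_cmult intro!: differentiable_mult)

lemma iter_deriv_add:
  assumes "smooth f" "smooth g" "vs \<in> lists Basis"
  shows "iter_deriv vs (\<lambda>x. f x + g x) = (\<lambda>x. iter_deriv vs f x + iter_deriv vs g x)"
  using assms(3)
proof (induction vs)
  case (Cons v vs)
  then show ?case
    using smooth_differentiable[OF assms(1), of vs] smooth_differentiable[OF assms(2), of vs]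
    by (auto simp: iter_deriv_Cons partial_deriv_add simp del: iter_deriv.simps(2))
qed simp

lemma smooth_add: "smooth f \<Longrightarrow> smooth g \<Longrightarrow> smooth (\<lambda>x. f x + g x)"
  by (simp add: smooth_def iter_deriv_add)

text \<open>The cone may change together with the coefficients: rapidly decreasing \<open>c\<close>
  will turn polynomial bounds into integrable ones.\<close>

lemma dominated_cmult_index:
  fixes F :: "'i \<Rightarrow> 'b::euclidean_space \<Rightarrow> complex"
  assumes F: "dominated W I F" and c: "\<And>N. N \<in> W \<Longrightarrow> (\<lambda>i. norm (c i) * N i) \<in> W'"
  shows "dominated W' I (\<lambda>i x. c i * F i x)"
  unfolding dominated_def
proof (intro conjI ballI allI)
  fix k and vs :: "'b list" assume vs: "vs \<in> lists Basis"
  then obtain N where N: "N \<in> W" "\<And>i x. i \<in> I \<Longrightarrow> (1 + norm x) ^ k * norm (iter_deriv vs (F i) x) \<le> N i"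
    using dominated_bound[OF F] by blast
  show "\<exists>N\<in>W'. \<forall>i\<in>I. \<forall>x. (1 + norm x) ^ k * norm (iter_deriv vs (\<lambda>x. c i * F i x) x) \<le> N i"
  proof (intro bexI ballI allI)
    fix i x assume i: "i \<in> I"
    then have sm: "smooth (F i)" using F by (simp add: dominated_def)
    have "(1 + norm x) ^ k * norm (iter_deriv vs (\<lambda>x. c i * F i x) x)
      = norm (c i) * ((1 + norm x) ^ k * norm (iter_deriv vs (F i) x))"
      unfolding iter_deriv_cmult[OF sm vs] by (simp add: norm_mult)
    also have "\<dots> \<le> norm (c i) * N i" by (intro mult_left_mono N(2) i) auto
    finally show "(1 + norm x) ^ k * norm (iter_deriv vs (\<lambda>x. c i * F i x) x) \<le> norm (c i) * N i" .
  qed (rule c[OF N(1)])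
qed (use F in \<open>auto simp: dominated_def smooth_cmult\<close>)

lemma dominated_cmult: "weight_cone W \<Longrightarrow> dominated W I F \<Longrightarrow> dominated W I (\<lambda>i x. c * F i x)"
  by (erule dominated_cmult_index) (auto intro: weight_cone_cmult)

lemma dominated_add:
  fixes F :: "'i \<Rightarrow> 'b::euclidean_space \<Rightarrow> complex"
  assumes W: "weight_cone W" and F: "dominated W I F" and G: "dominated W I G"
  shows "dominated W I (\<lambda>i x. F i x + G i x)"
  unfolding dominated_def
proof (intro conjI ballI allI)
  fix k and vs :: "'b list" assume vs: "vs \<in> lists Basis"
  obtain M where M: "M \<in> W" "\<And>i x. i \<in> I \<Longrightarrow> (1 + norm x) ^ k * norm (iter_deriv vs (F i) x) \<le> M i"
    using dominated_bound[OF F vs] by blast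
  obtain N where N: "N \<in> W" "\<And>i x. i \<in> I \<Longrightarrow> (1 + norm x) ^ k * norm (iter_deriv vs (G i) x) \<le> N i"
    using dominated_bound[OF G vs] by blast
  show "\<exists>N\<in>W. \<forall>i\<in>I. \<forall>x. (1 + norm x) ^ k * norm (iter_deriv vs (\<lambda>x. F i x + G i x) x) \<le> N i"
  proof (intro bexI ballI allI)
    fix i x assume i: "i \<in> I"
    then have sm: "smooth (F i)" "smooth (G i)" using F G by (auto simp: dominated_def)
    have "(1 + norm x) ^ k * norm (iter_deriv vs (F i) x + iter_deriv vs (G i) x)
       \<le> (1 + norm x) ^ k * (norm (iter_deriv vs (F i) x) + norm (iter_deriv vs (G i) x))"
      by (intro mult_left_mono norm_triangle_ineq) auto
    also have "\<dots> \<le> M i + N i" unfolding distrib_left using M N i by (intro add_mono) auto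
    finally show "(1 + norm x) ^ k * norm (iter_deriv vs (\<lambda>x. F i x + G i x) x) \<le> M i + N i"
      unfolding iter_deriv_add[OF sm vs] .
  qed (intro weight_cone_add W M N)
qed (use F G in \<open>auto simp: dominated_def smooth_add\<close>)

lemma dominated_zero: "weight_cone W \<Longrightarrow> dominated W I (\<lambda>i x. 0)"
  by (rule dominated_coinduct[where X = "{\<lambda>i x. 0}"])
    (auto simp: partial_deriv_def intro!: exI[of _ "\<lambda>i. 0"], auto simp: weight_cone_def)

lemma dominated_sum:
  assumes "weight_cone W" "finite A" "\<And>a. a \<in> A \<Longrightarrow> dominated W I (F a)"
  shows "dominated W I (\<lambda>i x. \<Sum>a\<in>A. F a i x)"
  using assms(2,3) by (induction A rule: finite_induct) (auto intro!: dominated_add dominated_zero assms(1))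

lemma schwartz_add: "f \<in> schwartz \<Longrightarrow> g \<in> schwartz \<Longrightarrow> (\<lambda>x. f x + g x) \<in> schwartz"
  unfolding schwartz_iff_dominated by (rule dominated_add) auto

lemma schwartz_cmult: "f \<in> schwartz \<Longrightarrow> (\<lambda>x. c * f x) \<in> schwartz"
  unfolding schwartz_iff_dominated by (rule dominated_cmult) auto

lemma schwartz_zero [simp]: "(\<lambda>x. 0) \<in> schwartz"
  unfolding schwartz_iff_dominated by (rule dominated_zero) simp

section \<open>Continuous operators on the Schwartz space\<close>

lemma schwartz_norm_ge:
  assumes f: "f \<in> schwartz" and vs: "vs \<in> lists Basis" "length vs \<le> m" and k: "k \<le> m"
  shows "(1 + norm x) ^ k * norm (iter_deriv vs f x) \<le> schwartz_norm m f"
proof -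
  define g where "g ws = (SUP x. (1 + norm x) ^ m * norm (iter_deriv ws f x))" for ws
  have le: "(1 + norm x) ^ m * norm (iter_deriv ws f x) \<le> g ws" if ws: "ws \<in> lists Basis" for ws x
  proof -
    have "bdd_above (range (\<lambda>x. (1 + norm x) ^ m * norm (iter_deriv ws f x)))"
    proof (rule bounded_imp_bdd_above)
      show "bounded (range (\<lambda>x. (1 + norm x) ^ m * norm (iter_deriv ws f x)))"
        using f ws by (simp add: schwartz_def)
    qed
    then show ?thesis unfolding g_def by (intro cSUP_upper) auto
  qed
  have "(1 + norm x) ^ k * norm (iter_deriv vs f x) \<le> (1 + norm x) ^ m * norm (iter_deriv vs f x)"
    using k by (intro mult_right_mono power_increasing) auto
  also have "\<dots> \<le> g vs" by (rule le[OF vs(1)])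
  also have "\<dots> \<le> schwartz_norm m f"
    unfolding schwartz_norm_def g_def[symmetric]
  proof (rule member_le_sum)
    show "finite {vs. set vs \<subseteq> (Basis::'a set) \<and> length vs \<le> m}"
      by (rule finite_lists_length_le) simp
    fix ws :: "'a list" assume "ws \<in> {vs. set vs \<subseteq> Basis \<and> length vs \<le> m} - {vs}"
    then show "0 \<le> g ws" by (intro order_trans[OF _ le[of ws 0]]) auto
  qed (use vs in auto)
  finally show ?thesis .
qed

lemma schwartz_norm_nonneg: "f \<in> schwartz \<Longrightarrow> 0 \<le> schwartz_norm m f"
  by (rule order_trans[OF _ schwartz_norm_ge[of f "[]" m 0 0]]) auto

lemma schwartz_norm_le:
  assumes "\<And>vs x. vs \<in> lists Basis \<Longrightarrow> length vs \<le> m \<Longrightarrow> (1 + norm x) ^ m * norm (iter_deriv vs f x) \<le> N vs"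
  shows "schwartz_norm m f \<le> (\<Sum>vs\<in>{vs. set vs \<subseteq> Basis \<and> length vs \<le> m}. N vs)"
  unfolding schwartz_norm_def using assms by (intro sum_mono cSUP_least) auto

text \<open>The factor counts the summands on the left, each of which is bounded by the whole norm
  of order \<open>n\<close>.\<close>

lemma schwartz_norm_mono:
  assumes f: "f \<in> schwartz" and "m \<le> n"
  shows "schwartz_norm m f \<le> real (card {vs. set vs \<subseteq> (Basis::'a::euclidean_space set) \<and> length vs \<le> m})
     * schwartz_norm n (f :: 'a \<Rightarrow> complex)"
proof -
  have "schwartz_norm m f \<le> (\<Sum>vs\<in>{vs. set vs \<subseteq> (Basis::'a set) \<and> length vs \<le> m}. schwartz_norm n f)"
    by (rule schwartz_norm_le) (use assms in \<open>auto intro!: schwartz_norm_ge\<close>)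
  then show ?thesis by simp
qed

definition schwartz_weights :: "(('a::euclidean_space \<Rightarrow> complex) \<Rightarrow> real) set" where
  "schwartz_weights = {N. \<exists>C m. \<forall>f\<in>schwartz. N f \<le> C * schwartz_norm m f}"

text \<open>Indexing by the argument itself makes the bounds those of continuity between Frechet
  spaces. Linearity is expressed separately, by \<open>linear_op\<close>.\<close>

abbreviation schwartz_op :: "(('a::euclidean_space \<Rightarrow> complex) \<Rightarrow> 'b::euclidean_space \<Rightarrow> complex) \<Rightarrow> bool" where
  "schwartz_op \<equiv> dominated schwartz_weights schwartz"

lemma schwartz_weight_raise:
  assumes "\<forall>f\<in>schwartz. N f \<le> C * schwartz_norm m f" "m \<le> n"
  obtains C' where "0 \<le> C'" "\<forall>f\<in>schwartz. N (f :: 'a::euclidean_space \<Rightarrow> complex) \<le> C' * schwartz_norm n f"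
proof
  define c where "c = real (card {vs. set vs \<subseteq> (Basis::'a set) \<and> length vs \<le> m})"
  show "0 \<le> \<bar>C\<bar> * c" by (simp add: c_def)
  show "\<forall>f\<in>schwartz. N f \<le> \<bar>C\<bar> * c * schwartz_norm n f"
  proof
    fix f :: "'a \<Rightarrow> complex" assume f: "f \<in> schwartz"
    have "N f \<le> \<bar>C\<bar> * schwartz_norm m f"
      using assms(1) f schwartz_norm_nonneg[OF f, of m]
      by (meson abs_ge_self mult_right_mono order_trans)
    also have "\<dots> \<le> \<bar>C\<bar> * (c * schwartz_norm n f)"
      unfolding c_def by (intro mult_left_mono schwartz_norm_mono f assms) auto
    finally show "N f \<le> \<bar>C\<bar> * c * schwartz_norm n f" by (simp add: mult.assoc)
  qed
qed

lemma weight_cone_schwartz [simp]: "weight_cone schwartz_weights"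
  unfolding weight_cone_def
proof (intro conjI ballI allI impI)
  fix M N :: "('a \<Rightarrow> complex) \<Rightarrow> real" assume "M \<in> schwartz_weights" "N \<in> schwartz_weights"
  then obtain C m D n where *: "\<forall>f\<in>schwartz. M f \<le> C * schwartz_norm m f" "\<forall>f\<in>schwartz. N f \<le> D * schwartz_norm n f"
    by (auto simp: schwartz_weights_def)
  obtain C' where C': "\<forall>f\<in>schwartz. M f \<le> C' * schwartz_norm (max m n) f"
    using schwartz_weight_raise[OF *(1), of "max m n"] by auto
  obtain D' where D': "\<forall>f\<in>schwartz. N f \<le> D' * schwartz_norm (max m n) f"
    using schwartz_weight_raise[OF *(2), of "max m n"] by auto
  show "(\<lambda>i. M i + N i) \<in> schwartz_weights" unfolding schwartz_weights_def
    using C' D' by (intro CollectI exI[of _ "C' + D'"] exI[of _ "max m n"]) (auto simp: distrib_right intro!: add_mono)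
next
  fix N :: "('a \<Rightarrow> complex) \<Rightarrow> real" and c :: real assume "N \<in> schwartz_weights" and c: "0 \<le> c"
  then obtain C m where *: "\<forall>f\<in>schwartz. N f \<le> C * schwartz_norm m f"
    by (auto simp: schwartz_weights_def)
  show "(\<lambda>i. c * N i) \<in> schwartz_weights" unfolding schwartz_weights_def
    using * c by (intro CollectI exI[of _ "c * C"] exI[of _ m]) (auto simp: mult.assoc intro!: mult_left_mono)
next
  show "(\<lambda>i. 0) \<in> schwartz_weights" unfolding schwartz_weights_def
    by (intro CollectI exI[of _ 0]) auto
qed

lemma schwartz_norm_weight: "schwartz_norm m \<in> schwartz_weights"
  unfolding schwartz_weights_def by (intro CollectI exI[of _ 1] exI[of _ m]) auto

lemma dominated_schwartz_norm:
  fixes F :: "'i \<Rightarrow> 'b::euclidean_space \<Rightarrow> complex"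
  assumes "weight_cone W" "dominated W I F"
  obtains N where "N \<in> W" "\<And>i. i \<in> I \<Longrightarrow> schwartz_norm m (F i) \<le> N i"
proof -
  have "\<exists>N\<in>W. \<forall>i\<in>I. \<forall>x. (1 + norm x) ^ m * norm (iter_deriv vs (F i) x) \<le> N i"
    if "set vs \<subseteq> Basis" for vs
    using assms(2) in_listsI[of vs Basis] that unfolding dominated_def by blast
  then obtain N where N: "\<And>vs. set vs \<subseteq> Basis \<Longrightarrow> N vs \<in> W"
    "\<And>vs i x. set vs \<subseteq> Basis \<Longrightarrow> i \<in> I \<Longrightarrow> (1 + norm x) ^ m * norm (iter_deriv vs (F i) x) \<le> N vs i"
    by metis
  show thesis
  proof
    show "(\<lambda>i. \<Sum>vs\<in>{vs. set vs \<subseteq> (Basis::'b set) \<and> length vs \<le> m}. N vs i) \<in> W"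
      by (rule weight_cone_sum[OF assms(1)]) (use N finite_lists_length_le[of Basis m] in auto)
    show "schwartz_norm m (F i) \<le> (\<Sum>vs\<in>{vs. set vs \<subseteq> Basis \<and> length vs \<le> m}. N vs i)" if "i \<in> I" for i
      by (rule schwartz_norm_le, rule N(2)[OF _ that]) auto
  qed
qed

lemma dominated_weight:
  assumes W: "weight_cone W" and F: "dominated W I F" and N: "N \<in> schwartz_weights"
  obtains M where "M \<in> W" "\<And>i. i \<in> I \<Longrightarrow> N (F i) \<le> M i"
proof -
  obtain C m where *: "\<forall>f\<in>schwartz. N f \<le> C * schwartz_norm m f" using N by (auto simp: schwartz_weights_def)
  obtain C where C: "0 \<le> C" "\<forall>f\<in>schwartz. N f \<le> C * schwartz_norm m f"
    using schwartz_weight_raise[OF *, of m] by auto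
  obtain M where M: "M \<in> W" "\<And>i. i \<in> I \<Longrightarrow> schwartz_norm m (F i) \<le> M i"
    using dominated_schwartz_norm[OF W F] by blast
  show thesis
  proof
    show "(\<lambda>i. C * M i) \<in> W" by (intro weight_cone_cmult W M C)
    fix i assume i: "i \<in> I"
    have "N (F i) \<le> C * schwartz_norm m (F i)" using C dominated_schwartz[OF F i] by auto
    also have "\<dots> \<le> C * M i" by (intro mult_left_mono M C i)
    finally show "N (F i) \<le> C * M i" .
  qed
qed

text \<open>Continuity of \<open>A\<close> bounds each seminorm of \<open>A (F i)\<close> by a
  seminorm of \<open>F i\<close>, hence by a weight in \<open>W\<close>. With
  \<open>W = schwartz_weights\<close> this is closure of operators under composition.\<close>

lemma dominated_op:
  fixes A :: "('b::euclidean_space \<Rightarrow> complex) \<Rightarrow> 'c::euclidean_space \<Rightarrow> complex"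
  assumes A: "schwartz_op A" and W: "weight_cone W" and F: "dominated W I F"
  shows "dominated W I (\<lambda>i. A (F i))"
  unfolding dominated_def
proof (intro conjI ballI allI)
  fix i assume "i \<in> I"
  then show "smooth (A (F i))" using A dominated_schwartz[OF F] by (simp add: dominated_def)
next
  fix k and vs :: "'c list" assume "vs \<in> lists Basis"
  then obtain N where N: "N \<in> schwartz_weights"
    "\<And>f x. f \<in> schwartz \<Longrightarrow> (1 + norm x) ^ k * norm (iter_deriv vs (A f) x) \<le> N f"
    using dominated_bound[OF A] by blast
  obtain M where M: "M \<in> W" "\<And>i. i \<in> I \<Longrightarrow> N (F i) \<le> M i" using dominated_weight[OF W F N(1)] by blast
  show "\<exists>N\<in>W. \<forall>i\<in>I. \<forall>x. (1 + norm x) ^ k * norm (iter_deriv vs (A (F i)) x) \<le> N i"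
  proof (intro bexI ballI allI)
    fix i x assume "i \<in> I"
    then show "(1 + norm x) ^ k * norm (iter_deriv vs (A (F i)) x) \<le> M i"
      using N(2)[OF dominated_schwartz[OF F]] M(2) by (meson order_trans)
  qed (rule M)
qed

lemma schwartz_op_schwartz: "schwartz_op A \<Longrightarrow> f \<in> schwartz \<Longrightarrow> A f \<in> schwartz"
  by (rule dominated_schwartz[of _ _ A])

lemma schwartz_op_id: "schwartz_op (\<lambda>f. f)"
  unfolding dominated_def
proof (intro conjI ballI allI)
  fix k and vs :: "'a list" assume "vs \<in> lists Basis"
  then show "\<exists>N\<in>schwartz_weights. \<forall>i\<in>schwartz. \<forall>x. (1 + norm x) ^ k * norm (iter_deriv vs i x) \<le> N i"
    by (intro bexI[of _ "schwartz_norm (max k (length vs))"])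
      (auto intro!: schwartz_norm_ge schwartz_norm_weight)
qed (simp add: schwartz_smooth)

lemma schwartz_op_compose: "schwartz_op A \<Longrightarrow> schwartz_op B \<Longrightarrow> schwartz_op (\<lambda>f. A (B f))"
  by (rule dominated_op) auto

lemma schwartz_op_iter_deriv:
  fixes ws :: "'a::euclidean_space list"
  assumes "ws \<in> lists Basis"
  shows "schwartz_op (iter_deriv ws)"
  unfolding dominated_def
proof (intro conjI ballI allI)
  fix k and vs :: "'a list" assume "vs \<in> lists Basis"
  then show "\<exists>N\<in>schwartz_weights. \<forall>i\<in>schwartz. \<forall>x. (1 + norm x) ^ k * norm (iter_deriv vs (iter_deriv ws i) x) \<le> N i"
    using dominated_bound[OF schwartz_op_id, of "vs @ ws" k] assms
    by (auto simp: iter_deriv_append) metis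
qed (use assms in \<open>auto intro!: schwartz_smooth schwartz_iter_deriv\<close>)

lemma schwartz_op_partial_deriv:
  assumes "b \<in> Basis"
  shows "schwartz_op (partial_deriv b)"
proof -
  have "iter_deriv [b] = partial_deriv b" by (simp add: fun_eq_iff partial_deriv_def)
  then show ?thesis using schwartz_op_iter_deriv[of "[b]"] assms by simp
qed

text \<open>The multiplications stand outermost, so that boundedness is immediate from the seminorms;
  stability under derivatives is the Leibniz rule.\<close>

inductive_set poly_diff_op :: "(('a::euclidean_space \<Rightarrow> complex) \<Rightarrow> 'a \<Rightarrow> complex) set" where
  deriv: "vs \<in> lists Basis \<Longrightarrow> iter_deriv vs \<in> poly_diff_op"
| coord: "A \<in> poly_diff_op \<Longrightarrow> (\<lambda>f x. complex_of_real (x \<bullet> v) * A f x) \<in> poly_diff_op"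
| add: "A \<in> poly_diff_op \<Longrightarrow> B \<in> poly_diff_op \<Longrightarrow> (\<lambda>f x. A f x + B f x) \<in> poly_diff_op"
| cmult: "A \<in> poly_diff_op \<Longrightarrow> (\<lambda>f x. c * A f x) \<in> poly_diff_op"

lemma poly_diff_op_differentiable:
  "A \<in> poly_diff_op \<Longrightarrow> f \<in> schwartz \<Longrightarrow> A f differentiable (at x)"
proof (induction rule: poly_diff_op.induct)
  case (deriv vs)
  then show ?case by (auto intro: smooth_differentiable schwartz_smooth)
next
  case (coord A v)
  then show ?case
    using has_derivative_inner_of_real[of v x] by (intro differentiable_mult) (auto intro: differentiableI)
qed (auto intro!: differentiable_mult)

lemma poly_diff_op_weight:
  fixes A :: "('a::euclidean_space \<Rightarrow> complex) \<Rightarrow> 'a \<Rightarrow> complex"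
  assumes "A \<in> poly_diff_op"
  shows "\<exists>N\<in>schwartz_weights. \<forall>f\<in>schwartz. \<forall>x. (1 + norm x) ^ k * norm (A f x) \<le> N f"
  using assms
proof (induction arbitrary: k rule: poly_diff_op.induct)
  case (deriv vs)
  then show ?case using schwartz_op_id unfolding dominated_def by blast
next
  case (coord A v)
  obtain N where N: "N \<in> schwartz_weights" "\<And>f x. f \<in> schwartz \<Longrightarrow> (1 + norm x) ^ Suc k * norm (A f x) \<le> N f"
    using coord.IH[of "Suc k"] by blast
  show ?case
  proof (intro bexI ballI allI)
    fix f x assume f: "f \<in> (schwartz :: ('a \<Rightarrow> complex) set)"
    have "\<bar>x \<bullet> v\<bar> \<le> norm v * (1 + norm x)"
      using Cauchy_Schwarz_ineq2[of x v] by (simp add: distrib_left mult.commute add_increasing)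
    then have "(1 + norm x) ^ k * norm (complex_of_real (x \<bullet> v) * A f x)
        \<le> (1 + norm x) ^ k * ((norm v * (1 + norm x)) * norm (A f x))"
      unfolding norm_mult norm_of_real by (intro mult_left_mono mult_right_mono) auto
    also have "\<dots> = norm v * ((1 + norm x) ^ Suc k * norm (A f x))" by (simp add: mult_ac)
    also have "\<dots> \<le> norm v * N f" by (intro mult_left_mono N f) auto
    finally show "(1 + norm x) ^ k * norm (complex_of_real (x \<bullet> v) * A f x) \<le> norm v * N f" .
  qed (intro weight_cone_cmult N weight_cone_schwartz norm_ge_zero)
next
  case (add A B)
  obtain M where M: "M \<in> schwartz_weights" "\<And>f x. f \<in> schwartz \<Longrightarrow> (1 + norm x) ^ k * norm (A f x) \<le> M f"
    using add.IH(1)[of k] by blast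
  obtain N where N: "N \<in> schwartz_weights" "\<And>f x. f \<in> schwartz \<Longrightarrow> (1 + norm x) ^ k * norm (B f x) \<le> N f"
    using add.IH(2)[of k] by blast
  show ?case
  proof (intro bexI ballI allI)
    fix f x assume f: "f \<in> (schwartz :: ('a \<Rightarrow> complex) set)"
    have "(1 + norm x) ^ k * norm (A f x + B f x) \<le> (1 + norm x) ^ k * (norm (A f x) + norm (B f x))"
      by (intro mult_left_mono norm_triangle_ineq) auto
    also have "\<dots> \<le> M f + N f" unfolding distrib_left using M N f by (intro add_mono) auto
    finally show "(1 + norm x) ^ k * norm (A f x + B f x) \<le> M f + N f" .
  qed (intro weight_cone_add M N weight_cone_schwartz)
next
  case (cmult A c)
  obtain N where N: "N \<in> schwartz_weights" "\<And>f x. f \<in> schwartz \<Longrightarrow> (1 + norm x) ^ k * norm (A f x) \<le> N f"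
    using cmult.IH[of k] by blast
  show ?case
  proof (intro bexI ballI allI)
    fix f x assume f: "f \<in> (schwartz :: ('a \<Rightarrow> complex) set)"
    have "(1 + norm x) ^ k * norm (c * A f x) = norm c * ((1 + norm x) ^ k * norm (A f x))"
      by (simp add: norm_mult)
    also have "\<dots> \<le> norm c * N f" by (intro mult_left_mono N f) auto
    finally show "(1 + norm x) ^ k * norm (c * A f x) \<le> norm c * N f" .
  qed (intro weight_cone_cmult N weight_cone_schwartz norm_ge_zero)
qed

lemma poly_diff_op_partial_deriv:
  fixes b :: "'a::euclidean_space"
  assumes "A \<in> poly_diff_op" and b: "b \<in> Basis"
  shows "\<exists>B\<in>poly_diff_op. \<forall>f\<in>schwartz. \<forall>x. B f x = partial_deriv b (A f) x"
  using assms(1)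
proof (induction rule: poly_diff_op.induct)
  case (deriv vs)
  then show ?case
    by (intro bexI[of _ "iter_deriv (b # vs)"] poly_diff_op.deriv)
      (use b in \<open>auto simp: partial_deriv_def\<close>)
next
  case (coord A v)
  then obtain B where B: "B \<in> poly_diff_op" "\<forall>f\<in>schwartz. \<forall>x. B f x = partial_deriv b (A f) x" by blast
  show ?case
  proof (intro bexI ballI allI)
    fix f x assume f: "f \<in> (schwartz :: ('a \<Rightarrow> complex) set)"
    show "complex_of_real (x \<bullet> v) * B f x + complex_of_real (b \<bullet> v) * A f x
        = partial_deriv b (\<lambda>x. complex_of_real (x \<bullet> v) * A f x) x"
      using poly_diff_op_differentiable[OF coord.hyps f] B f
        partial_deriv_eqI[OF has_derivative_inner_of_real, of b v x]
        differentiableI[OF has_derivative_inner_of_real[of v x]]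
      by (simp add: partial_deriv_mult)
  qed (intro poly_diff_op.intros B coord.hyps)
next
  case (add A B)
  then obtain A' B' where A': "A' \<in> poly_diff_op" "\<forall>f\<in>schwartz. \<forall>x. A' f x = partial_deriv b (A f) x"
    and B': "B' \<in> poly_diff_op" "\<forall>f\<in>schwartz. \<forall>x. B' f x = partial_deriv b (B f) x" by blast
  show ?case
    by (intro bexI[of _ "\<lambda>f x. A' f x + B' f x"] poly_diff_op.add A' B')
      (use A' B' add.hyps in \<open>auto simp: partial_deriv_add poly_diff_op_differentiable\<close>)
next
  case (cmult A c)
  then obtain B where B: "B \<in> poly_diff_op" "\<forall>f\<in>schwartz. \<forall>x. B f x = partial_deriv b (A f) x" by blast
  show ?case
    by (intro bexI[of _ "\<lambda>f x. c * B f x"] poly_diff_op.cmult B)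
      (use B cmult.hyps in \<open>auto simp: partial_deriv_cmult poly_diff_op_differentiable\<close>)
qed

lemma poly_diff_op_schwartz_op:
  fixes A :: "('a::euclidean_space \<Rightarrow> complex) \<Rightarrow> 'a \<Rightarrow> complex"
  assumes "A \<in> poly_diff_op"
  shows "schwartz_op A"
proof (rule dominated_coinduct[where X = poly_diff_op])
  fix A assume "A \<in> (poly_diff_op :: (('a \<Rightarrow> complex) \<Rightarrow> 'a \<Rightarrow> complex) set)"
  then show "\<exists>N\<in>schwartz_weights. \<forall>f\<in>schwartz. \<forall>x. norm (A f x) \<le> N f"
    using poly_diff_op_weight[of A 0] by simp
qed (use assms in \<open>auto intro: poly_diff_op_differentiable poly_diff_op_partial_deriv poly_diff_op.coord\<close>)

lemma schwartz_op_coord: "schwartz_op (\<lambda>f x. complex_of_real (x \<bullet> v) * f x)"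
  using poly_diff_op_schwartz_op[OF poly_diff_op.coord[OF poly_diff_op.deriv[of "[]"]]] by simp

lemma schwartz_coord: "f \<in> schwartz \<Longrightarrow> (\<lambda>x. complex_of_real (x \<bullet> v) * f x) \<in> schwartz"
  by (rule schwartz_op_schwartz[OF schwartz_op_coord])

lemma schwartz_op_add: "schwartz_op A \<Longrightarrow> schwartz_op B \<Longrightarrow> schwartz_op (\<lambda>f x. A f x + B f x)"
  by (rule dominated_add) auto

lemma schwartz_op_cmult: "schwartz_op A \<Longrightarrow> schwartz_op (\<lambda>f x. c * A f x)"
  by (rule dominated_cmult) auto

text \<open>Serves the chain rule for a linear substitution, which produces derivatives along
  vectors \<open>S b\<close> outside the basis.\<close>

lemma schwartz_op_directional:
  "schwartz_op (partial_deriv (v :: 'a::euclidean_space))"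
proof -
  have "schwartz_op (\<lambda>f x. \<Sum>b\<in>Basis. complex_of_real (v \<bullet> b) * partial_deriv b f x)"
    by (intro dominated_sum schwartz_op_cmult schwartz_op_partial_deriv) auto
  then show ?thesis
    by (rule iffD1[OF dominated_cong, rotated])
      (auto simp: fun_eq_iff schwartz_differentiable partial_deriv_expand)
qed

section \<open>Phases, products, linear substitutions and chirps\<close>

text \<open>The sign is that of the Fourier kernel, so that kernels, modulations and chirps share
  one calculus.\<close>

definition phase :: "real \<Rightarrow> complex" where
  "phase t = exp (- (\<i> * complex_of_real t))"

lemma norm_phase [simp]: "norm (phase t) = 1"
  by (simp add: phase_def)

lemma phase_0 [simp]: "phase 0 = 1"
  by (simp add: phase_def)

lemma phase_add: "phase (s + t) = phase s * phase t"
  by (simp add: phase_def exp_add[symmetric] distrib_left)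

lemma phase_minus: "phase (- t) * phase t = 1" "phase t * phase (- t) = 1"
  using phase_add[of "-t" t] phase_add[of t "-t"] by simp_all

lemma cnj_phase: "cnj (phase t) = phase (- t)"
  by (simp add: phase_def exp_cnj)

lemma phase_measurable [measurable (raw)]:
  "f \<in> borel_measurable M \<Longrightarrow> (\<lambda>x. phase (f x)) \<in> borel_measurable M"
  unfolding phase_def by measurable

lemma continuous_on_phase [continuous_intros]:
  "continuous_on A f \<Longrightarrow> continuous_on A (\<lambda>x. phase (f x))"
  unfolding phase_def by (intro continuous_intros)

lemma has_derivative_phase:
  assumes "(f has_derivative f') (at x)"
  shows "((\<lambda>x. phase (f x)) has_derivative (\<lambda>h. - \<i> * complex_of_real (f' h) * phase (f x))) (at x)"
proof -
  have "((\<lambda>x. - (\<i> * complex_of_real (f x))) has_derivative (\<lambda>h. - (\<i> * complex_of_real (f' h)))) (at x)"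
    by (intro derivative_intros assms)
  from has_derivative_compose[OF this DERIV_exp[unfolded has_field_derivative_def]] show ?thesis
    unfolding phase_def by (simp add: mult.commute mult.left_commute)
qed

lemma norm_phase_diff_le: "norm (phase s - phase t) \<le> \<bar>s - t\<bar>"
proof -
  have "phase s - phase t = phase s * (1 - iexp (s - t))"
    by (simp add: phase_def right_diff_distrib flip: exp_add)
  then have "norm (phase s - phase t) = norm (iexp (s - t) - 1)"
    by (simp add: norm_mult norm_minus_commute)
  then show ?thesis using iexp_approx1[of "s - t" 0] by simp
qed

lemma schwartz_mult:
  fixes f g :: "'a::euclidean_space \<Rightarrow> complex"
  assumes "f \<in> schwartz" "g \<in> schwartz"
  shows "(\<lambda>x. f x * g x) \<in> schwartz"
proof -
  define X where "X = {\<lambda>x. f x * g x | f g :: 'a \<Rightarrow> complex. f \<in> schwartz \<and> g \<in> schwartz}"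
  have XI: "(\<lambda>x. f x * g x) \<in> X" if "f \<in> schwartz" "g \<in> schwartz" for f g
    unfolding X_def using that by blast
  show ?thesis
  proof (rule schwartz_coinduct_sum[where X = X])
    show "(\<lambda>x. f x * g x) \<in> X" by (rule XI[OF assms])
  next
    fix h :: "'a \<Rightarrow> complex" assume "h \<in> X"
    then obtain f g where f: "f \<in> schwartz" and g: "g \<in> schwartz" and h: "h = (\<lambda>x. f x * g x)"
      unfolding X_def by blast
    obtain C where C: "0 \<le> C" "\<And>x. norm (f x) \<le> C" using schwartz_bounded[OF f] by blast
    obtain D where D: "0 \<le> D" "\<And>x. norm (g x) \<le> D" using schwartz_bounded[OF g] by blast
    have "norm (h x) \<le> C * D" for x unfolding h norm_mult using C D by (intro mult_mono) auto
    then show "\<exists>C. \<forall>x. norm (h x) \<le> C" by blast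
    show "h differentiable (at x)" for x
      unfolding h using f g by (intro differentiable_mult schwartz_differentiable)
    fix b :: 'a assume b: "b \<in> Basis"
    show "\<exists>f'\<in>X. \<exists>g'\<in>X. \<forall>x. partial_deriv b h x = f' x + g' x"
    proof (intro bexI allI)
      show "partial_deriv b h x = f x * partial_deriv b g x + partial_deriv b f x * g x" for x
        unfolding h using f g by (intro partial_deriv_mult schwartz_differentiable)
    qed (intro XI schwartz_partial_deriv f g b)+
    show "\<exists>f'\<in>X. \<exists>g'\<in>X. \<forall>x. complex_of_real (x \<bullet> b) * h x = f' x + g' x"
    proof (intro bexI allI)
      \<comment> \<open>A coordinate falls on one factor only; the zero product fills the second
        summand demanded by the sum rule.\<close>
      show "complex_of_real (x \<bullet> b) * h x = (complex_of_real (x \<bullet> b) * f x) * g x + 0 * 0" for x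
        by (simp add: h)
    qed (rule XI[OF schwartz_zero schwartz_zero] XI[OF schwartz_coord[OF f] g])+
  qed
qed

lemma schwartz_cnj:
  fixes f :: "'a::euclidean_space \<Rightarrow> complex"
  assumes "f \<in> schwartz"
  shows "(\<lambda>x. cnj (f x)) \<in> schwartz"
proof -
  define X where "X = {\<lambda>x. cnj (f x) | f :: 'a \<Rightarrow> complex. f \<in> schwartz}"
  have XI: "(\<lambda>x. cnj (f x)) \<in> X" if "f \<in> schwartz" for f
    unfolding X_def using that by blast
  show ?thesis
  proof (rule schwartz_coinduct_sum[where X = X])
    show "(\<lambda>x. cnj (f x)) \<in> X" by (rule XI[OF assms])
  next
    fix h :: "'a \<Rightarrow> complex" assume "h \<in> X"
    then obtain f where f: "f \<in> schwartz" and h: "h = (\<lambda>x. cnj (f x))" unfolding X_def by blast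
    obtain C where C: "\<And>x. norm (f x) \<le> C" using schwartz_bounded[OF f] by blast
    then show "\<exists>C. \<forall>x. norm (h x) \<le> C" by (auto simp: h)
    have d: "(h has_derivative (\<lambda>v. cnj (partial_deriv v f x))) (at x)" for x
      unfolding h by (intro has_derivative_cnj has_derivative_partial_deriv schwartz_differentiable f)
    then show "h differentiable (at x)" for x by (rule differentiableI)
    fix b :: 'a assume b: "b \<in> Basis"
    show "\<exists>f'\<in>X. \<exists>g'\<in>X. \<forall>x. partial_deriv b h x = f' x + g' x"
    proof (intro bexI allI)
      show "partial_deriv b h x = cnj (partial_deriv b f x) + cnj 0" for x
        using partial_deriv_eqI[OF d] by simp
    qed (rule XI[OF schwartz_zero] XI[OF schwartz_partial_deriv[OF f b]])+
    show "\<exists>f'\<in>X. \<exists>g'\<in>X. \<forall>x. complex_of_real (x \<bullet> b) * h x = f' x + g' x"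
    proof (intro bexI allI)
      show "complex_of_real (x \<bullet> b) * h x = cnj (complex_of_real (x \<bullet> b) * f x) + cnj 0" for x
        by (simp add: h)
    qed (rule XI[OF schwartz_zero] XI[OF schwartz_coord[OF f]])+
  qed
qed

lemma schwartz_op_sup_weight:
  assumes "schwartz_op A"
  shows "\<exists>N\<in>schwartz_weights. \<forall>f\<in>schwartz. \<forall>x. (1 + norm x) ^ k * norm (A f x) \<le> N f"
proof -
  obtain N where "N \<in> schwartz_weights"
    "\<And>f x. f \<in> schwartz \<Longrightarrow> (1 + norm x) ^ k * norm (iter_deriv [] (A f) x) \<le> N f"
    by (rule dominated_bound[OF assms, of "[]"]) auto
  then show ?thesis by (intro bexI[of _ N]) auto
qed

lemma schwartz_op_differentiable:
  "schwartz_op A \<Longrightarrow> f \<in> schwartz \<Longrightarrow> A f differentiable (at x)"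
  by (rule schwartz_differentiable, rule schwartz_op_schwartz[of A f])

text \<open>The maps \<open>A f (S x)\<close>, with \<open>A\<close> ranging over all continuous
  operators, form a closed family: a derivative is absorbed into \<open>A\<close> as a derivative
  along \<open>S b\<close>, and \<open>x \<bullet> b = S x \<bullet> adjoint (inv S) b\<close> lets
  a coordinate pass inside.\<close>

lemma schwartz_op_linear_comp:
  fixes S :: "'b::euclidean_space \<Rightarrow> 'a::euclidean_space"
  assumes lin: "linear S" and bij: "bij S"
  shows "schwartz_op (\<lambda>f x. f (S x))"
proof -
  define X where "X = (\<lambda>A f x. A f (S x)) ` {A :: ('a \<Rightarrow> complex) \<Rightarrow> 'a \<Rightarrow> complex. schwartz_op A}"
  have XI: "(\<lambda>f x. A f (S x)) \<in> X" if "schwartz_op A" for A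
    unfolding X_def by (rule imageI) (simp add: that)
  have S: "(S has_derivative S) (at x)" for x
    using lin by (simp add: bounded_linear_imp_has_derivative linear_conv_bounded_linear)
  show ?thesis
  proof (rule dominated_coinduct[where X = X])
    show "(\<lambda>f x. f (S x)) \<in> X" by (rule XI[OF schwartz_op_id])
  next
    fix F assume "F \<in> X"
    then obtain A where A: "schwartz_op A" and F: "F = (\<lambda>f x. A f (S x))" by (auto simp: X_def)
    show "\<exists>N\<in>schwartz_weights. \<forall>f\<in>schwartz. \<forall>x. norm (F f x) \<le> N f"
      using schwartz_op_sup_weight[OF A, of 0] by (auto simp: F)
    have d: "(F f has_derivative (\<lambda>v. partial_deriv (S v) (A f) (S x))) (at x)"
      if "f \<in> schwartz" for f x
      unfolding F by (rule has_derivative_compose[OF S has_derivative_partial_deriv])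
        (rule schwartz_op_differentiable[OF A that])
    then show "F f differentiable (at x)" if "f \<in> schwartz" for f x
      using that by (blast intro: differentiableI)
    fix b :: 'b
    show "\<exists>G\<in>X. \<forall>f\<in>schwartz. \<forall>x. G f x = partial_deriv b (F f) x"
    proof (intro bexI ballI allI)
      show "partial_deriv (S b) (A f) (S x) = partial_deriv b (F f) x" if "f \<in> schwartz" for f x
        using partial_deriv_eqI[OF d[OF that]] by simp
      have "schwartz_op (\<lambda>f. partial_deriv (S b) (A f))"
        by (rule schwartz_op_compose[OF schwartz_op_directional A])
      then show "(\<lambda>f x. partial_deriv (S b) (A f) (S x)) \<in> X" by (rule XI)
    qed
    show "\<exists>G\<in>X. \<forall>f\<in>schwartz. \<forall>x. G f x = complex_of_real (x \<bullet> b) * F f x"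
    proof (intro bexI ballI allI)
      show "complex_of_real (S x \<bullet> adjoint (inv S) b) * A f (S x) = complex_of_real (x \<bullet> b) * F f x" for f x
        using adjoint_works[OF linear_inv[OF lin bij], of "S x" b] bij
        by (simp add: F bij_is_inj)
      have "schwartz_op (\<lambda>f x. complex_of_real (x \<bullet> adjoint (inv S) b) * A f x)"
        by (rule schwartz_op_compose[OF schwartz_op_coord A])
      then show "(\<lambda>f x. complex_of_real (S x \<bullet> adjoint (inv S) b) * A f (S x)) \<in> X" by (rule XI)
    qed
  qed simp
qed

text \<open>Differentiating the phase yields a factor linear in \<open>x\<close>, which is absorbed
  into the operator behind the chirp as a coordinate. Since \<open>K\<close> may fail to be
  symmetric, the direction of this coordinate is \<open>K b + adjoint K b\<close>.\<close>

lemma schwartz_op_chirp: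
  fixes K :: "'a::euclidean_space \<Rightarrow> 'a"
  assumes lin: "linear K"
  shows "schwartz_op (\<lambda>f x. phase (x \<bullet> K x / 2) * f x)"
proof -
  define X where "X = (\<lambda>A f x. phase (x \<bullet> K x / 2) * A f x) ` {A :: ('a \<Rightarrow> complex) \<Rightarrow> 'a \<Rightarrow> complex. schwartz_op A}"
  have XI: "(\<lambda>f x. phase (x \<bullet> K x / 2) * A f x) \<in> X" if "schwartz_op A" for A
    unfolding X_def by (rule imageI) (simp add: that)
  have K: "(K has_derivative K) (at x)" for x
    using lin by (simp add: bounded_linear_imp_has_derivative linear_conv_bounded_linear)
  have dq: "((\<lambda>x. x \<bullet> K x / 2) has_derivative (\<lambda>v. (x \<bullet> K v + v \<bullet> K x) / 2)) (at x)" for x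
    by (rule bounded_linear.has_derivative[OF bounded_linear_divide has_derivative_inner[OF has_derivative_ident K]])
  show ?thesis
  proof (rule dominated_coinduct[where X = X])
    show "(\<lambda>f x. phase (x \<bullet> K x / 2) * f x) \<in> X" by (rule XI[OF schwartz_op_id])
  next
    fix F assume "F \<in> X"
    then obtain A where A: "schwartz_op A" and F: "F = (\<lambda>f x. phase (x \<bullet> K x / 2) * A f x)" by (auto simp: X_def)
    show "\<exists>N\<in>schwartz_weights. \<forall>f\<in>schwartz. \<forall>x. norm (F f x) \<le> N f"
      using schwartz_op_sup_weight[OF A, of 0] by (auto simp: F norm_mult)
    have d: "(F f has_derivative (\<lambda>v. phase (x \<bullet> K x / 2) * partial_deriv v (A f) x
        + - \<i> * complex_of_real ((x \<bullet> K v + v \<bullet> K x) / 2) * phase (x \<bullet> K x / 2) * A f x)) (at x)"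
      if "f \<in> schwartz" for f x
      unfolding F
      by (rule has_derivative_mult[OF has_derivative_phase[OF dq] has_derivative_partial_deriv])
        (rule schwartz_op_differentiable[OF A that])
    then show "F f differentiable (at x)" if "f \<in> schwartz" for f x
      using that by (blast intro: differentiableI)
    fix b :: 'a
    show "\<exists>G\<in>X. \<forall>f\<in>schwartz. \<forall>x. G f x = partial_deriv b (F f) x" if b: "b \<in> Basis"
    proof (intro bexI ballI allI)
      define v where "v = K b + adjoint K b"
      show "phase (x \<bullet> K x / 2) * (partial_deriv b (A f) x + - (\<i> / 2) * (complex_of_real (x \<bullet> v) * A f x))
          = partial_deriv b (F f) x" if "f \<in> schwartz" for f x
        using partial_deriv_eqI[OF d[OF that], of b x] adjoint_works[OF lin, of x b]
        by (simp add: v_def inner_add_right algebra_simps inner_commute add_divide_distrib)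
      have "schwartz_op (\<lambda>f x. partial_deriv b (A f) x + - (\<i> / 2) * (complex_of_real (x \<bullet> v) * A f x))"
        by (intro schwartz_op_add schwartz_op_cmult schwartz_op_compose[OF schwartz_op_coord A]
          schwartz_op_compose[OF schwartz_op_partial_deriv[OF b] A])
      then show "(\<lambda>f x. phase (x \<bullet> K x / 2) * (partial_deriv b (A f) x + - (\<i> / 2) * (complex_of_real (x \<bullet> v) * A f x))) \<in> X"
        by (rule XI)
    qed
    show "\<exists>G\<in>X. \<forall>f\<in>schwartz. \<forall>x. G f x = complex_of_real (x \<bullet> b) * F f x"
    proof (intro bexI ballI allI)
      show "phase (x \<bullet> K x / 2) * (complex_of_real (x \<bullet> b) * A f x) = complex_of_real (x \<bullet> b) * F f x" for f x
        by (simp add: F)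
      have "schwartz_op (\<lambda>f x. complex_of_real (x \<bullet> b) * A f x)"
        by (rule schwartz_op_compose[OF schwartz_op_coord A])
      then show "(\<lambda>f x. phase (x \<bullet> K x / 2) * (complex_of_real (x \<bullet> b) * A f x)) \<in> X" by (rule XI)
    qed
  qed simp
qed

text \<open>All derivatives vanish off the support, whose complement is open; on the compact support
  every weighted derivative is bounded by continuity.\<close>

lemma test_functions_schwartz:
  assumes "f \<in> test_functions"
  shows "f \<in> schwartz"
proof -
  define K where "K = closure {x. f x \<noteq> 0}"
  have K: "compact K" and sm: "smooth f" using assms by (auto simp: test_functions_def K_def)
  have zero: "iter_deriv vs f x = 0" if "vs \<in> lists Basis" "x \<notin> K" for vs x
    using that
  proof (induction vs arbitrary: x rule: list.induct)
    case Nil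
    then show ?case using closure_subset[of "{x. f x \<noteq> 0}"] by (auto simp: K_def)
  next
    case (Cons v vs)
    have "open (- K)" using K by (simp add: compact_imp_closed open_Compl)
    then have "(iter_deriv vs f has_derivative (\<lambda>h. 0)) (at x)"
      by (rule has_derivative_transform_within_open[OF has_derivative_const[of 0]])
        (use Cons in auto)
    then show ?case by (simp add: frechet_derivative_at[symmetric])
  qed
  have "bounded (range (\<lambda>x. (1 + norm x) ^ k * norm (iter_deriv vs f x)))"
    if vs: "vs \<in> lists Basis" for k vs
  proof -
    have "continuous_on K (\<lambda>x. (1 + norm x) ^ k * norm (iter_deriv vs f x))"
      using smooth_differentiable[OF sm vs]
      by (intro continuous_intros) (meson continuous_at_imp_continuous_on differentiable_imp_continuous_within)
    then have "compact ((\<lambda>x. (1 + norm x) ^ k * norm (iter_deriv vs f x)) ` K)"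
      by (rule compact_continuous_image[OF _ K])
    then have "bounded (insert 0 ((\<lambda>x. (1 + norm x) ^ k * norm (iter_deriv vs f x)) ` K))"
      by (simp add: compact_imp_bounded)
    then show ?thesis
    proof (rule bounded_subset, intro image_subsetI)
      fix x
      show "(1 + norm x) ^ k * norm (iter_deriv vs f x)
          \<in> insert 0 ((\<lambda>x. (1 + norm x) ^ k * norm (iter_deriv vs f x)) ` K)"
        by (cases "x \<in> K") (use zero[OF vs] in auto)
    qed
  qed
  then show ?thesis using sm by (simp add: schwartz_def)
qed

section \<open>Integrals of Schwartz functions\<close>

text \<open>Two powers per dimension, because \<open>(1 + norm x)\<^sup>2\<close> dominates each
  \<open>1 + (x \<bullet> b)\<^sup>2\<close>: the decay is at least that of a product of the
  integrable functions \<open>inverse (1 + t\<^sup>2)\<close>.\<close>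

definition decay_exponent :: "'a::euclidean_space itself \<Rightarrow> nat" where
  "decay_exponent _ = 2 * DIM('a)"

lemma integrable_decay:
  "integrable lborel (\<lambda>x::'a::euclidean_space. 1 / (1 + norm x) ^ decay_exponent TYPE('a))"
proof (rule integrableI_bounded)
  have "(\<integral>\<^sup>+x. ennreal (norm (1 / (1 + norm (x::'a)) ^ decay_exponent TYPE('a))) \<partial>lborel)
     \<le> (\<integral>\<^sup>+x. ennreal (\<Prod>b\<in>Basis. inverse (1 + (x \<bullet> b)\<^sup>2)) \<partial>(lborel :: 'a measure))"
  proof (intro nn_integral_mono ennreal_leI)
    fix x :: 'a
    have "1 + (x \<bullet> b)\<^sup>2 \<le> (1 + norm x)\<^sup>2" if "b \<in> Basis" for b
    proof -
      have "(x \<bullet> b)\<^sup>2 \<le> (norm x)\<^sup>2" using Basis_le_norm[OF that, of x] by (simp add: abs_le_square_iff[symmetric])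
      moreover have "(1 + norm x)\<^sup>2 = 1 + (norm x)\<^sup>2 + 2 * norm x" by (simp add: power2_sum)
      moreover have "0 \<le> norm x" by simp
      ultimately show ?thesis by linarith
    qed
    then have "(\<Prod>b\<in>(Basis::'a set). 1 + (x \<bullet> b)\<^sup>2) \<le> (\<Prod>b\<in>(Basis::'a set). (1 + norm x)\<^sup>2)"
      by (intro prod_mono) (auto intro: add_nonneg_nonneg)
    also have "\<dots> = (1 + norm x) ^ decay_exponent TYPE('a)"
      by (simp add: decay_exponent_def power_mult)
    finally have "1 / (1 + norm x) ^ decay_exponent TYPE('a) \<le> 1 / (\<Prod>b\<in>(Basis::'a set). 1 + (x \<bullet> b)\<^sup>2)"
      by (intro divide_left_mono mult_pos_pos prod_pos) (auto simp: add_pos_nonneg)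
    then show "norm (1 / (1 + norm x) ^ decay_exponent TYPE('a)) \<le> (\<Prod>b\<in>Basis. inverse (1 + (x \<bullet> b)\<^sup>2))"
      by (simp add: prod_dividef inverse_eq_divide)
  qed
  also have "\<dots> = (\<integral>\<^sup>+x. (\<Prod>b\<in>Basis. ennreal (inverse (1 + (x \<bullet> b)\<^sup>2))) \<partial>(lborel :: 'a measure))"
    by (simp add: prod_ennreal)
  also have "\<dots> = (\<Prod>b\<in>(Basis :: 'a set). (\<integral>\<^sup>+t. ennreal (inverse (1 + t\<^sup>2)) \<partial>lborel))"
    by (rule nn_integral_lborel_prod) auto
  also have "\<dots> < \<infinity>"
  proof -
    have "integrable lborel (\<lambda>t::real. inverse (1 + t\<^sup>2))"
      using integrable_inverse_1_plus_square by (simp add: set_integrable_def)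
    then have "(\<integral>\<^sup>+t. ennreal (inverse (1 + t\<^sup>2)) \<partial>(lborel :: real measure)) < \<infinity>"
      by (simp add: integrable_iff_bounded)
    then show ?thesis by (simp add: power_less_top_ennreal)
  qed
  finally show "(\<integral>\<^sup>+x. ennreal (norm (1 / (1 + norm (x::'a)) ^ decay_exponent TYPE('a))) \<partial>lborel) < \<infinity>" .
qed simp

lemma le_decay:
  fixes x :: "'a::euclidean_space"
  assumes "(1 + norm x) ^ k * a \<le> C"
  shows "a \<le> C * (1 / (1 + norm x) ^ k)"
proof -
  have "0 < (1 + norm x) ^ k" by (simp add: add_pos_nonneg)
  then show ?thesis using assms by (simp add: field_simps)
qed

text \<open>The second, quantitative part is what makes the Fourier transform continuous and not
  merely defined.\<close>

lemma decay_bound_integrable: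
  fixes f :: "'a::euclidean_space \<Rightarrow> complex"
  assumes [measurable]: "f \<in> borel_measurable borel"
    and bd: "\<And>x. (1 + norm x) ^ decay_exponent TYPE('a) * norm (f x) \<le> C"
  shows "integrable lborel f"
    and "norm (LINT x|lborel. f x) \<le> C * (LINT x|lborel. 1 / (1 + norm (x::'a)) ^ decay_exponent TYPE('a))"
proof -
  have le: "norm (f x) \<le> C * (1 / (1 + norm x) ^ decay_exponent TYPE('a))" for x
    by (rule le_decay[OF bd])
  have int: "integrable lborel (\<lambda>x. C * (1 / (1 + norm (x::'a)) ^ decay_exponent TYPE('a)))"
    by (intro integrable_mult_right integrable_decay)
  show f: "integrable lborel f"
    by (rule Bochner_Integration.integrable_bound[OF int]) (use order_trans[OF le abs_ge_self] in \<open>auto simp del: abs_divide intro!: AE_I2\<close>)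
  have "norm (LINT x|lborel. f x) \<le> (LINT x|lborel. norm (f x))" by simp
  also have "\<dots> \<le> (LINT x|lborel. C * (1 / (1 + norm (x::'a)) ^ decay_exponent TYPE('a)))"
    by (rule integral_mono[OF integrable_norm[OF f] int le])
  finally show "norm (LINT x|lborel. f x) \<le> C * (LINT x|lborel. 1 / (1 + norm (x::'a)) ^ decay_exponent TYPE('a))"
    by (simp only: integral_mult_right_zero)
qed

lemma schwartz_integrable: "f \<in> schwartz \<Longrightarrow> integrable lborel f"
  by (metis decay_bound_integrable(1) schwartz_decay schwartz_measurable)

section \<open>Mean value bounds and differentiation under the integral sign\<close>

lemma norm_diff_le_partial_deriv:
  fixes f :: "'a::euclidean_space \<Rightarrow> complex"
  assumes "convex S" "\<And>x. x \<in> S \<Longrightarrow> f differentiable (at x)"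
    and bd: "\<And>x b. x \<in> S \<Longrightarrow> b \<in> Basis \<Longrightarrow> norm (partial_deriv b f x) \<le> C"
    and "x \<in> S" "y \<in> S"
  shows "norm (f x - f y) \<le> real DIM('a) * C * norm (x - y)"
proof (rule differentiable_bound[OF assms(1)])
  fix z assume z: "z \<in> S"
  show "(f has_derivative (\<lambda>v. partial_deriv v f z)) (at z within S)"
    using has_derivative_partial_deriv[OF assms(2)[OF z]] by (rule has_derivative_at_withinI)
  show "onorm (\<lambda>v. partial_deriv v f z) \<le> real DIM('a) * C"
  proof (rule onorm_le)
    fix v :: 'a
    have "norm (partial_deriv v f z) \<le> (\<Sum>b\<in>(Basis::'a set). norm (complex_of_real (v \<bullet> b) * partial_deriv b f z))"
      unfolding partial_deriv_expand[OF assms(2)[OF z], of v] by (rule norm_sum)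
    also have "\<dots> \<le> (\<Sum>b\<in>(Basis::'a set). norm v * C)"
      unfolding norm_mult norm_of_real using bd[OF z] by (intro sum_mono mult_mono Basis_le_norm) auto
    finally show "norm (partial_deriv v f z) \<le> real DIM('a) * C * norm v" by (simp add: mult_ac)
  qed
qed (use assms in auto)

lemma schwartz_Lipschitz:
  fixes f :: "'a::euclidean_space \<Rightarrow> complex"
  assumes f: "f \<in> schwartz"
  obtains L where "0 \<le> L" "\<And>x y. norm (f x - f y) \<le> L * norm (x - y)"
proof -
  have "\<exists>C. 0 \<le> C \<and> (\<forall>x. norm (partial_deriv b f x) \<le> C)" if "b \<in> Basis" for b
    using schwartz_bounded[OF schwartz_partial_deriv[OF f that]] by metis
  then obtain C where C: "\<And>b. b \<in> Basis \<Longrightarrow> 0 \<le> C b" "\<And>b x. b \<in> Basis \<Longrightarrow> norm (partial_deriv b f x) \<le> C b"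
    by metis
  have le: "norm (partial_deriv b f x) \<le> (\<Sum>b\<in>Basis. C b)" if "b \<in> Basis" for b x
    using C that by (intro order_trans[OF C(2)] member_le_sum) auto
  show thesis
  proof
    show "0 \<le> real DIM('a) * (\<Sum>b\<in>Basis. C b)" using C by (intro mult_nonneg_nonneg sum_nonneg) auto
    show "norm (f x - f y) \<le> real DIM('a) * (\<Sum>b\<in>Basis. C b) * norm (x - y)" for x y
      using f le by (intro norm_diff_le_partial_deriv[of UNIV]) auto
  qed
qed

text \<open>Dominated convergence is applied to the remainder divided by \<open>norm h\<close>,
  along sequences tending to 0. Inside the unit ball the mean value inequality bounds the increment
  and the partial derivatives bound the linear part, each by the dimension times \<open>G s\<close>
  after the division.\<close>

lemma has_derivative_lebesgue_integral:
  fixes f :: "'s \<Rightarrow> 'a::euclidean_space \<Rightarrow> complex"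
  assumes int: "\<And>x. integrable M (\<lambda>s. f s x)"
    and diff: "\<And>s x. s \<in> space M \<Longrightarrow> f s differentiable (at x)"
    and G: "integrable M G"
    and bd: "\<And>s x b. s \<in> space M \<Longrightarrow> x \<in> ball x0 1 \<Longrightarrow> b \<in> Basis \<Longrightarrow> norm (partial_deriv b (f s) x) \<le> G s"
  shows "integrable M (\<lambda>s. partial_deriv v (f s) x0)"
    and "((\<lambda>x. LINT s|M. f s x) has_derivative (\<lambda>v. LINT s|M. partial_deriv v (f s) x0)) (at x0)"
proof -
  have [measurable]: "(\<lambda>s. f s x) \<in> borel_measurable M" for x using int[of x] by auto
  \<comment> \<open>Measurability in \<open>s\<close> is inherited from the difference quotients
    with step \<open>1 / Suc n\<close>, which converge pointwise.\<close>
  have [measurable]: "(\<lambda>s. partial_deriv v (f s) x0) \<in> borel_measurable M" for v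
  proof (rule borel_measurable_LIMSEQ_metric)
    fix s assume s: "s \<in> space M"
    have "(f s has_derivative (\<lambda>v. partial_deriv v (f s) x0)) (at x0)"
      by (rule has_derivative_partial_deriv[OF diff[OF s]])
    have line: "((\<lambda>t. x0 + t *\<^sub>R v) has_derivative (\<lambda>t. t *\<^sub>R v)) (at 0)"
      by (auto intro!: derivative_eq_intros)
    have "((\<lambda>t. f s (x0 + t *\<^sub>R v)) has_derivative (\<lambda>t. partial_deriv (t *\<^sub>R v) (f s) x0)) (at 0)"
      using has_derivative_compose[OF line, of "f s" "\<lambda>v. partial_deriv v (f s) x0"] \<open>(f s has_derivative _) (at x0)\<close> by simp
    then have lim0: "((\<lambda>t. norm (f s (x0 + t *\<^sub>R v) - f s x0 - partial_deriv (t *\<^sub>R v) (f s) x0) / norm t) \<longlongrightarrow> 0) (at 0)"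
      by (simp add: has_derivative_at)
    have "linear (\<lambda>v. partial_deriv v (f s) x0)"
      using has_derivative_partial_deriv[OF diff[OF s]] by (rule has_derivative_linear)
    then have "norm (f s (x0 + t *\<^sub>R v) - f s x0 - partial_deriv (t *\<^sub>R v) (f s) x0) / norm t
        = norm ((f s (x0 + t *\<^sub>R v) - f s x0) /\<^sub>R t - partial_deriv v (f s) x0)" if "t \<noteq> 0" for t
    proof -
      have "(f s (x0 + t *\<^sub>R v) - f s x0) /\<^sub>R t - partial_deriv v (f s) x0
          = (f s (x0 + t *\<^sub>R v) - f s x0 - partial_deriv (t *\<^sub>R v) (f s) x0) /\<^sub>R t"
        using that linear_scale[OF \<open>linear (\<lambda>v. partial_deriv v (f s) x0)\<close>, of t v]
        by (simp add: scaleR_diff_right)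
      then show ?thesis by (simp add: divide_inverse mult.commute)
    qed
    then have "((\<lambda>t. norm ((f s (x0 + t *\<^sub>R v) - f s x0) /\<^sub>R t - partial_deriv v (f s) x0)) \<longlongrightarrow> 0) (at 0)"
      by (intro Lim_transform_eventually[OF lim0]) (auto simp: eventually_at_filter)
    then have lim: "((\<lambda>t. (f s (x0 + t *\<^sub>R v) - f s x0) /\<^sub>R t) \<longlongrightarrow> partial_deriv v (f s) x0) (at 0)"
      by (rule LIM_zero_cancel[OF tendsto_norm_zero_cancel])
    show "(\<lambda>n. (f s (x0 + (1 / real (Suc n)) *\<^sub>R v) - f s x0) /\<^sub>R (1 / real (Suc n)))
        \<longlonglongrightarrow> partial_deriv v (f s) x0"
      using LIMSEQ_Suc[OF lim_1_over_n[where 'a = real]]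
      by (intro filterlim_compose[OF lim]) (auto simp: filterlim_at simp del: of_nat_Suc)
  qed measurable
  have pbd: "norm (partial_deriv v (f s) x0) \<le> real DIM('a) * norm v * G s" if s: "s \<in> space M" for s v
  proof -
    have "norm (partial_deriv v (f s) x0) \<le> (\<Sum>b\<in>(Basis::'a set). norm (complex_of_real (v \<bullet> b) * partial_deriv b (f s) x0))"
      unfolding partial_deriv_expand[OF diff[OF s], of v] by (rule norm_sum)
    also have "\<dots> \<le> (\<Sum>b\<in>(Basis::'a set). norm v * G s)"
      unfolding norm_mult norm_of_real using bd[OF s] by (intro sum_mono mult_mono Basis_le_norm) auto
    finally show ?thesis by (simp add: mult_ac)
  qed
  show pint: "integrable M (\<lambda>s. partial_deriv v (f s) x0)" for v
    by (rule Bochner_Integration.integrable_bound[OF integrable_mult_right[OF G, of "real DIM('a) * norm v"]])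
      (auto intro!: AE_I2 order_trans[OF pbd])
  have lin: "linear (\<lambda>v. partial_deriv v (f s) x0)" if "s \<in> space M" for s
    using has_derivative_partial_deriv[OF diff[OF that]] by (rule has_derivative_linear)
  have lin': "linear (\<lambda>v. LINT s|M. partial_deriv v (f s) x0)"
  proof (rule linearI)
    fix v w :: 'a and r :: real
    have "(LINT s|M. partial_deriv (v + w) (f s) x0) = (LINT s|M. partial_deriv v (f s) x0 + partial_deriv w (f s) x0)"
      by (rule Bochner_Integration.integral_cong) (auto simp: linear_add[OF lin])
    then show "(LINT s|M. partial_deriv (v + w) (f s) x0) = (LINT s|M. partial_deriv v (f s) x0) + (LINT s|M. partial_deriv w (f s) x0)"
      by (simp add: pint)
    have "(LINT s|M. partial_deriv (r *\<^sub>R v) (f s) x0) = (LINT s|M. r *\<^sub>R partial_deriv v (f s) x0)"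
      by (rule Bochner_Integration.integral_cong) (auto simp: linear_scale[OF lin])
    then show "(LINT s|M. partial_deriv (r *\<^sub>R v) (f s) x0) = r *\<^sub>R (LINT s|M. partial_deriv v (f s) x0)"
      by simp
  qed
  have lim0: "((\<lambda>h. (LINT s|M. (f s (x0 + h) - f s x0 - partial_deriv h (f s) x0) /\<^sub>R norm h)) \<longlongrightarrow> 0) (at 0)"
    unfolding tendsto_at_iff_sequentially comp_def
  proof (intro allI impI)
    fix X :: "nat \<Rightarrow> 'a" assume X: "\<forall>i. X i \<in> UNIV - {0}" "X \<longlonglongrightarrow> 0"
    \<comment> \<open>The majorant is available in the unit ball only, so finitely many terms of the
      sequence are dropped.\<close>
    obtain n0 where n0: "\<And>n. n \<ge> n0 \<Longrightarrow> norm (X n) < 1"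
      using LIMSEQ_D[OF X(2), of 1] by auto
    define Y where "Y n = X (n + n0)" for n
    have Y: "Y n \<noteq> 0" "norm (Y n) < 1" for n using X n0 by (auto simp: Y_def)
    have Y0: "Y \<longlonglongrightarrow> 0" unfolding Y_def using X(2) by (rule LIMSEQ_ignore_initial_segment)
    have "(\<lambda>n. (LINT s|M. (f s (x0 + Y n) - f s x0 - partial_deriv (Y n) (f s) x0) /\<^sub>R norm (Y n)))
        \<longlonglongrightarrow> (LINT s|M. 0)"
    proof (rule integral_dominated_convergence)
      show "integrable M (\<lambda>s. 2 * real DIM('a) * G s)" by (intro integrable_mult_right G)
      show "AE s in M. (\<lambda>n. (f s (x0 + Y n) - f s x0 - partial_deriv (Y n) (f s) x0) /\<^sub>R norm (Y n)) \<longlonglongrightarrow> 0"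
      proof (rule AE_I2)
        fix s assume s: "s \<in> space M"
        have "((\<lambda>h. norm (f s (x0 + h) - f s x0 - partial_deriv h (f s) x0) / norm h) \<longlongrightarrow> 0) (at 0)"
          using has_derivative_partial_deriv[OF diff[OF s]] by (simp add: has_derivative_at)
        then have "(\<lambda>n. norm (f s (x0 + Y n) - f s x0 - partial_deriv (Y n) (f s) x0) / norm (Y n)) \<longlonglongrightarrow> 0"
          by (rule filterlim_compose) (use Y Y0 in \<open>auto simp: filterlim_at\<close>)
        then show "(\<lambda>n. (f s (x0 + Y n) - f s x0 - partial_deriv (Y n) (f s) x0) /\<^sub>R norm (Y n)) \<longlonglongrightarrow> 0"
          by (subst tendsto_norm_zero_iff[symmetric]) (simp add: divide_inverse mult.commute)
      qed
      show "AE s in M. norm ((f s (x0 + Y n) - f s x0 - partial_deriv (Y n) (f s) x0) /\<^sub>R norm (Y n))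
          \<le> 2 * real DIM('a) * G s" for n
      proof (rule AE_I2)
        fix s assume s: "s \<in> space M"
        have "norm (f s (x0 + Y n) - f s x0) \<le> real DIM('a) * G s * norm (x0 + Y n - x0)"
          by (rule norm_diff_le_partial_deriv[of "ball x0 1"]) (use bd[OF s] diff[OF s] Y in \<open>auto simp: dist_norm\<close>)
        then have "norm (f s (x0 + Y n) - f s x0) \<le> real DIM('a) * G s * norm (Y n)" by simp
        then have "norm (f s (x0 + Y n) - f s x0 - partial_deriv (Y n) (f s) x0)
            \<le> real DIM('a) * G s * norm (Y n) + real DIM('a) * norm (Y n) * G s"
          using pbd[OF s, of "Y n"]
            norm_triangle_ineq4[of "f s (x0 + Y n) - f s x0" "partial_deriv (Y n) (f s) x0"] by linarith
        then show "norm ((f s (x0 + Y n) - f s x0 - partial_deriv (Y n) (f s) x0) /\<^sub>R norm (Y n))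
          \<le> 2 * real DIM('a) * G s"
        proof -
          assume le: "norm (f s (x0 + Y n) - f s x0 - partial_deriv (Y n) (f s) x0)
            \<le> real DIM('a) * G s * norm (Y n) + real DIM('a) * norm (Y n) * G s"
          have "norm ((f s (x0 + Y n) - f s x0 - partial_deriv (Y n) (f s) x0) /\<^sub>R norm (Y n))
            = norm (f s (x0 + Y n) - f s x0 - partial_deriv (Y n) (f s) x0) / norm (Y n)"
            by (simp add: divide_inverse mult.commute)
          also have "\<dots> \<le> 2 * real DIM('a) * G s"
            using le Y(1)[of n] by (simp add: pos_divide_le_eq mult_ac)
          finally show ?thesis .
        qed
      qed
    qed measurable
    then show "(\<lambda>n. (LINT s|M. (f s (x0 + X n) - f s x0 - partial_deriv (X n) (f s) x0) /\<^sub>R norm (X n))) \<longlonglongrightarrow> 0"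
      using LIMSEQ_offset[of "\<lambda>n. LINT s|M. (f s (x0 + X n) - f s x0 - partial_deriv (X n) (f s) x0) /\<^sub>R norm (X n)" n0 0]
      by (simp add: Y_def)
  qed
  have eq: "(LINT s|M. (f s (x0 + h) - f s x0 - partial_deriv h (f s) x0) /\<^sub>R norm h)
      = ((LINT s|M. f s (x0 + h)) - (LINT s|M. f s x0) - (LINT s|M. partial_deriv h (f s) x0)) /\<^sub>R norm h" for h
    by (simp add: int pint)
  show "((\<lambda>x. LINT s|M. f s x) has_derivative (\<lambda>v. LINT s|M. partial_deriv v (f s) x0)) (at x0)"
    unfolding has_derivative_at
  proof
    show "bounded_linear (\<lambda>v. LINT s|M. partial_deriv v (f s) x0)"
      using lin' by (simp add: linear_conv_bounded_linear)
    show "((\<lambda>h. norm ((LINT s|M. f s (x0 + h)) - (LINT s|M. f s x0) - (LINT s|M. partial_deriv h (f s) x0)) / norm h) \<longlongrightarrow> 0) (at 0)"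
      using tendsto_norm_zero[OF lim0] unfolding eq by (simp add: divide_inverse mult.commute)
  qed
qed

section \<open>Time-frequency shifts\<close>

text \<open>Translation precedes modulation: with this order
  \<open>windowed_fourier w u y \<xi>\<close> is exactly \<open>u (tf_shift y \<xi> w)\<close>.
  Exchanging the two costs a constant phase.\<close>

definition tf_shift :: "'a::euclidean_space \<Rightarrow> 'a \<Rightarrow> ('a \<Rightarrow> complex) \<Rightarrow> 'a \<Rightarrow> complex" where
  "tf_shift y \<xi> f = (\<lambda>x. f (x - y) * phase (x \<bullet> \<xi>))"

lemma norm_tf_shift: "norm (tf_shift y \<xi> f x) = norm (f (x - y))"
  by (simp add: tf_shift_def norm_mult)

lemma has_derivative_tf_shift:
  assumes "f \<in> schwartz"
  shows "(tf_shift y \<xi> f has_derivative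
    (\<lambda>v. tf_shift y \<xi> (partial_deriv v f) x + - \<i> * complex_of_real (v \<bullet> \<xi>) * tf_shift y \<xi> f x)) (at x)"
proof -
  have 1: "((\<lambda>x. f (x - y)) has_derivative (\<lambda>v. partial_deriv v f (x - y))) (at x)"
    by (rule has_derivative_compose[OF _ has_derivative_partial_deriv[OF schwartz_differentiable[OF assms]],
      of "\<lambda>x. x - y" "\<lambda>v. v"]) (auto intro!: derivative_eq_intros)
  have 2: "((\<lambda>x. x \<bullet> \<xi>) has_derivative (\<lambda>v. v \<bullet> \<xi>)) (at x)" by (auto intro!: derivative_eq_intros)
  show ?thesis
    using has_derivative_mult[OF 1 has_derivative_phase[OF 2]]
    unfolding tf_shift_def by (simp add: add.commute mult_ac)
qed

lemma partial_deriv_tf_shift: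
  "f \<in> schwartz \<Longrightarrow> partial_deriv b (tf_shift y \<xi> f) x
     = tf_shift y \<xi> (partial_deriv b f) x + - \<i> * complex_of_real (b \<bullet> \<xi>) * tf_shift y \<xi> f x"
  by (rule partial_deriv_eqI[OF has_derivative_tf_shift])

lemma coord_tf_shift:
  "complex_of_real (x \<bullet> b) * tf_shift y \<xi> f x
     = tf_shift y \<xi> (\<lambda>x. complex_of_real (x \<bullet> b) * f x) x + complex_of_real (y \<bullet> b) * tf_shift y \<xi> f x"
  by (simp add: tf_shift_def algebra_simps inner_diff_left)

section \<open>Growth and continuity of shifts in their parameters\<close>

definition poly_growth :: "('s::real_normed_vector \<Rightarrow> complex) \<Rightarrow> bool" where
  "poly_growth p \<longleftrightarrow> continuous_on UNIV p \<and> (\<exists>C k. 0 \<le> C \<and> (\<forall>s. norm (p s) \<le> C * (1 + norm s) ^ k))"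

lemma poly_growth_mult:
  assumes "poly_growth p" "poly_growth q"
  shows "poly_growth (\<lambda>s. p s * q s)"
proof -
  obtain C k D l where *: "0 \<le> C" "\<And>s. norm (p s) \<le> C * (1 + norm s) ^ k"
    "0 \<le> D" "\<And>s. norm (q s) \<le> D * (1 + norm s) ^ l"
    using assms by (auto simp: poly_growth_def)
  have "norm (p s * q s) \<le> (C * D) * (1 + norm s) ^ (k + l)" for s
  proof -
    have "norm (p s * q s) \<le> (C * (1 + norm s) ^ k) * (D * (1 + norm s) ^ l)"
      unfolding norm_mult using * by (intro mult_mono) auto
    then show ?thesis by (simp add: power_add mult_ac)
  qed
  then show ?thesis using assms * unfolding poly_growth_def
    by (intro conjI continuous_on_mult exI[of _ "C * D"] exI[of _ "k + l"]) auto
qed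

lemma poly_growth_const: "poly_growth (\<lambda>s. c)"
  unfolding poly_growth_def by (intro conjI exI[of _ "norm c"] exI[of _ 0] continuous_on_const) auto

lemma poly_growth_linear:
  assumes "bounded_linear f"
  shows "poly_growth (\<lambda>s. complex_of_real (f s))"
proof -
  interpret bounded_linear f by fact
  obtain K where K: "0 \<le> K" "\<And>s. norm (f s) \<le> norm s * K" using nonneg_bounded by blast
  have "norm (complex_of_real (f s)) \<le> K * (1 + norm s) ^ 1" for s
    using K(1) order_trans[OF K(2)[of s], of "K * (1 + norm s)"] by (simp add: algebra_simps)
  then show ?thesis unfolding poly_growth_def using K(1)
    by (intro conjI continuous_intros continuous_on_of_real linear_continuous_on assms) blast
qed

definition poly_weights :: "('s::real_normed_vector \<Rightarrow> real) set" where
  "poly_weights = {N. \<exists>C k. 0 \<le> C \<and> (\<forall>s. N s \<le> C * (1 + norm s) ^ k)}"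

lemma weight_cone_poly [simp]: "weight_cone (poly_weights :: ('s::real_normed_vector \<Rightarrow> real) set)"
  unfolding weight_cone_def
proof (intro conjI ballI allI impI)
  fix M N :: "'s \<Rightarrow> real" assume "M \<in> poly_weights" "N \<in> poly_weights"
  then obtain C k D l where *: "0 \<le> C" "\<And>s. M s \<le> C * (1 + norm s) ^ k"
    "0 \<le> D" "\<And>s. N s \<le> D * (1 + norm s) ^ l"
    unfolding poly_weights_def by blast
  have "M s + N s \<le> (C + D) * (1 + norm s) ^ (k + l)" for s
  proof -
    have "M s \<le> C * (1 + norm s) ^ (k + l)"
      using * by (intro order_trans[OF *(2)] mult_left_mono power_increasing) auto
    moreover have "N s \<le> D * (1 + norm s) ^ (k + l)"
      using * by (intro order_trans[OF *(4)] mult_left_mono power_increasing) auto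
    ultimately show ?thesis by (simp add: distrib_right)
  qed
  then show "(\<lambda>i. M i + N i) \<in> poly_weights" unfolding poly_weights_def using *
    by (intro CollectI exI[of _ "C + D"] exI[of _ "k + l"]) auto
next
  fix N :: "'s \<Rightarrow> real" and c :: real assume "N \<in> poly_weights" and c: "0 \<le> c"
  then obtain C k where *: "0 \<le> C" "\<And>s. N s \<le> C * (1 + norm s) ^ k"
    unfolding poly_weights_def by blast
  then have "c * N s \<le> (c * C) * (1 + norm s) ^ k" for s
    using mult_left_mono[OF *(2) c] by (simp add: mult.assoc)
  then show "(\<lambda>i. c * N i) \<in> poly_weights" unfolding poly_weights_def using * c
    by (intro CollectI exI[of _ "c * C"] exI[of _ k]) auto
next
  show "(\<lambda>i. 0) \<in> (poly_weights :: ('s \<Rightarrow> real) set)" unfolding poly_weights_def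
    by (intro CollectI exI[of _ 0]) auto
qed

text \<open>Such bounds on the seminorms of \<open>F s - F s0\<close> express continuity at
  \<open>s0\<close> for the Schwartz topology. The limit is punctured, as in
  \<open>isCont_def\<close>.\<close>

definition vanishing_weights :: "'s::topological_space \<Rightarrow> ('s \<Rightarrow> real) set" where
  "vanishing_weights s0 = {N. \<exists>M. (\<forall>s. N s \<le> M s) \<and> (M \<longlongrightarrow> 0) (at s0)}"

lemma weight_cone_vanishing [simp]: "weight_cone (vanishing_weights s0)"
  unfolding weight_cone_def
proof (intro conjI ballI allI impI)
  fix M N assume "M \<in> vanishing_weights s0" "N \<in> vanishing_weights s0"
  then obtain M' N' where *: "\<And>s. M s \<le> M' s" "(M' \<longlongrightarrow> 0) (at s0)" "\<And>s. N s \<le> N' s" "(N' \<longlongrightarrow> 0) (at s0)"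
    unfolding vanishing_weights_def by blast
  then show "(\<lambda>i. M i + N i) \<in> vanishing_weights s0" unfolding vanishing_weights_def
    using tendsto_add[OF *(2) *(4)] by (intro CollectI exI[of _ "\<lambda>i. M' i + N' i"]) (auto intro: add_mono)
next
  fix N and c :: real assume "N \<in> vanishing_weights s0" and c: "0 \<le> c"
  then obtain N' where *: "\<And>s. N s \<le> N' s" "(N' \<longlongrightarrow> 0) (at s0)" unfolding vanishing_weights_def by blast
  then show "(\<lambda>i. c * N i) \<in> vanishing_weights s0" unfolding vanishing_weights_def
    using tendsto_mult_right_zero[OF *(2), of c] c
    by (intro CollectI exI[of _ "\<lambda>i. c * N' i"]) (auto intro: mult_left_mono)
next
  show "(\<lambda>i. 0) \<in> vanishing_weights s0" unfolding vanishing_weights_def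
    by (intro CollectI exI[of _ "\<lambda>i. 0"]) auto
qed

text \<open>The coefficients \<open>p\<close> are forced: a derivative of a shift produces the
  factor \<open>b \<bullet> snd s\<close>, a coordinate the factor
  \<open>fst s \<bullet> b\<close>.\<close>

definition tf_family :: "('a::euclidean_space \<times> 'a \<Rightarrow> 'a \<Rightarrow> complex) set" where
  "tf_family = {\<lambda>s x. p s * tf_shift (fst s) (snd s) g x | p g. poly_growth p \<and> g \<in> schwartz}"

lemma tf_familyI:
  "poly_growth p \<Longrightarrow> g \<in> schwartz \<Longrightarrow> (\<lambda>s x. p s * tf_shift (fst s) (snd s) g x) \<in> tf_family"
  unfolding tf_family_def by blast

lemma tf_familyE:
  assumes "F \<in> tf_family"
  obtains p g where "poly_growth p" "g \<in> schwartz" "F = (\<lambda>s x. p s * tf_shift (fst s) (snd s) g x)"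
  using assms unfolding tf_family_def by blast

lemma tf_family_differentiable: "F \<in> tf_family \<Longrightarrow> F s differentiable (at x)"
  by (elim tf_familyE) (auto intro!: differentiable_mult differentiableI[OF has_derivative_tf_shift])

lemma tf_family_partial_deriv:
  assumes "F \<in> tf_family" "b \<in> Basis"
  shows "\<exists>G\<in>tf_family. \<exists>H\<in>tf_family. \<forall>s x. partial_deriv b (F s) x = G s x + H s x"
proof -
  obtain p g where p: "poly_growth p" and g: "g \<in> schwartz"
    and F: "F = (\<lambda>s x. p s * tf_shift (fst s) (snd s) g x)" using assms(1) by (rule tf_familyE)
  have eq: "partial_deriv b (F s) x = p s * tf_shift (fst s) (snd s) (partial_deriv b g) x
      + (p s * (- \<i> * complex_of_real (b \<bullet> snd s))) * tf_shift (fst s) (snd s) g x" for s x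
    unfolding F partial_deriv_cmult[OF differentiableI[OF has_derivative_tf_shift[OF g]]]
      partial_deriv_tf_shift[OF g] by (simp add: algebra_simps)
  have "poly_growth (\<lambda>s::'a \<times> 'a. complex_of_real (b \<bullet> snd s))"
    by (intro poly_growth_linear bounded_linear_intros)
  then have "poly_growth (\<lambda>s. p s * (- \<i> * complex_of_real (b \<bullet> snd s)))"
    by (intro poly_growth_mult p poly_growth_const)
  then have H: "(\<lambda>s x. (p s * (- \<i> * complex_of_real (b \<bullet> snd s))) * tf_shift (fst s) (snd s) g x) \<in> tf_family"
    by (rule tf_familyI[OF _ g])
  show ?thesis
    by (rule bexI[OF bexI[OF _ H] tf_familyI[OF p schwartz_partial_deriv[OF g assms(2)]]]) (simp add: eq)
qed

lemma tf_family_coord: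
  assumes "F \<in> tf_family"
  shows "\<exists>G\<in>tf_family. \<exists>H\<in>tf_family. \<forall>s x. complex_of_real (x \<bullet> b) * F s x = G s x + H s x"
proof -
  obtain p g where p: "poly_growth p" and g: "g \<in> schwartz"
    and F: "F = (\<lambda>s x. p s * tf_shift (fst s) (snd s) g x)" using assms(1) by (rule tf_familyE)
  have eq: "complex_of_real (x \<bullet> b) * F s x
      = p s * tf_shift (fst s) (snd s) (\<lambda>x. complex_of_real (x \<bullet> b) * g x) x
      + (p s * complex_of_real (fst s \<bullet> b)) * tf_shift (fst s) (snd s) g x" for s x
    unfolding F using coord_tf_shift[of x b "fst s" "snd s" g] by (simp add: algebra_simps)
  have "poly_growth (\<lambda>s::'a \<times> 'a. complex_of_real (fst s \<bullet> b))"
    by (intro poly_growth_linear bounded_linear_intros)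
  then have "poly_growth (\<lambda>s. p s * complex_of_real (fst s \<bullet> b))"
    by (intro poly_growth_mult p)
  then have H: "(\<lambda>s x. (p s * complex_of_real (fst s \<bullet> b)) * tf_shift (fst s) (snd s) g x) \<in> tf_family"
    by (rule tf_familyI[OF _ g])
  show ?thesis
    by (rule bexI[OF bexI[OF _ H] tf_familyI[OF p schwartz_coord[OF g, of b]]]) (simp add: eq)
qed

lemma dominated_tf_family:
  fixes F :: "'a::euclidean_space \<times> 'a \<Rightarrow> 'a \<Rightarrow> complex"
  assumes "F \<in> tf_family"
  shows "dominated poly_weights UNIV F"
proof (rule dominated_coinduct_sum[OF weight_cone_poly assms])
  fix F :: "'a \<times> 'a \<Rightarrow> 'a \<Rightarrow> complex" assume "F \<in> tf_family"
  then obtain p g where p: "poly_growth p" and g: "g \<in> schwartz"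
    and F: "F = (\<lambda>s x. p s * tf_shift (fst s) (snd s) g x)" by (rule tf_familyE)
  obtain C k where C: "0 \<le> C" "\<And>s. norm (p s) \<le> C * (1 + norm s) ^ k"
    using p unfolding poly_growth_def by blast
  obtain D where D: "0 \<le> D" "\<And>x. norm (g x) \<le> D" using schwartz_bounded[OF g] by blast
  have "norm (F s x) \<le> (C * D) * (1 + norm s) ^ k" for s x
  proof -
    have "norm (F s x) \<le> (C * (1 + norm s) ^ k) * D"
      unfolding F norm_mult norm_tf_shift using C D by (intro mult_mono) auto
    then show ?thesis by (simp add: mult_ac)
  qed
  moreover have "(\<lambda>s. (C * D) * (1 + norm s) ^ k) \<in> (poly_weights :: ('a \<times> 'a \<Rightarrow> real) set)"
    unfolding poly_weights_def using C(1) D(1) by (intro CollectI exI[of _ "C * D"] exI[of _ k]) auto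
  ultimately show "\<exists>N\<in>poly_weights. \<forall>s\<in>UNIV. \<forall>x. norm (F s x) \<le> N s"
    by (intro bexI[of _ "\<lambda>s. (C * D) * (1 + norm s) ^ k"]) auto
qed (use tf_family_differentiable tf_family_partial_deriv tf_family_coord in auto)

text \<open>Uniformity in \<open>x\<close> is the point. The increment of the phase grows with
  \<open>norm x\<close>; the decay of \<open>g\<close> compensates it, at the price of the factor
  \<open>1 + norm y0\<close>. The translation part uses a Lipschitz bound for
  \<open>g\<close>.\<close>

lemma norm_tf_shift_diff_le:
  assumes g: "g \<in> schwartz"
  obtains L where "\<And>y \<xi> y0 \<xi>0 x. norm (tf_shift y \<xi> g x - tf_shift y0 \<xi>0 g x)
     \<le> L * norm (y - y0) + L * (1 + norm y0) * norm (\<xi> - \<xi>0)"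
proof -
  obtain L where L: "0 \<le> L" "\<And>x y. norm (g x - g y) \<le> L * norm (x - y)" using schwartz_Lipschitz[OF g] by blast
  obtain C where C: "0 \<le> C" "\<And>x. (1 + norm x) ^ 1 * norm (g x) \<le> C" using schwartz_decay[OF g] by blast
  have "norm (tf_shift y \<xi> g x - tf_shift y0 \<xi>0 g x) \<le> (L + C) * norm (y - y0) + (L + C) * (1 + norm y0) * norm (\<xi> - \<xi>0)"
    for y \<xi> y0 \<xi>0 x
  proof -
    have "tf_shift y \<xi> g x - tf_shift y0 \<xi>0 g x
        = (g (x - y) - g (x - y0)) * phase (x \<bullet> \<xi>) + g (x - y0) * (phase (x \<bullet> \<xi>) - phase (x \<bullet> \<xi>0))"
      by (simp add: tf_shift_def algebra_simps)
    also have "norm \<dots> \<le> norm (g (x - y) - g (x - y0)) + norm (g (x - y0)) * norm (phase (x \<bullet> \<xi>) - phase (x \<bullet> \<xi>0))"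
      by (rule order_trans[OF norm_triangle_ineq]) (simp add: norm_mult)
    also have "norm (g (x - y) - g (x - y0)) \<le> L * norm (y - y0)"
      using L(2)[of "x - y" "x - y0"] by (simp add: norm_minus_commute)
    also have "norm (g (x - y0)) * norm (phase (x \<bullet> \<xi>) - phase (x \<bullet> \<xi>0)) \<le> C * (1 + norm y0) * norm (\<xi> - \<xi>0)"
    proof -
      have "norm (phase (x \<bullet> \<xi>) - phase (x \<bullet> \<xi>0)) \<le> norm x * norm (\<xi> - \<xi>0)"
        using norm_phase_diff_le[of "x \<bullet> \<xi>" "x \<bullet> \<xi>0"] Cauchy_Schwarz_ineq2[of x "\<xi> - \<xi>0"]
        by (simp add: inner_diff_right)
      \<comment> \<open>Separates the growth in \<open>x - y0\<close>, which \<open>g\<close>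
        absorbs, from the growth in \<open>y0\<close>, which is constant for a fixed base
        point.\<close>
      moreover have "norm x \<le> (1 + norm (x - y0)) * (1 + norm y0)"
      proof -
        have "(1 + norm (x - y0)) * (1 + norm y0) = 1 + norm (x - y0) + norm y0 + norm (x - y0) * norm y0"
          by (simp add: algebra_simps)
        moreover have "norm x \<le> norm (x - y0) + norm y0" using norm_triangle_ineq[of "x - y0" y0] by simp
        moreover have "0 \<le> norm (x - y0) * norm y0" by simp
        ultimately show ?thesis by linarith
      qed
      ultimately have "norm (phase (x \<bullet> \<xi>) - phase (x \<bullet> \<xi>0)) \<le> (1 + norm (x - y0)) * (1 + norm y0) * norm (\<xi> - \<xi>0)"
        by (meson mult_right_mono norm_ge_zero order_trans)
      then have "norm (g (x - y0)) * norm (phase (x \<bullet> \<xi>) - phase (x \<bullet> \<xi>0))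
          \<le> norm (g (x - y0)) * ((1 + norm (x - y0)) * (1 + norm y0) * norm (\<xi> - \<xi>0))"
        by (rule mult_left_mono) simp
      also have "\<dots> = ((1 + norm (x - y0)) ^ 1 * norm (g (x - y0))) * ((1 + norm y0) * norm (\<xi> - \<xi>0))"
        by (simp add: mult_ac)
      also have "\<dots> \<le> C * ((1 + norm y0) * norm (\<xi> - \<xi>0))"
        by (intro mult_right_mono C) auto
      finally show ?thesis by (simp add: mult.assoc)
    qed
    finally have "norm (tf_shift y \<xi> g x - tf_shift y0 \<xi>0 g x) \<le> L * norm (y - y0) + C * (1 + norm y0) * norm (\<xi> - \<xi>0)"
      by simp
    also have "\<dots> \<le> (L + C) * norm (y - y0) + (L + C) * (1 + norm y0) * norm (\<xi> - \<xi>0)"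
      using L C by (intro add_mono mult_right_mono) auto
    finally show ?thesis .
  qed
  then show thesis by (rule that)
qed

text \<open>The derivative and coordinate rules of \<open>tf_family\<close> hold at all parameters
  with the same two families and hence pass to differences; only the sup norm needs an
  estimate.\<close>

lemma dominated_tf_family_diff:
  fixes F :: "'a::euclidean_space \<times> 'a \<Rightarrow> 'a \<Rightarrow> complex"
  assumes "F \<in> tf_family"
  shows "dominated (vanishing_weights s0) UNIV (\<lambda>s x. F s x - F s0 x)"
proof -
  define X where "X = (\<lambda>F s x. F s x - F s0 x) ` (tf_family :: ('a \<times> 'a \<Rightarrow> 'a \<Rightarrow> complex) set)"
  have XI: "(\<lambda>s x. F s x - F s0 x) \<in> X" if "F \<in> tf_family" for F
    unfolding X_def using that by (rule imageI)
  show ?thesis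
  proof (rule dominated_coinduct_sum[OF weight_cone_vanishing XI[OF assms]])
    fix H assume "H \<in> X"
    then obtain F where F: "F \<in> tf_family" and H: "H = (\<lambda>s x. F s x - F s0 x)" unfolding X_def by blast
    obtain p g where p: "poly_growth p" and g: "g \<in> schwartz"
      and Fp: "F = (\<lambda>s x. p s * tf_shift (fst s) (snd s) g x)" using F by (rule tf_familyE)
    show "\<exists>N\<in>vanishing_weights s0. \<forall>s\<in>UNIV. \<forall>x. norm (H s x) \<le> N s"
    proof -
      obtain D where D: "0 \<le> D" "\<And>x. norm (g x) \<le> D" using schwartz_bounded[OF g] by blast
      obtain L where L: "\<And>y \<xi> y0 \<xi>0 x. norm (tf_shift y \<xi> g x - tf_shift y0 \<xi>0 g x)
         \<le> L * norm (y - y0) + L * (1 + norm y0) * norm (\<xi> - \<xi>0)" using norm_tf_shift_diff_le[OF g] by blast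
      define N where "N s = norm (p s - p s0) * D
        + norm (p s0) * (L * norm (fst s - fst s0) + L * (1 + norm (fst s0)) * norm (snd s - snd s0))" for s
      have "norm (H s x) \<le> N s" for s x
      proof -
        have "H s x = (p s - p s0) * tf_shift (fst s) (snd s) g x
          + p s0 * (tf_shift (fst s) (snd s) g x - tf_shift (fst s0) (snd s0) g x)"
          by (simp add: H Fp algebra_simps)
        also have "norm \<dots> \<le> norm (p s - p s0) * norm (g (x - fst s))
          + norm (p s0) * norm (tf_shift (fst s) (snd s) g x - tf_shift (fst s0) (snd s0) g x)"
          by (rule order_trans[OF norm_triangle_ineq]) (simp add: norm_mult norm_tf_shift)
        also have "\<dots> \<le> N s" unfolding N_def by (intro add_mono mult_left_mono D L) auto
        finally show ?thesis .
      qed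
      moreover have "N \<in> vanishing_weights s0"
      proof -
        have "isCont p s0"
          using p unfolding poly_growth_def by (simp only: continuous_on_eq_continuous_at[OF open_UNIV]) blast
        then have "(p \<longlongrightarrow> p s0) (at s0)" by (simp add: isCont_def)
        then have "(N \<longlongrightarrow> norm (p s0 - p s0) * D
            + norm (p s0) * (L * norm (fst s0 - fst s0) + L * (1 + norm (fst s0)) * norm (snd s0 - snd s0))) (at s0)"
          unfolding N_def by (intro tendsto_intros)
        then have "(N \<longlongrightarrow> 0) (at s0)" by simp
        then show ?thesis unfolding vanishing_weights_def by (intro CollectI exI[of _ N]) auto
      qed
      ultimately show ?thesis by blast
    qed
    show d: "H s differentiable (at x)" for s x
      unfolding H by (intro differentiable_diff tf_family_differentiable F)
    have dF: "partial_deriv b (H s) x = partial_deriv b (F s) x - partial_deriv b (F s0) x" for b s x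
      unfolding H by (intro partial_deriv_eqI has_derivative_diff has_derivative_partial_deriv tf_family_differentiable F)
    fix b :: 'a assume b: "b \<in> Basis"
    show "\<exists>G\<in>X. \<exists>K\<in>X. \<forall>i\<in>UNIV. \<forall>x. partial_deriv b (H i) x = G i x + K i x"
    proof -
      obtain G K where GK: "G \<in> tf_family" "K \<in> tf_family" "\<And>s x. partial_deriv b (F s) x = G s x + K s x"
        using tf_family_partial_deriv[OF F b] by blast
      show ?thesis
        by (rule bexI[OF bexI[OF _ XI[OF GK(2)]] XI[OF GK(1)]]) (simp add: dF GK(3))
    qed
    show "\<exists>G\<in>X. \<exists>K\<in>X. \<forall>i\<in>UNIV. \<forall>x. complex_of_real (x \<bullet> b) * H i x = G i x + K i x"
    proof -
      obtain G K where GK: "G \<in> tf_family" "K \<in> tf_family" "\<And>s x. complex_of_real (x \<bullet> b) * F s x = G s x + K s x"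
        using tf_family_coord[OF F] by blast
      show ?thesis
        by (rule bexI[OF bexI[OF _ XI[OF GK(2)]] XI[OF GK(1)]]) (simp add: H GK(3) right_diff_distrib)
    qed
  qed
qed

lemma tf_shift_tf_family: "g \<in> schwartz \<Longrightarrow> (\<lambda>s. tf_shift (fst s) (snd s) g) \<in> tf_family"
  using tf_familyI[OF poly_growth_const[of 1]] by simp

lemma schwartz_tf_shift: "g \<in> schwartz \<Longrightarrow> tf_shift y \<xi> g \<in> schwartz"
  using dominated_schwartz[OF dominated_tf_family[OF tf_shift_tf_family], of g "(y, \<xi>)"] by simp

section \<open>The Fourier transform\<close>

definition fourier :: "('a::euclidean_space \<Rightarrow> complex) \<Rightarrow> 'a \<Rightarrow> complex" where
  "fourier f \<xi> = (LINT x|lborel. f x * phase (x \<bullet> \<xi>))"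

text \<open>The integral of \<open>f (s + x)\<close> over \<open>s\<close> does not depend on
  \<open>x\<close>, so its derivative, taken under the integral sign, is 0.\<close>

lemma schwartz_integral_partial_deriv:
  fixes f :: "'a::euclidean_space \<Rightarrow> complex"
  assumes f: "f \<in> schwartz" and b: "b \<in> Basis"
  shows "(LINT x|lborel. partial_deriv b f x) = 0"
proof -
  define n where "n = decay_exponent TYPE('a)"
  have "\<exists>C. 0 \<le> C \<and> (\<forall>x. (1 + norm x) ^ n * norm (partial_deriv b f x) \<le> C)" if "b \<in> Basis" for b
    using schwartz_decay[OF schwartz_partial_deriv[OF f that], of n] by metis
  then obtain C where C: "\<And>b. b \<in> Basis \<Longrightarrow> 0 \<le> C b"
    "\<And>b x. b \<in> Basis \<Longrightarrow> (1 + norm x) ^ n * norm (partial_deriv b f x) \<le> C b" by metis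
  \<comment> \<open>For \<open>norm x < 1\<close> the weight \<open>1 + norm s\<close> is at most
    twice \<open>1 + norm (s + x)\<close>, whence the factor \<open>2 ^ n\<close>.\<close>
  define D where "D = (\<Sum>b\<in>Basis. C b) * 2 ^ n"
  have shift: "((\<lambda>x. f (s + x)) has_derivative (\<lambda>v. partial_deriv v f (s + x))) (at x)" for s x
    by (rule has_derivative_compose[OF _ has_derivative_partial_deriv[OF schwartz_differentiable[OF f]],
      of "\<lambda>x. s + x" "\<lambda>v. v"]) (auto intro!: derivative_eq_intros)
  have "((\<lambda>x. LINT s|lborel. f (s + x)) has_derivative (\<lambda>v. LINT s|lborel. partial_deriv v (\<lambda>x. f (s + x)) 0)) (at 0)"
  proof (rule has_derivative_lebesgue_integral(2))
    show "integrable lborel (\<lambda>s. f (s + x))" for x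
      using schwartz_integrable[OF schwartz_tf_shift[OF f, of "-x" 0]] by (simp add: tf_shift_def)
    show "(\<lambda>x. f (s + x)) differentiable (at x)" for s x using shift by (rule differentiableI)
    show "integrable lborel (\<lambda>s. D * (1 / (1 + norm (s :: 'a)) ^ n))"
      unfolding n_def by (intro integrable_mult_right integrable_decay)
    fix s x b :: 'a assume x: "x \<in> ball 0 1" and b: "b \<in> Basis"
    have "1 + norm s \<le> 2 * (1 + norm (s + x))"
    proof -
      have "norm s \<le> norm (s + x) + norm x" using norm_triangle_ineq4[of "s + x" x] by simp
      moreover have "norm x < 1" using x by simp
      moreover have "0 \<le> norm (s + x)" by simp
      ultimately show ?thesis by (smt (verit))
    qed
    then have "(1 + norm s) ^ n * norm (partial_deriv b f (s + x))
        \<le> (2 * (1 + norm (s + x))) ^ n * norm (partial_deriv b f (s + x))"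
      by (intro mult_right_mono power_mono) auto
    also have "\<dots> = 2 ^ n * ((1 + norm (s + x)) ^ n * norm (partial_deriv b f (s + x)))"
      by (simp only: power_mult_distrib mult.assoc)
    also have "\<dots> \<le> 2 ^ n * C b" by (intro mult_left_mono C b) auto
    also have "\<dots> \<le> 2 ^ n * (\<Sum>b\<in>Basis. C b)" using C b by (intro mult_left_mono member_le_sum) auto
    finally have "norm (partial_deriv b f (s + x)) \<le> D * (1 / (1 + norm s) ^ n)"
      unfolding D_def by (intro le_decay) (simp add: mult.commute)
    then show "norm (partial_deriv b (\<lambda>x. f (s + x)) x) \<le> D * (1 / (1 + norm s) ^ n)"
      using partial_deriv_eqI[OF shift] by simp
  qed
  moreover have "(LINT s|lborel. f (s + x)) = (LINT s|lborel. f s)" for x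
  proof -
    have "(LINT s|lborel. f s) = (LINT s|distr lborel borel ((+) x). f s)" by (simp add: lborel_distr_plus)
    also have "\<dots> = (LINT s|lborel. f (x + s))" using schwartz_measurable[OF f] by (simp add: integral_distr)
    finally show ?thesis by (simp add: add.commute)
  qed
  ultimately have "((\<lambda>x::'a. LINT s|lborel. f s) has_derivative (\<lambda>v. LINT s|lborel. partial_deriv v (\<lambda>x. f (s + x)) 0)) (at 0)"
    by simp
  from has_derivative_unique[OF this has_derivative_const]
  have "(LINT s|lborel. partial_deriv b (\<lambda>x. f (s + x)) 0) = 0" by (rule fun_cong)
  moreover have "partial_deriv b (\<lambda>x. f (s + x)) 0 = partial_deriv b f s" for s
    using partial_deriv_eqI[OF shift[of s 0]] by simp
  ultimately show ?thesis by simp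
qed

lemma integrable_fourier: "f \<in> schwartz \<Longrightarrow> integrable lborel (\<lambda>x. f x * phase (x \<bullet> \<xi>))"
  using schwartz_integrable[OF schwartz_tf_shift[of f 0 \<xi>]] by (simp add: tf_shift_def)

lemma fourier_add:
  "f \<in> schwartz \<Longrightarrow> g \<in> schwartz \<Longrightarrow> fourier (\<lambda>x. f x + g x) \<xi> = fourier f \<xi> + fourier g \<xi>"
  by (simp add: fourier_def distrib_right integrable_fourier)

lemma fourier_cmult: "fourier (\<lambda>x. c * f x) \<xi> = c * fourier f \<xi>"
  by (simp add: fourier_def mult.assoc)

lemma has_derivative_fourier:
  fixes f :: "'a::euclidean_space \<Rightarrow> complex"
  assumes f: "f \<in> schwartz"
  shows "(fourier f has_derivative (\<lambda>v. fourier (\<lambda>x. - \<i> * (complex_of_real (x \<bullet> v) * f x)) \<xi>)) (at \<xi>)"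
proof -
  have d: "((\<lambda>\<xi>. f x * phase (x \<bullet> \<xi>)) has_derivative (\<lambda>v. f x * (- \<i> * complex_of_real (x \<bullet> v) * phase (x \<bullet> \<xi>)))) (at \<xi>)"
    for x \<xi> :: 'a
    by (intro has_derivative_mult_right has_derivative_phase) (auto intro!: derivative_eq_intros)
  have "((\<lambda>\<xi>. LINT x|lborel. f x * phase (x \<bullet> \<xi>)) has_derivative
     (\<lambda>v. LINT x|lborel. partial_deriv v (\<lambda>\<xi>. f x * phase (x \<bullet> \<xi>)) \<xi>)) (at \<xi>)"
  proof (rule has_derivative_lebesgue_integral(2))
    show "integrable lborel (\<lambda>x. f x * phase (x \<bullet> \<xi>))" for \<xi> by (rule integrable_fourier[OF f])
    show "(\<lambda>\<xi>. f x * phase (x \<bullet> \<xi>)) differentiable (at \<xi>)" for x \<xi> using d by (rule differentiableI)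
    show "integrable lborel (\<lambda>x. \<Sum>b\<in>Basis. norm (complex_of_real (x \<bullet> b) * f x))"
      by (intro Bochner_Integration.integrable_sum integrable_norm schwartz_integrable schwartz_coord f)
    fix x \<xi>' b :: 'a assume b: "b \<in> Basis"
    have "norm (partial_deriv b (\<lambda>\<xi>. f x * phase (x \<bullet> \<xi>)) \<xi>') = norm (complex_of_real (x \<bullet> b) * f x)"
      using partial_deriv_eqI[OF d, of b x \<xi>'] by (simp add: norm_mult)
    also have "\<dots> \<le> (\<Sum>b\<in>Basis. norm (complex_of_real (x \<bullet> b) * f x))"
      using b by (intro member_le_sum) auto
    finally show "norm (partial_deriv b (\<lambda>\<xi>. f x * phase (x \<bullet> \<xi>)) \<xi>') \<le> (\<Sum>b\<in>Basis. norm (complex_of_real (x \<bullet> b) * f x))" .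
  qed
  moreover have "partial_deriv v (\<lambda>\<xi>. f x * phase (x \<bullet> \<xi>)) \<xi> = - \<i> * (complex_of_real (x \<bullet> v) * f x) * phase (x \<bullet> \<xi>)" for v x
    using partial_deriv_eqI[OF d, of v x \<xi>] by (simp add: mult_ac)
  ultimately show ?thesis by (simp add: fourier_def[abs_def])
qed

text \<open>Integration by parts: the derivative of \<open>f\<close> times the kernel has integral
  0.\<close>

lemma coord_fourier:
  assumes f: "f \<in> schwartz" and b: "b \<in> Basis"
  shows "complex_of_real (\<xi> \<bullet> b) * fourier f \<xi> = fourier (\<lambda>x. - \<i> * partial_deriv b f x) \<xi>"
proof -
  have "0 = (LINT x|lborel. partial_deriv b (tf_shift 0 \<xi> f) x)"
    by (simp add: schwartz_integral_partial_deriv[OF schwartz_tf_shift[OF f] b])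
  also have "\<dots> = (LINT x|lborel. tf_shift 0 \<xi> (partial_deriv b f) x + - \<i> * complex_of_real (b \<bullet> \<xi>) * tf_shift 0 \<xi> f x)"
    by (simp only: partial_deriv_tf_shift[OF f])
  also have "\<dots> = fourier (partial_deriv b f) \<xi> + - \<i> * complex_of_real (b \<bullet> \<xi>) * fourier f \<xi>"
  proof -
    have i: "integrable lborel (tf_shift 0 \<xi> (partial_deriv b f))" "integrable lborel (tf_shift 0 \<xi> f)"
      by (intro schwartz_integrable schwartz_tf_shift schwartz_partial_deriv f b)+
    show ?thesis
      unfolding Bochner_Integration.integral_add[OF i(1) integrable_mult_right[OF i(2)]] integral_mult_right_zero
      by (simp add: fourier_def tf_shift_def)
  qed
  finally have e: "fourier (partial_deriv b f) \<xi> = \<i> * (complex_of_real (b \<bullet> \<xi>) * fourier f \<xi>)"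
    by (simp add: algebra_simps add_eq_0_iff)
  have "- \<i> * fourier (partial_deriv b f) \<xi> = complex_of_real (b \<bullet> \<xi>) * fourier f \<xi>"
    unfolding e by (simp add: mult.assoc[symmetric])
  then show ?thesis using fourier_cmult[of "- \<i>" "partial_deriv b f" \<xi>] by (simp add: inner_commute)
qed

text \<open>The compositions of the transform with continuous operators are closed under derivatives
  and coordinates because the transform exchanges the two: each turns into the other one, applied
  after \<open>A\<close> and before the transform.\<close>

lemma schwartz_op_fourier: "schwartz_op (fourier :: ('a::euclidean_space \<Rightarrow> complex) \<Rightarrow> _)"
proof -
  define X where "X = (\<lambda>A f. fourier (A f)) ` {A :: ('a \<Rightarrow> complex) \<Rightarrow> 'a \<Rightarrow> complex. schwartz_op A}"
  have XI: "(\<lambda>f. fourier (A f)) \<in> X" if "schwartz_op A" for A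
    unfolding X_def by (rule imageI) (simp add: that)
  show ?thesis
  proof (rule dominated_coinduct[where X = X])
    show "fourier \<in> X" by (rule XI[OF schwartz_op_id])
  next
    fix F assume "F \<in> X"
    then obtain A where A: "schwartz_op A" and F: "F = (\<lambda>f. fourier (A f))" by (auto simp: X_def)
    have Af: "A f \<in> schwartz" if "f \<in> schwartz" for f by (rule schwartz_op_schwartz[of A f, OF A that])
    show "\<exists>N\<in>schwartz_weights. \<forall>f\<in>schwartz. \<forall>x. norm (F f x) \<le> N f"
    proof -
      obtain N where N: "N \<in> schwartz_weights"
        "\<And>f x. f \<in> schwartz \<Longrightarrow> (1 + norm x) ^ decay_exponent TYPE('a) * norm (A f x) \<le> N f"
        using schwartz_op_sup_weight[OF A] by blast
      define I where "I = (LINT x|lborel. 1 / (1 + norm (x::'a)) ^ decay_exponent TYPE('a))"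
      have "norm (F f \<xi>) \<le> I * N f" if f: "f \<in> schwartz" for f \<xi>
      proof -
        have [measurable]: "A f \<in> borel_measurable borel" by (rule schwartz_measurable[OF Af[OF f]])
        have "norm (LINT x|lborel. A f x * phase (x \<bullet> \<xi>)) \<le> N f * I" unfolding I_def
          by (rule decay_bound_integrable(2)) (use N(2)[OF f] in \<open>auto simp: norm_mult\<close>)
        then show ?thesis by (simp add: F fourier_def mult.commute)
      qed
      moreover have "0 \<le> I" unfolding I_def by simp
      ultimately show ?thesis
        by (intro bexI[OF _ weight_cone_cmult[OF weight_cone_schwartz N(1), of I]]) auto
    qed
    show "F f differentiable (at x)" if "f \<in> schwartz" for f x
      unfolding F by (rule differentiableI[OF has_derivative_fourier[OF Af[OF that]]])
    fix b :: 'a assume b: "b \<in> Basis"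
    show "\<exists>G\<in>X. \<forall>f\<in>schwartz. \<forall>x. G f x = partial_deriv b (F f) x"
    proof (intro bexI ballI allI)
      show "fourier (\<lambda>x. - \<i> * (complex_of_real (x \<bullet> b) * A f x)) x = partial_deriv b (F f) x" if "f \<in> schwartz" for f x
        unfolding F partial_deriv_eqI[OF has_derivative_fourier[OF Af[OF that]]] ..
      have "schwartz_op (\<lambda>f x. - \<i> * (complex_of_real (x \<bullet> b) * A f x))"
        by (rule schwartz_op_cmult[OF schwartz_op_compose[OF schwartz_op_coord A]])
      then show "(\<lambda>f. fourier (\<lambda>x. - \<i> * (complex_of_real (x \<bullet> b) * A f x))) \<in> X" by (rule XI)
    qed
    show "\<exists>G\<in>X. \<forall>f\<in>schwartz. \<forall>x. G f x = complex_of_real (x \<bullet> b) * F f x"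
    proof (intro bexI ballI allI)
      show "fourier (\<lambda>x. - \<i> * partial_deriv b (A f) x) x = complex_of_real (x \<bullet> b) * F f x" if "f \<in> schwartz" for f x
        unfolding F coord_fourier[OF Af[OF that] b] ..
      have "schwartz_op (\<lambda>f x. - \<i> * partial_deriv b (A f) x)"
        by (rule schwartz_op_cmult[OF schwartz_op_compose[OF schwartz_op_partial_deriv[OF b] A]])
      then show "(\<lambda>f. fourier (\<lambda>x. - \<i> * partial_deriv b (A f) x)) \<in> X" by (rule XI)
    qed
  qed simp
qed

lemma schwartz_fourier: "f \<in> schwartz \<Longrightarrow> fourier f \<in> schwartz"
  by (rule schwartz_op_schwartz[OF schwartz_op_fourier])

section \<open>Inversion and Plancherel formulas\<close>

lemma fourier_exchange:
  assumes f: "f \<in> schwartz" and g: "g \<in> schwartz"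
  shows "(LINT \<xi>|lborel. fourier f \<xi> * g \<xi>) = (LINT t|lborel. f t * fourier g t)"
proof -
  have [measurable]: "f \<in> borel_measurable borel" "g \<in> borel_measurable borel"
    using f g by (auto intro: schwartz_measurable)
  have "integrable (lborel \<Otimes>\<^sub>M lborel) (\<lambda>(t, \<xi>). f t * phase (t \<bullet> \<xi>) * g \<xi>)"
  proof (rule lborel_pair.Fubini_integrable)
    have "(\<lambda>t. LINT \<xi>|lborel. norm (f t * phase (t \<bullet> \<xi>) * g \<xi>)) = (\<lambda>t. norm (f t) * (LINT \<xi>|lborel. norm (g \<xi>)))"
      by (simp add: norm_mult)
    then show "integrable lborel (\<lambda>t. LINT \<xi>|lborel. norm (case (t, \<xi>) of (t, \<xi>) \<Rightarrow> f t * phase (t \<bullet> \<xi>) * g \<xi>))"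
      using schwartz_integrable[OF f] by simp
    show "AE t in lborel. integrable lborel (\<lambda>\<xi>. case (t, \<xi>) of (t, \<xi>) \<Rightarrow> f t * phase (t \<bullet> \<xi>) * g \<xi>)"
      using integrable_fourier[OF g]
      by (auto simp: inner_commute mult.assoc mult.commute[of "phase _"] intro!: AE_I2 integrable_mult_right)
  qed simp
  from lborel_pair.Fubini_integral[OF this]
  have "(LINT \<xi>|lborel. LINT t|lborel. f t * phase (t \<bullet> \<xi>) * g \<xi>) = (LINT t|lborel. LINT \<xi>|lborel. f t * phase (t \<bullet> \<xi>) * g \<xi>)" .
  moreover have "fourier f \<xi> * g \<xi> = (LINT t|lborel. f t * phase (t \<bullet> \<xi>) * g \<xi>)" for \<xi>
    by (simp add: fourier_def)
  moreover have "f t * fourier g t = (LINT \<xi>|lborel. f t * phase (t \<bullet> \<xi>) * g \<xi>)" for t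
    unfolding fourier_def integral_mult_right_zero[symmetric]
    by (rule Bochner_Integration.integral_cong) (simp_all add: inner_commute mult_ac)
  ultimately show ?thesis by (simp only:)
qed

text \<open>The exchange formula for a dilated and modulated \<open>\<psi>\<close>. Its transform is
  a dilated translate of \<open>fourier \<psi>\<close>; the substitution constant \<open>C\<close>
  that this brings in is used up by the final change of variables.\<close>

lemma fourier_inversion_scaled:
  fixes f \<psi> :: "'a::euclidean_space \<Rightarrow> complex"
  assumes f: "f \<in> schwartz" and \<psi>: "\<psi> \<in> schwartz" and e: "e \<noteq> 0"
  shows "(LINT \<xi>|lborel. fourier f \<xi> * (\<psi> (e *\<^sub>R \<xi>) * phase (- (x \<bullet> \<xi>))))
    = (LINT s|lborel. f (x + e *\<^sub>R s) * fourier \<psi> s)"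
proof -
  have [measurable]: "f \<in> borel_measurable borel" "\<psi> \<in> borel_measurable borel" "fourier \<psi> \<in> borel_measurable borel"
    using f \<psi> by (auto intro: schwartz_measurable schwartz_fourier)
  have lin: "linear (\<lambda>\<xi>::'a. e *\<^sub>R \<xi>)" by (simp add: linear_scale_self)
  have bij: "bij (\<lambda>\<xi>::'a. e *\<^sub>R \<xi>)"
    by (rule o_bij[of "\<lambda>\<xi>. (1 / e) *\<^sub>R \<xi>"]) (use e in \<open>auto simp: fun_eq_iff\<close>)
  obtain C :: real where C: "0 < C"
    "\<And>h::'a \<Rightarrow> complex. h \<in> borel_measurable borel \<Longrightarrow> (LINT x|lborel. h (e *\<^sub>R x)) = complex_of_real C * (LINT x|lborel. h x)"
    using lborel_linear_substitution[OF lin bij] by metis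
  have comp: "(\<lambda>\<xi>. \<psi> (e *\<^sub>R \<xi>)) \<in> schwartz"
    by (rule schwartz_op_schwartz[OF schwartz_op_linear_comp[OF lin bij] \<psi>])
  define g where "g \<xi> = \<psi> (e *\<^sub>R \<xi>) * phase (- (x \<bullet> \<xi>))" for \<xi>
  have g: "g \<in> schwartz"
    using schwartz_tf_shift[OF comp, of 0 "- x"] by (simp add: tf_shift_def g_def[abs_def] inner_commute)
  have Fg: "fourier g t = complex_of_real C * fourier \<psi> ((1 / e) *\<^sub>R (t - x))" for t
  proof -
    have "fourier g t = (LINT \<xi>|lborel. \<psi> (e *\<^sub>R \<xi>) * phase ((e *\<^sub>R \<xi>) \<bullet> ((1 / e) *\<^sub>R (t - x))))"
      unfolding fourier_def g_def mult.assoc phase_add[symmetric] using e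
      by (simp add: inner_diff_right inner_commute)
    also have "\<dots> = complex_of_real C * (LINT \<eta>|lborel. \<psi> \<eta> * phase (\<eta> \<bullet> ((1 / e) *\<^sub>R (t - x))))"
      by (rule C(2)) simp
    finally show ?thesis by (simp add: fourier_def)
  qed
  define K where "K t = f (x + t) * fourier \<psi> ((1 / e) *\<^sub>R t)" for t
  have [measurable]: "K \<in> borel_measurable borel" unfolding K_def[abs_def] by measurable
  have "(LINT \<xi>|lborel. fourier f \<xi> * g \<xi>) = (LINT t|lborel. f t * fourier g t)"
    by (rule fourier_exchange[OF f g])
  also have "\<dots> = complex_of_real C * (LINT t|lborel. f t * fourier \<psi> ((1 / e) *\<^sub>R (t - x)))"
    unfolding Fg by (simp add: mult.left_commute)
  also have "(LINT t|lborel. f t * fourier \<psi> ((1 / e) *\<^sub>R (t - x)))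
      = (LINT t|distr lborel borel ((+) x). f t * fourier \<psi> ((1 / e) *\<^sub>R (t - x)))"
    by (simp add: lborel_distr_plus)
  also have "\<dots> = (LINT t|lborel. K t)"
    by (subst integral_distr) (auto simp: K_def[abs_def])
  also have "complex_of_real C * (LINT t|lborel. K t) = (LINT s|lborel. K (e *\<^sub>R s))"
    by (rule C(2)[symmetric]) simp
  also have "\<dots> = (LINT s|lborel. f (x + e *\<^sub>R s) * fourier \<psi> s)" using e by (simp add: K_def)
  finally show ?thesis by (simp add: g_def)
qed

text \<open>Both sides of the scaled formula converge as the dilation tends to 0, by dominated
  convergence. An arbitrary Schwartz function takes the place of the usual Gaussian, since no
  explicit transform enters.\<close>

lemma fourier_inversion_product:
  fixes f \<psi> :: "'a::euclidean_space \<Rightarrow> complex"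
  assumes f: "f \<in> schwartz" and \<psi>: "\<psi> \<in> schwartz"
  shows "(LINT \<xi>|lborel. fourier f \<xi> * phase (- (x \<bullet> \<xi>))) * \<psi> 0 = f x * (LINT s|lborel. fourier \<psi> s)"
proof -
  have [measurable]: "f \<in> borel_measurable borel" "\<psi> \<in> borel_measurable borel"
    "fourier \<psi> \<in> borel_measurable borel" "fourier f \<in> borel_measurable borel"
    using f \<psi> by (auto intro: schwartz_measurable schwartz_fourier)
  obtain C where C: "0 \<le> C" "\<And>x. norm (\<psi> x) \<le> C" using schwartz_bounded[OF \<psi>] by blast
  obtain D where D: "0 \<le> D" "\<And>x. norm (f x) \<le> D" using schwartz_bounded[OF f] by blast
  define e where "e n = 1 / real (Suc n)" for n
  have e: "e \<longlonglongrightarrow> 0" unfolding e_def[abs_def] using LIMSEQ_Suc[OF lim_1_over_n[where 'a = real]] by simp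
  have cont: "isCont f y" "isCont \<psi> y" for y
    using schwartz_continuous[OF f, of UNIV] schwartz_continuous[OF \<psi>, of UNIV]
    by (auto simp: continuous_on_eq_continuous_at)
  have "(\<lambda>n. LINT \<xi>|lborel. fourier f \<xi> * (\<psi> (e n *\<^sub>R \<xi>) * phase (- (x \<bullet> \<xi>))))
     \<longlonglongrightarrow> (LINT \<xi>|lborel. fourier f \<xi> * (\<psi> 0 * phase (- (x \<bullet> \<xi>))))"
  proof (rule integral_dominated_convergence)
    show "integrable lborel (\<lambda>\<xi>. norm (fourier f \<xi>) * C)"
      by (intro integrable_mult_left integrable_norm schwartz_integrable schwartz_fourier f)
    show "AE \<xi> in lborel. (\<lambda>n. fourier f \<xi> * (\<psi> (e n *\<^sub>R \<xi>) * phase (- (x \<bullet> \<xi>)))) \<longlonglongrightarrow> fourier f \<xi> * (\<psi> 0 * phase (- (x \<bullet> \<xi>)))"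
    proof (rule AE_I2)
      fix \<xi> :: 'a
      have "(\<lambda>n. e n *\<^sub>R \<xi>) \<longlonglongrightarrow> 0 *\<^sub>R \<xi>" by (rule tendsto_scaleR[OF e tendsto_const])
      then have "(\<lambda>n. \<psi> (e n *\<^sub>R \<xi>)) \<longlonglongrightarrow> \<psi> 0" using isCont_tendsto_compose[OF cont(2)] by force
      then show "(\<lambda>n. fourier f \<xi> * (\<psi> (e n *\<^sub>R \<xi>) * phase (- (x \<bullet> \<xi>)))) \<longlonglongrightarrow> fourier f \<xi> * (\<psi> 0 * phase (- (x \<bullet> \<xi>)))"
        by (intro tendsto_intros)
    qed
    show "AE \<xi> in lborel. norm (fourier f \<xi> * (\<psi> (e n *\<^sub>R \<xi>) * phase (- (x \<bullet> \<xi>)))) \<le> norm (fourier f \<xi>) * C" for n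
      by (intro AE_I2) (simp add: norm_mult mult_left_mono C)
  qed measurable
  moreover have "(\<lambda>n. LINT s|lborel. f (x + e n *\<^sub>R s) * fourier \<psi> s) \<longlonglongrightarrow> (LINT s|lborel. f x * fourier \<psi> s)"
  proof (rule integral_dominated_convergence)
    show "integrable lborel (\<lambda>s. D * norm (fourier \<psi> s))"
      by (intro integrable_mult_right integrable_norm schwartz_integrable schwartz_fourier \<psi>)
    show "AE s in lborel. (\<lambda>n. f (x + e n *\<^sub>R s) * fourier \<psi> s) \<longlonglongrightarrow> f x * fourier \<psi> s"
    proof (rule AE_I2)
      fix s :: 'a
      have "(\<lambda>n. x + e n *\<^sub>R s) \<longlonglongrightarrow> x + 0 *\<^sub>R s" by (rule tendsto_add[OF tendsto_const tendsto_scaleR[OF e tendsto_const]])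
      then have "(\<lambda>n. f (x + e n *\<^sub>R s)) \<longlonglongrightarrow> f x" using isCont_tendsto_compose[OF cont(1)] by force
      then show "(\<lambda>n. f (x + e n *\<^sub>R s) * fourier \<psi> s) \<longlonglongrightarrow> f x * fourier \<psi> s" by (intro tendsto_intros)
    qed
    show "AE s in lborel. norm (f (x + e n *\<^sub>R s) * fourier \<psi> s) \<le> D * norm (fourier \<psi> s)" for n
      by (intro AE_I2) (simp add: norm_mult mult_right_mono D)
  qed measurable
  moreover have "(LINT \<xi>|lborel. fourier f \<xi> * (\<psi> (e n *\<^sub>R \<xi>) * phase (- (x \<bullet> \<xi>))))
      = (LINT s|lborel. f (x + e n *\<^sub>R s) * fourier \<psi> s)" for n
    by (rule fourier_inversion_scaled[OF f \<psi>]) (simp add: e_def)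
  ultimately have "(LINT \<xi>|lborel. fourier f \<xi> * (\<psi> 0 * phase (- (x \<bullet> \<xi>)))) = (LINT s|lborel. f x * fourier \<psi> s)"
    by (simp add: LIMSEQ_unique)
  then show ?thesis by (simp add: mult.left_commute[of _ "\<psi> 0"] mult.commute)
qed

text \<open>A continuous function that vanishes almost everywhere vanishes, because a nonempty open
  set is not negligible.\<close>

lemma schwartz_L2_pos:
  fixes f :: "'a::euclidean_space \<Rightarrow> complex"
  assumes f: "f \<in> schwartz" and a: "f a \<noteq> 0"
  shows "0 < (LINT x|lborel. (norm (f x))\<^sup>2)"
    and "(LINT x|lborel. f x * cnj (f x)) = complex_of_real (LINT x|lborel. (norm (f x))\<^sup>2)"
proof -
  have [measurable]: "f \<in> borel_measurable borel" by (rule schwartz_measurable[OF f])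
  have eq: "f x * cnj (f x) = complex_of_real ((norm (f x))\<^sup>2)" for x
    by (simp only: complex_norm_square)
  have int: "integrable lborel (\<lambda>x. (norm (f x))\<^sup>2)"
    using integrable_norm[OF schwartz_integrable[OF schwartz_mult[OF f schwartz_cnj[OF f]]]]
    by (simp add: norm_mult power2_eq_square)
  show "(LINT x|lborel. f x * cnj (f x)) = complex_of_real (LINT x|lborel. (norm (f x))\<^sup>2)"
    unfolding eq by (rule integral_complex_of_real)
  have "(LINT x|lborel. (norm (f x))\<^sup>2) \<noteq> 0"
  proof
    assume "(LINT x|lborel. (norm (f x))\<^sup>2) = 0"
    then have "AE x in lborel. f x = 0" using int by (simp add: integral_nonneg_eq_0_iff_AE)
    then have "{x. f x \<noteq> 0} \<in> null_sets lborel"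
      by (simp add: AE_iff_null)
    then have "negligible {x. f x \<noteq> 0}"
      by (simp add: negligible_iff_null_sets null_sets_completionI)
    moreover have "open {x. f x \<noteq> 0}"
      using schwartz_continuous[OF f, of UNIV] by (intro open_Collect_neq) auto
    ultimately show False using open_not_negligible[of "{x. f x \<noteq> 0}"] a by auto
  qed
  moreover have "0 \<le> (LINT x|lborel. (norm (f x))\<^sup>2)" by simp
  ultimately show "0 < (LINT x|lborel. (norm (f x))\<^sup>2)" by linarith
qed

text \<open>The constant first appears as the quotient \<open>z\<close> of the integral of a
  transform by a function value, a priori complex and possibly 0. Plancherel's formula holds with
  \<open>cnj z\<close>, and its diagonal case exhibits \<open>cnj z\<close> as a quotient of squared
  norms.\<close>

lemma fourier_inversion:
  fixes \<psi> :: "'a::euclidean_space \<Rightarrow> complex"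
  assumes "\<psi> \<in> schwartz" "\<psi> \<noteq> (\<lambda>x. 0)"
  obtains c :: real where "0 < c"
    "\<And>f x. f \<in> (schwartz :: ('a \<Rightarrow> complex) set) \<Longrightarrow>
       (LINT \<xi>|lborel. fourier f \<xi> * phase (- (x \<bullet> \<xi>))) = complex_of_real c * f x"
    "\<And>f g. f \<in> (schwartz :: ('a \<Rightarrow> complex) set) \<Longrightarrow> g \<in> schwartz \<Longrightarrow>
       (LINT \<xi>|lborel. fourier f \<xi> * cnj (fourier g \<xi>)) = complex_of_real c * (LINT x|lborel. f x * cnj (g x))"
proof -
  obtain a where a: "\<psi> a \<noteq> 0" using assms(2) by auto
  \<comment> \<open>Translation moves a point where \<open>\<psi>\<close> does not vanish to the
    origin, where the product formula evaluates it.\<close>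
  define \<phi> where "\<phi> = tf_shift (- a) 0 \<psi>"
  have \<phi>: "\<phi> \<in> schwartz" unfolding \<phi>_def by (rule schwartz_tf_shift[OF assms(1)])
  have \<phi>0: "\<phi> 0 \<noteq> 0" using a by (simp add: \<phi>_def tf_shift_def)
  define z where "z = (LINT s|lborel. fourier \<phi> s) / \<phi> 0"
  have inv: "(LINT \<xi>|lborel. fourier f \<xi> * phase (- (x \<bullet> \<xi>))) = z * f x" if "f \<in> schwartz" for f :: "'a \<Rightarrow> complex" and x
    using fourier_inversion_product[OF that \<phi>, of x] \<phi>0 by (simp add: z_def field_simps)
  have planch: "(LINT \<xi>|lborel. fourier f \<xi> * cnj (fourier g \<xi>)) = cnj z * (LINT x|lborel. f x * cnj (g x))"
    if f: "f \<in> schwartz" and g: "g \<in> schwartz" for f g :: "'a \<Rightarrow> complex"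
  proof -
    have conj: "fourier (\<lambda>\<xi>. cnj (fourier g \<xi>)) t = cnj (z * g t)" for t
    proof -
      have "fourier (\<lambda>\<xi>. cnj (fourier g \<xi>)) t = (LINT \<xi>|lborel. cnj (fourier g \<xi> * phase (- (t \<bullet> \<xi>))))"
        unfolding fourier_def[of "\<lambda>\<xi>. cnj (fourier g \<xi>)"] by (simp add: cnj_phase inner_commute)
      also have "\<dots> = cnj (LINT \<xi>|lborel. fourier g \<xi> * phase (- (t \<bullet> \<xi>)))" by (rule Bochner_Integration.integral_cnj)
      finally show ?thesis using inv[OF g] by simp
    qed
    have "(LINT \<xi>|lborel. fourier f \<xi> * cnj (fourier g \<xi>)) = (LINT t|lborel. f t * fourier (\<lambda>\<xi>. cnj (fourier g \<xi>)) t)"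
      by (rule fourier_exchange[OF f schwartz_cnj[OF schwartz_fourier[OF g]]])
    then show ?thesis unfolding conj by (simp add: mult.left_commute)
  qed
  define P where "P = (LINT x|lborel. (norm (\<phi> x))\<^sup>2)"
  have P: "0 < P" "(LINT x|lborel. \<phi> x * cnj (\<phi> x)) = complex_of_real P"
    using schwartz_L2_pos[OF \<phi> \<phi>0] by (auto simp: P_def)
  have "(\<exists>b. fourier \<phi> b \<noteq> 0) \<or> fourier \<phi> = (\<lambda>x. 0)" by auto
  moreover have "fourier \<phi> \<noteq> (\<lambda>x. 0)"
  proof
    \<comment> \<open>Then \<open>z = 0\<close>, and Plancherel makes every transform vanish; but
      the transform of the squared modulus of \<open>\<phi>\<close> takes the positive value
      \<open>P\<close> at 0.\<close>
    assume "fourier \<phi> = (\<lambda>x. 0)"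
    then have "z = 0" by (simp add: z_def)
    define h where "h x = \<phi> x * cnj (\<phi> x)" for x
    have h: "h \<in> schwartz" unfolding h_def[abs_def] by (intro schwartz_mult schwartz_cnj \<phi>)
    have "fourier h 0 = complex_of_real P" using P(2) by (simp add: fourier_def h_def)
    then have "fourier h 0 \<noteq> 0" using P(1) by simp
    from schwartz_L2_pos[OF schwartz_fourier[OF h] this] planch[OF h h] \<open>z = 0\<close> show False by simp
  qed
  ultimately obtain b where b: "fourier \<phi> b \<noteq> 0" by blast
  define Q where "Q = (LINT x|lborel. (norm (fourier \<phi> x))\<^sup>2)"
  have Q: "0 < Q" "(LINT x|lborel. fourier \<phi> x * cnj (fourier \<phi> x)) = complex_of_real Q"
    using schwartz_L2_pos[OF schwartz_fourier[OF \<phi>] b] by (auto simp: Q_def)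
  have "complex_of_real Q = cnj z * complex_of_real P" using planch[OF \<phi> \<phi>] P Q by simp
  then have z: "cnj z = complex_of_real (Q / P)" using P(1) by (simp add: field_simps)
  then have z': "z = complex_of_real (Q / P)" by (metis complex_cnj_cnj complex_cnj_complex_of_real)
  show thesis
  proof
    show "0 < Q / P" using P Q by simp
  qed (use inv planch z z' in auto)
qed

section \<open>Tempered distributions and integrals of Schwartz functions\<close>

lemma tempered_add: "u \<in> tempered \<Longrightarrow> f \<in> schwartz \<Longrightarrow> g \<in> schwartz \<Longrightarrow> u (\<lambda>x. f x + g x) = u f + u g"
  by (simp add: tempered_def)

lemma tempered_cmult: "u \<in> tempered \<Longrightarrow> f \<in> schwartz \<Longrightarrow> u (\<lambda>x. c * f x) = c * u f"
  by (simp add: tempered_def)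

lemma tempered_outside: "u \<in> tempered \<Longrightarrow> f \<notin> schwartz \<Longrightarrow> u f = 0"
  by (simp add: tempered_def)

lemma tempered_diff:
  assumes "u \<in> tempered" "f \<in> schwartz" "g \<in> schwartz"
  shows "u (\<lambda>x. f x - g x) = u f - u g"
  using tempered_add[OF assms(1,2) schwartz_cmult[OF assms(3), of "-1"]] tempered_cmult[OF assms(1,3), of "-1"]
  by simp

lemma schwartz_diff:
  assumes "f \<in> schwartz" "g \<in> schwartz"
  shows "(\<lambda>x. f x - g x) \<in> schwartz"
  using schwartz_add[OF assms(1) schwartz_cmult[OF assms(2), of "-1"]] by simp

lemma schwartz_sum:
  "(\<And>a. a \<in> A \<Longrightarrow> f a \<in> schwartz) \<Longrightarrow> (\<lambda>x. \<Sum>a\<in>A. f a x) \<in> schwartz"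
  by (induction A rule: infinite_finite_induct) (simp_all add: schwartz_add)

lemma tempered_sum:
  assumes u: "u \<in> tempered"
  shows "(\<And>a. a \<in> A \<Longrightarrow> f a \<in> schwartz) \<Longrightarrow> u (\<lambda>x. \<Sum>a\<in>A. f a x) = (\<Sum>a\<in>A. u (f a))"
proof (induction A rule: infinite_finite_induct)
  case (insert a A)
  then show ?case using tempered_add[OF u, of "f a" "\<lambda>x. \<Sum>a\<in>A. f a x"] by (simp add: schwartz_sum)
qed (use tempered_cmult[OF u schwartz_zero, of 0] in simp_all)

lemma tempered_bound:
  assumes "u \<in> tempered"
  obtains C m where "0 \<le> C" "\<And>f. f \<in> schwartz \<Longrightarrow> norm (u f) \<le> C * schwartz_norm m f"
proof -
  obtain C m where *: "\<And>f. f \<in> schwartz \<Longrightarrow> norm (u f) \<le> C * schwartz_norm m f"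
    using assms unfolding tempered_def by blast
  have "norm (u f) \<le> \<bar>C\<bar> * schwartz_norm m f" if "f \<in> schwartz" for f
    using *[OF that] schwartz_norm_nonneg[OF that, of m] by (meson abs_ge_self mult_right_mono order_trans)
  then show thesis using that[of "\<bar>C\<bar>" m] by simp
qed

lemma tempered_weight: "u \<in> tempered \<Longrightarrow> (\<lambda>f. norm (u f)) \<in> schwartz_weights"
  unfolding tempered_def schwartz_weights_def by blast

text \<open>The transpose of \<open>A\<close>, with the same default 0 as in
  \<open>tempered\<close>. Transposition reverses composition, which fixes the order of the factors
  when an operator on distributions is traced back to functions.\<close>

definition pullback :: "(('b::euclidean_space \<Rightarrow> complex) \<Rightarrow> 'a::euclidean_space \<Rightarrow> complex) \<Rightarrow> 'a functional \<Rightarrow> 'b functional" where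
  "pullback A u = (\<lambda>\<phi>. if \<phi> \<in> schwartz then u (A \<phi>) else 0)"

definition linear_op :: "(('b::euclidean_space \<Rightarrow> complex) \<Rightarrow> 'a::euclidean_space \<Rightarrow> complex) \<Rightarrow> bool" where
  "linear_op A \<longleftrightarrow> (\<forall>f\<in>schwartz. \<forall>g\<in>schwartz. A (\<lambda>x. f x + g x) = (\<lambda>x. A f x + A g x)) \<and>
     (\<forall>c. \<forall>f\<in>schwartz. A (\<lambda>x. c * f x) = (\<lambda>x. c * A f x))"

lemma tempered_pullback:
  fixes A :: "('b::euclidean_space \<Rightarrow> complex) \<Rightarrow> 'a::euclidean_space \<Rightarrow> complex"
  assumes A: "schwartz_op A" "linear_op A" and u: "u \<in> tempered"
  shows "pullback A u \<in> tempered"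
proof -
  have Af: "A f \<in> schwartz" if "f \<in> schwartz" for f by (rule schwartz_op_schwartz[of A f, OF A(1) that])
  obtain M where "M \<in> schwartz_weights" "\<And>f. f \<in> schwartz \<Longrightarrow> norm (u (A f)) \<le> M f"
    using dominated_weight[OF weight_cone_schwartz A(1) tempered_weight[OF u]] by blast
  then obtain C m where C: "\<And>f. f \<in> schwartz \<Longrightarrow> norm (u (A f)) \<le> C * schwartz_norm m f"
    unfolding schwartz_weights_def by (blast intro: order_trans)
  show ?thesis unfolding tempered_def
  proof (intro CollectI conjI ballI allI impI)
    show "\<exists>C m. \<forall>f\<in>schwartz. norm (pullback A u f) \<le> C * schwartz_norm m f"
      using C by (intro exI[of _ C] exI[of _ m]) (simp add: pullback_def)
  next
    fix f g :: "'b \<Rightarrow> complex" assume "f \<in> schwartz" "g \<in> schwartz"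
    then show "pullback A u (\<lambda>x. f x + g x) = pullback A u f + pullback A u g"
      using A(2) u by (simp add: pullback_def linear_op_def schwartz_add tempered_add Af)
  next
    fix c and f :: "'b \<Rightarrow> complex" assume "f \<in> schwartz"
    then show "pullback A u (\<lambda>x. c * f x) = c * pullback A u f"
      using A(2) u by (simp add: pullback_def linear_op_def schwartz_cmult tempered_cmult Af)
  qed (simp add: pullback_def)
qed

text \<open>The seminorm \<open>schwartz_norm m\<close> is equivalent to the norm of an embedding into the Banach space
  of bounded continuous functions on a product, whose second factor is the discrete set of
  multi-indices. In this space, Riemann sums of continuous functions converge to the
  Henstock-Kurzweil integral.\<close>

instance bcontfun :: (metric_space, banach) banach ..

definition multi_indices :: "nat \<Rightarrow> 'a::euclidean_space list set" where
  "multi_indices m = {vs. set vs \<subseteq> Basis \<and> length vs \<le> m}"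

definition seminorm_embed ::
  "nat \<Rightarrow> ('a::euclidean_space \<Rightarrow> complex) \<Rightarrow> ('a \<times> 'a list discrete) \<Rightarrow>\<^sub>C complex" where
  "seminorm_embed m f = Bcontfun (\<lambda>(x, d). if of_discrete d \<in> multi_indices m
     then (1 + norm x) ^ m *\<^sub>R iter_deriv (of_discrete d) f x else 0)"

lemma multi_indices_lists: "vs \<in> multi_indices m \<Longrightarrow> vs \<in> lists Basis"
  by (auto simp: multi_indices_def)

lemma multi_indices_length: "vs \<in> multi_indices m \<Longrightarrow> length vs \<le> m"
  by (simp add: multi_indices_def)

lemma schwartz_norm_ge_index:
  "f \<in> schwartz \<Longrightarrow> vs \<in> multi_indices m \<Longrightarrow> (1 + norm x) ^ m * norm (iter_deriv vs f x) \<le> schwartz_norm m f"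
  by (rule schwartz_norm_ge[OF _ multi_indices_lists multi_indices_length order_refl])

lemma abs_weight: "\<bar>(1 + norm x) ^ m\<bar> = (1 + norm x) ^ m"
  by (rule abs_of_nonneg) simp

text \<open>\<open>Bcontfun\<close> carries information only for bounded continuous arguments.
  Continuity is checked slice by slice, since the slices over points of the discrete factor are
  open.\<close>

lemma seminorm_embed_apply:
  fixes f :: "'a::euclidean_space \<Rightarrow> complex"
  assumes f: "f \<in> schwartz"
  shows "apply_bcontfun (seminorm_embed m f) (x, d) = (if of_discrete d \<in> multi_indices m
     then (1 + norm x) ^ m *\<^sub>R iter_deriv (of_discrete d) f x else 0)"
proof -
  define h where "h = (\<lambda>(x::'a, d). if of_discrete d \<in> multi_indices m
     then (1 + norm x) ^ m *\<^sub>R iter_deriv (of_discrete d) f x else 0)"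
  have "continuous_on (UNIV \<times> {d}) h" for d
  proof -
    have "continuous_on (UNIV \<times> {d}) (\<lambda>z. if of_discrete d \<in> multi_indices m
      then (1 + norm (fst z)) ^ m *\<^sub>R iter_deriv (of_discrete d) f (fst z) else 0)"
    proof (cases "of_discrete d \<in> multi_indices m")
      case True
      have "continuous_on UNIV (iter_deriv (of_discrete d) f)"
        by (rule schwartz_continuous[OF schwartz_iter_deriv[OF f multi_indices_lists[OF True]]])
      then have "continuous_on (UNIV \<times> {d}) (\<lambda>z. iter_deriv (of_discrete d) f (fst z))"
        by (rule continuous_on_compose2) (auto intro!: continuous_intros)
      then show ?thesis using True by (auto intro!: continuous_intros)
    qed simp
    then show ?thesis by (rule continuous_on_eq) (auto simp: h_def)
  qed
  then have "continuous_on (\<Union>d\<in>UNIV. UNIV \<times> {d}) h"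
    by (intro continuous_on_open_UN open_Times open_UNIV open_discrete)
  moreover have "(\<Union>d\<in>UNIV. (UNIV :: 'a set) \<times> {d :: 'a list discrete}) = UNIV" by auto
  ultimately have cont: "continuous_on UNIV h" by simp
  have "norm (h z) \<le> schwartz_norm m f" for z
    using schwartz_norm_ge_index[OF f, of "of_discrete (snd z)" m "fst z"] schwartz_norm_nonneg[OF f, of m]
    by (auto simp: h_def split_beta abs_weight)
  with cont have "h \<in> bcontfun" by (rule bcontfun_normI)
  then have "apply_bcontfun (seminorm_embed m f) = h"
    by (simp add: seminorm_embed_def h_def[symmetric] Bcontfun_inverse)
  then show ?thesis by (simp add: h_def)
qed

lemma norm_seminorm_embed_le:
  fixes f :: "'a::euclidean_space \<Rightarrow> complex"
  assumes f: "f \<in> schwartz"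
  shows "norm (seminorm_embed m f) \<le> schwartz_norm m f"
proof (rule norm_bound)
  fix z :: "'a \<times> 'a list discrete"
  show "norm (apply_bcontfun (seminorm_embed m f) z) \<le> schwartz_norm m f"
    using schwartz_norm_ge_index[OF f, of "of_discrete (snd z)" m "fst z"] schwartz_norm_nonneg[OF f, of m]
    by (cases z) (auto simp: seminorm_embed_apply[OF f] abs_weight)
qed

text \<open>The left side is a sum over multi-indices, the right side a supremum, hence the factor
  that counts them.\<close>

lemma schwartz_norm_le_embed:
  fixes f :: "'a::euclidean_space \<Rightarrow> complex"
  assumes f: "f \<in> schwartz"
  shows "schwartz_norm m f \<le> real (card (multi_indices m :: 'a list set)) * norm (seminorm_embed m f)"
proof -
  have "schwartz_norm m f \<le> (\<Sum>vs\<in>{vs. set vs \<subseteq> (Basis::'a set) \<and> length vs \<le> m}. norm (seminorm_embed m f))"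
  proof (rule schwartz_norm_le)
    fix vs :: "'a list" and x :: 'a assume "vs \<in> lists Basis" "length vs \<le> m"
    then have "vs \<in> multi_indices m" by (auto simp: multi_indices_def)
    then show "(1 + norm x) ^ m * norm (iter_deriv vs f x) \<le> norm (seminorm_embed m f)"
      using norm_bounded[of "seminorm_embed m f" "(x, discrete vs)"]
      by (simp add: seminorm_embed_apply[OF f] abs_weight discrete_inverse)
  qed
  then show ?thesis by (simp add: multi_indices_def)
qed

lemma seminorm_embed_diff:
  fixes f g :: "'a::euclidean_space \<Rightarrow> complex"
  assumes f: "f \<in> schwartz" and g: "g \<in> schwartz"
  shows "seminorm_embed m (\<lambda>x. f x - g x) = seminorm_embed m f - seminorm_embed m g"
proof (rule bcontfun_eqI)
  fix z :: "'a \<times> 'a list discrete"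
  have "iter_deriv vs (\<lambda>x. f x - g x) = (\<lambda>x. iter_deriv vs f x - iter_deriv vs g x)" if "vs \<in> multi_indices m" for vs
    using iter_deriv_add[OF schwartz_smooth[OF f] schwartz_smooth[OF schwartz_cmult[OF g, of "-1"]] multi_indices_lists[OF that]]
      iter_deriv_cmult[OF schwartz_smooth[OF g] multi_indices_lists[OF that], where c = "-1"] by simp
  then show "apply_bcontfun (seminorm_embed m (\<lambda>x. f x - g x)) z = apply_bcontfun (seminorm_embed m f - seminorm_embed m g) z"
    using f g by (cases z) (simp add: seminorm_embed_apply schwartz_diff scaleR_diff_right)
qed

lemma seminorm_embed_sum:
  fixes f :: "'b \<Rightarrow> 'a::euclidean_space \<Rightarrow> complex"
  assumes "finite A" "\<And>a. a \<in> A \<Longrightarrow> f a \<in> schwartz"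
  shows "seminorm_embed m (\<lambda>x. \<Sum>a\<in>A. complex_of_real (c a) * f a x) = (\<Sum>a\<in>A. c a *\<^sub>R seminorm_embed m (f a))"
  using assms
proof (induction A rule: finite_induct)
  case empty
  have "(\<lambda>x::'a. 0 - 0 :: complex) = (\<lambda>x. 0)" by simp
  then show ?case using seminorm_embed_diff[OF schwartz_zero schwartz_zero, of m] by simp
next
  case (insert a A)
  have fa: "f a \<in> schwartz" using insert by simp
  have S: "(\<lambda>x. \<Sum>a\<in>A. complex_of_real (c a) * f a x) \<in> schwartz"
    using insert by (intro schwartz_sum schwartz_cmult) auto
  have "seminorm_embed m (\<lambda>x. complex_of_real (c a) * f a x + (\<Sum>a\<in>A. complex_of_real (c a) * f a x))
      = c a *\<^sub>R seminorm_embed m (f a) + seminorm_embed m (\<lambda>x. \<Sum>a\<in>A. complex_of_real (c a) * f a x)"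
  proof (rule bcontfun_eqI)
    fix z :: "'a \<times> 'a list discrete"
    have "iter_deriv vs (\<lambda>x. complex_of_real (c a) * f a x + (\<Sum>a\<in>A. complex_of_real (c a) * f a x))
        = (\<lambda>x. complex_of_real (c a) * iter_deriv vs (f a) x
            + iter_deriv vs (\<lambda>x. \<Sum>a\<in>A. complex_of_real (c a) * f a x) x)" if "vs \<in> multi_indices m" for vs
      using iter_deriv_add[OF schwartz_smooth[OF schwartz_cmult[OF fa]] schwartz_smooth[OF S] multi_indices_lists[OF that]]
        iter_deriv_cmult[OF schwartz_smooth[OF fa] multi_indices_lists[OF that]] by simp
    then show "apply_bcontfun (seminorm_embed m (\<lambda>x. complex_of_real (c a) * f a x + (\<Sum>a\<in>A. complex_of_real (c a) * f a x))) z
      = apply_bcontfun (c a *\<^sub>R seminorm_embed m (f a) + seminorm_embed m (\<lambda>x. \<Sum>a\<in>A. complex_of_real (c a) * f a x)) z"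
      using fa S by (cases z) (simp add: seminorm_embed_apply schwartz_add schwartz_cmult distrib_left scaleR_conv_of_real mult_ac)
  qed
  then show ?case using insert by simp
qed

section \<open>Distributions applied to integrals of Schwartz functions\<close>

definition integrable_weights :: "('s::euclidean_space \<Rightarrow> real) set" where
  "integrable_weights = {N. \<exists>G. integrable lborel G \<and> (\<forall>s. N s \<le> G s)}"

lemma weight_cone_integrable [simp]: "weight_cone (integrable_weights :: ('s::euclidean_space \<Rightarrow> real) set)"
  unfolding weight_cone_def
proof (intro conjI ballI allI impI)
  fix M N :: "'s \<Rightarrow> real" assume "M \<in> integrable_weights" "N \<in> integrable_weights"
  then obtain G H where "integrable lborel G" "\<And>s. M s \<le> G s" "integrable lborel H" "\<And>s. N s \<le> H s"
    unfolding integrable_weights_def by blast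
  then show "(\<lambda>s. M s + N s) \<in> integrable_weights" unfolding integrable_weights_def
    by (intro CollectI exI[of _ "\<lambda>s. G s + H s"]) (auto intro: add_mono)
next
  fix N :: "'s \<Rightarrow> real" and c :: real assume "N \<in> integrable_weights" and c: "0 \<le> c"
  then obtain G where "integrable lborel G" "\<And>s. N s \<le> G s" unfolding integrable_weights_def by blast
  then show "(\<lambda>s. c * N s) \<in> integrable_weights" unfolding integrable_weights_def
    using c by (intro CollectI exI[of _ "\<lambda>s. c * G s"]) (auto intro: mult_left_mono)
next
  show "(\<lambda>s. 0) \<in> (integrable_weights :: ('s \<Rightarrow> real) set)" unfolding integrable_weights_def
    by (intro CollectI exI[of _ "\<lambda>s. 0"]) auto
qed

lemma continuous_of_vanishing:
  fixes f :: "'s::euclidean_space \<Rightarrow> 'b::real_normed_vector"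
  assumes "\<And>s0. \<exists>N\<in>vanishing_weights s0. \<forall>s. norm (f s - f s0) \<le> N s"
  shows "continuous_on UNIV f"
  unfolding continuous_on_eq_continuous_at[OF open_UNIV]
proof
  fix s0
  obtain N where "N \<in> vanishing_weights s0" "\<And>s. norm (f s - f s0) \<le> N s" using assms[of s0] by blast
  then obtain M where M: "\<And>s. norm (f s - f s0) \<le> M s" "(M \<longlongrightarrow> 0) (at s0)"
    unfolding vanishing_weights_def by (blast intro: order_trans)
  have "((\<lambda>s. f s - f s0) \<longlongrightarrow> 0) (at s0)"
    by (rule Lim_null_comparison[OF _ M(2)]) (simp add: M(1))
  then show "isCont f s0" unfolding isCont_def by (rule LIM_zero_cancel)
qed

text \<open>Induction on the order; domination provides an integrable majorant, uniform in
  \<open>x\<close>, for each derivative.\<close>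

lemma iter_deriv_integral:
  fixes f :: "'s::euclidean_space \<Rightarrow> 'a::euclidean_space \<Rightarrow> complex"
  assumes meas: "\<And>x. (\<lambda>s. f s x) \<in> borel_measurable borel"
    and dom: "dominated integrable_weights UNIV f" and vs: "vs \<in> lists Basis"
  shows "(\<forall>x. integrable lborel (\<lambda>s. iter_deriv vs (f s) x)) \<and>
    iter_deriv vs (\<lambda>x. LINT s|lborel. f s x) = (\<lambda>x. LINT s|lborel. iter_deriv vs (f s) x)"
proof -
  have bd: "\<exists>G. integrable lborel G \<and> (\<forall>s x. norm (iter_deriv ws (f s) x) \<le> G s)"
    if ws: "ws \<in> lists Basis" for ws
  proof -
    obtain N where N: "N \<in> integrable_weights" "\<And>s x. (1 + norm x) ^ 0 * norm (iter_deriv ws (f s) x) \<le> N s"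
      using dominated_bound[OF dom ws, of 0] by (metis UNIV_I)
    obtain G where "integrable lborel G" "\<And>s. N s \<le> G s" using N(1) unfolding integrable_weights_def by blast
    then show ?thesis using N(2) by (intro exI[of _ G]) (auto intro: order_trans)
  qed
  have sm: "smooth (f s)" for s using dom by (simp add: dominated_def)
  show ?thesis using vs
  proof (induction vs rule: list.induct)
    case Nil
    obtain G where G: "integrable lborel G" "\<And>s x. norm (iter_deriv [] (f s) x) \<le> G s" using bd[of "[]"] by auto
    have "integrable lborel (\<lambda>s. f s x)" for x
      by (rule Bochner_Integration.integrable_bound[OF G(1)])
        (use meas[of x] order_trans[OF G(2) abs_ge_self] in \<open>auto intro!: AE_I2\<close>)
    then show ?case by simp
  next
    case (Cons v vs)
    then have v: "v \<in> Basis" and vs: "vs \<in> lists Basis" by auto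
    have int: "integrable lborel (\<lambda>s. iter_deriv vs (f s) x)" for x using Cons.IH[OF vs] by blast
    have eq: "iter_deriv vs (\<lambda>x. LINT s|lborel. f s x) = (\<lambda>x. LINT s|lborel. iter_deriv vs (f s) x)"
      using Cons.IH[OF vs] by blast
    have "\<exists>G. integrable lborel G \<and> (\<forall>s x. norm (partial_deriv b (iter_deriv vs (f s)) x) \<le> G s)" if b: "b \<in> Basis" for b
      using bd[of "b # vs"] vs b by (simp add: iter_deriv_Cons del: iter_deriv.simps(2))
    then obtain G where G: "\<And>b. b \<in> Basis \<Longrightarrow> integrable lborel (G b)"
      "\<And>b s x. b \<in> Basis \<Longrightarrow> norm (partial_deriv b (iter_deriv vs (f s)) x) \<le> G b s" by metis
    have le: "norm (partial_deriv b (iter_deriv vs (f s)) x) \<le> (\<Sum>b\<in>Basis. G b s)" if "b \<in> Basis" for b s x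
    proof -
      have "0 \<le> G b s" if "b \<in> Basis" for b by (rule order_trans[OF norm_ge_zero G(2)[OF that]])
      then have "G b s \<le> (\<Sum>b\<in>Basis. G b s)" using that by (intro member_le_sum) auto
      then show ?thesis using G(2)[OF that] order_trans by blast
    qed
    have Gint: "integrable lborel (\<lambda>s. \<Sum>b\<in>Basis. G b s)" by (intro Bochner_Integration.integrable_sum G)
    note deriv = has_derivative_lebesgue_integral[OF int smooth_differentiable[OF sm vs] Gint le]
    have "integrable lborel (\<lambda>s. partial_deriv v (iter_deriv vs (f s)) x)" for x by (rule deriv(1))
    moreover have "partial_deriv v (\<lambda>x. LINT s|lborel. iter_deriv vs (f s) x) x
        = (LINT s|lborel. partial_deriv v (iter_deriv vs (f s)) x)" for x
      by (rule partial_deriv_eqI[OF deriv(2)])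
    ultimately show ?case by (simp add: iter_deriv_Cons eq del: iter_deriv.simps(2))
  qed
qed

text \<open>\<open>u\<close> acts on Schwartz functions and not on the Banach space around them, so
  it cannot simply be moved through a vector-valued integral. It does commute with finite Riemann
  sums: one tagged division is chosen for which the sums of \<open>E (f s)\<close> and of
  \<open>u (f s)\<close> are both near their integrals, and the seminorm bound of \<open>u\<close>
  transports the first closeness.\<close>

lemma tempered_integral:
  fixes f :: "'s::euclidean_space \<Rightarrow> 'a::euclidean_space \<Rightarrow> complex"
  assumes u: "u \<in> tempered"
    and cont: "\<And>s0. dominated (vanishing_weights s0) UNIV (\<lambda>s x. f s x - f s0 x)"
    and dom: "dominated integrable_weights UNIV f"
    and F: "(\<lambda>x. LINT s|lborel. f s x) \<in> schwartz"
  shows "continuous_on UNIV (\<lambda>s. u (f s))" "integrable lborel (\<lambda>s. u (f s))"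
    "u (\<lambda>x. LINT s|lborel. f s x) = (LINT s|lborel. u (f s))"
proof -
  obtain C m where C: "0 \<le> C" "\<And>f. f \<in> schwartz \<Longrightarrow> norm (u f) \<le> C * schwartz_norm m f"
    using tempered_bound[OF u] by blast
  define E where "E = (seminorm_embed m :: ('a \<Rightarrow> complex) \<Rightarrow> _)"
  define n where "n = real (card (multi_indices m :: 'a list set))"
  have n: "0 \<le> n" by (simp add: n_def)
  have uE: "norm (u g) \<le> C * (n * norm (E g))" if "g \<in> schwartz" for g
    using C(2)[OF that] mult_left_mono[OF schwartz_norm_le_embed[OF that, of m] C(1)] by (simp add: E_def n_def)
  have fs: "f s \<in> schwartz" for s by (rule dominated_schwartz[OF dom]) simp
  define F0 where "F0 x = (LINT s|lborel. f s x)" for x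
  have F0: "F0 \<in> schwartz" using F by (simp add: F0_def[abs_def])
  have vanish: "\<exists>N\<in>vanishing_weights s0. \<forall>s. schwartz_norm m (\<lambda>x. f s x - f s0 x) \<le> N s" for s0
    using dominated_schwartz_norm[OF weight_cone_vanishing cont] by (metis UNIV_I)
  have Econt: "continuous_on UNIV (\<lambda>s. E (f s))"
  proof (rule continuous_of_vanishing)
    fix s0
    obtain N where N: "N \<in> vanishing_weights s0" "\<And>s. schwartz_norm m (\<lambda>x. f s x - f s0 x) \<le> N s" using vanish by blast
    have "norm (E (f s) - E (f s0)) \<le> N s" for s
      using order_trans[OF norm_seminorm_embed_le[OF schwartz_diff[OF fs fs]] N(2)]
      by (simp add: E_def seminorm_embed_diff[OF fs fs])
    then show "\<exists>N\<in>vanishing_weights s0. \<forall>s. norm (E (f s) - E (f s0)) \<le> N s" using N(1) by blast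
  qed
  show ucont: "continuous_on UNIV (\<lambda>s. u (f s))"
  proof (rule continuous_of_vanishing)
    fix s0
    obtain N where N: "N \<in> vanishing_weights s0" "\<And>s. schwartz_norm m (\<lambda>x. f s x - f s0 x) \<le> N s" using vanish by blast
    have "norm (u (f s) - u (f s0)) \<le> C * N s" for s
      using order_trans[OF C(2)[OF schwartz_diff[OF fs fs]] mult_left_mono[OF N(2) C(1)]]
      by (simp add: tempered_diff[OF u fs fs])
    then show "\<exists>N\<in>vanishing_weights s0. \<forall>s. norm (u (f s) - u (f s0)) \<le> N s"
      by (intro bexI[OF _ weight_cone_cmult[OF weight_cone_vanishing N(1) C(1)]]) auto
  qed
  obtain N where "N \<in> integrable_weights" "\<And>s. schwartz_norm m (f s) \<le> N s"
    using dominated_schwartz_norm[OF weight_cone_integrable dom] by (metis UNIV_I)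
  then obtain G where G: "integrable lborel G" "\<And>s. schwartz_norm m (f s) \<le> G s"
    unfolding integrable_weights_def by (blast intro: order_trans)
  show uint: "integrable lborel (\<lambda>s. u (f s))"
  proof (rule Bochner_Integration.integrable_bound[OF integrable_mult_right[OF G(1), of C]])
    show "(\<lambda>s. u (f s)) \<in> borel_measurable lborel"
      using borel_measurable_continuous_onI[OF ucont] by simp
    have "norm (u (f s)) \<le> norm (C * G s)" for s
      using order_trans[OF C(2)[OF fs] mult_left_mono[OF G(2) C(1)]] by (rule order_trans) simp
    then show "AE s in lborel. norm (u (f s)) \<le> norm (C * G s)" by simp
  qed
  \<comment> \<open>Continuity gives integrability on boxes; the integrable bound \<open>G\<close>
    extends it to the whole space.\<close>
  have "(\<lambda>s. E (f s)) integrable_on UNIV"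
  proof (rule integrable_on_all_intervals_integrable_bound)
    show "(\<lambda>s. if s \<in> UNIV then E (f s) else 0) integrable_on cbox a b" for a b
      using integrable_continuous[OF continuous_on_subset[OF Econt subset_UNIV], of a b] by simp
    show "norm (E (f s)) \<le> G s" for s
      using order_trans[OF norm_seminorm_embed_le[OF fs] G(2)] by (simp add: E_def)
    show "G integrable_on UNIV" by (rule integrable_on_lborel[OF G(1)])
  qed
  then obtain B where B: "((\<lambda>s. E (f s)) has_integral B) UNIV" by (auto simp: integrable_on_def)
  have meas: "(\<lambda>s. f s x) \<in> borel_measurable borel" for x
  proof (intro borel_measurable_continuous_onI continuous_of_vanishing)
    fix s0
    obtain N where "N \<in> vanishing_weights s0" "\<And>s x. (1 + norm x) ^ 0 * norm (iter_deriv [] (\<lambda>x. f s x - f s0 x) x) \<le> N s"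
      using dominated_bound[OF cont, of "[]" s0 0] by (metis UNIV_I lists.Nil)
    then show "\<exists>N\<in>vanishing_weights s0. \<forall>s. norm (f s x - f s0 x) \<le> N s" by auto
  qed
  \<comment> \<open>Evaluation at a point is bounded and linear on bounded continuous functions, so
    the vector integral can be identified pointwise, by differentiating the scalar integral under
    the sign.\<close>
  have "B = E F0"
  proof (rule bcontfun_eqI)
    fix z :: "'a \<times> 'a list discrete"
    obtain x d where z: "z = (x, d)" by (cases z)
    note D = iter_deriv_integral[OF meas dom multi_indices_lists, of "of_discrete d" m]
    have "bounded_linear (\<lambda>g :: ('a \<times> 'a list discrete) \<Rightarrow>\<^sub>C complex. apply_bcontfun g z)"
      by (rule bounded_linear_intro[where K = 1]) (auto simp: norm_bounded)
    from has_integral_linear[OF B this]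
    have 1: "((\<lambda>s. apply_bcontfun (E (f s)) z) has_integral apply_bcontfun B z) UNIV" by (simp add: comp_def)
    have "integrable lborel (\<lambda>s. apply_bcontfun (E (f s)) z)"
      using D by (cases "of_discrete d \<in> (multi_indices m :: 'a list set)") (auto simp: E_def z seminorm_embed_apply[OF fs])
    from has_integral_integral_lborel[OF this]
    have 2: "((\<lambda>s. apply_bcontfun (E (f s)) z) has_integral (LINT s|lborel. apply_bcontfun (E (f s)) z)) UNIV" .
    have "(LINT s|lborel. apply_bcontfun (E (f s)) z) = apply_bcontfun (E F0) z"
      using D by (cases "of_discrete d \<in> (multi_indices m :: 'a list set)")
        (auto simp: E_def z seminorm_embed_apply[OF fs] seminorm_embed_apply[OF F] F0_def[abs_def])
    then show "apply_bcontfun B z = apply_bcontfun (E F0) z" using has_integral_unique[OF 1 2] by simp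
  qed
  with B have Eint: "((\<lambda>s. E (f s)) has_integral E F0) UNIV" by simp
  have uhas: "((\<lambda>s. u (f s)) has_integral (LINT s|lborel. u (f s))) UNIV"
    by (rule has_integral_integral_lborel[OF uint])
  \<comment> \<open>The error splits into that of \<open>E R\<close> against \<open>E F0\<close>, at
    most \<open>2 * e\<close> and enlarged by \<open>C * n\<close>, and two errors \<open>e\<close>
    on the side of \<open>u\<close>.\<close>
  have "norm (u F0 - (LINT s|lborel. u (f s))) \<le> (C * n * 2 + 2) * e" if e: "0 < e" for e
  proof -
    have nU: "\<not> (\<exists>a b. (UNIV :: 's set) = cbox a b)" by simp
    obtain B1 where "\<forall>a b. ball 0 B1 \<subseteq> cbox a b \<longrightarrow>
        (\<exists>z. ((\<lambda>s. if s \<in> UNIV then E (f s) else 0) has_integral z) (cbox a b) \<and> norm (z - E F0) < e)"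
      by (rule has_integral_altD[OF Eint nU e])
    then have B1: "\<And>a b. ball 0 B1 \<subseteq> cbox a b \<Longrightarrow> \<exists>z. ((\<lambda>s. E (f s)) has_integral z) (cbox a b) \<and> norm (z - E F0) < e"
      by simp
    obtain B2 where "\<forall>a b. ball 0 B2 \<subseteq> cbox a b \<longrightarrow>
        (\<exists>z. ((\<lambda>s. if s \<in> UNIV then u (f s) else 0) has_integral z) (cbox a b) \<and> norm (z - (LINT s|lborel. u (f s))) < e)"
      by (rule has_integral_altD[OF uhas nU e])
    then have B2: "\<And>a b. ball 0 B2 \<subseteq> cbox a b \<Longrightarrow> \<exists>z. ((\<lambda>s. u (f s)) has_integral z) (cbox a b) \<and> norm (z - (LINT s|lborel. u (f s))) < e"
      by simp
    obtain a b :: 's where ab: "ball 0 (max B1 B2) \<subseteq> cbox a b"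
      using bounded_subset_cbox_symmetric[OF bounded_ball] by metis
    have sub: "ball 0 B1 \<subseteq> cbox a b" "ball 0 B2 \<subseteq> cbox a b"
      using ab subset_ball[of B1 "max B1 B2" "0::'s"] subset_ball[of B2 "max B1 B2" "0::'s"] by auto
    obtain z where z: "((\<lambda>s. E (f s)) has_integral z) (cbox a b)" "norm (z - E F0) < e" using B1[OF sub(1)] by blast
    obtain y where y: "((\<lambda>s. u (f s)) has_integral y) (cbox a b)" "norm (y - (LINT s|lborel. u (f s))) < e"
      using B2[OF sub(2)] by blast
    obtain \<gamma>1 where "gauge \<gamma>1 \<and> (\<forall>D. D tagged_division_of (cbox a b) \<and> \<gamma>1 fine D \<longrightarrow>
        norm ((\<Sum>(x, k)\<in>D. measure lborel k *\<^sub>R E (f x)) - z) < e)"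
      using z(1)[unfolded has_integral, rule_format, OF e] by (elim exE)
    then have \<gamma>1: "gauge \<gamma>1" "\<And>D. D tagged_division_of (cbox a b) \<Longrightarrow> \<gamma>1 fine D \<Longrightarrow>
        norm ((\<Sum>(x, k)\<in>D. measure lborel k *\<^sub>R E (f x)) - z) < e"
      by simp_all
    obtain \<gamma>2 where "gauge \<gamma>2 \<and> (\<forall>D. D tagged_division_of (cbox a b) \<and> \<gamma>2 fine D \<longrightarrow>
        norm ((\<Sum>(x, k)\<in>D. measure lborel k *\<^sub>R u (f x)) - y) < e)"
      using y(1)[unfolded has_integral, rule_format, OF e] by (elim exE)
    then have \<gamma>2: "gauge \<gamma>2" "\<And>D. D tagged_division_of (cbox a b) \<Longrightarrow> \<gamma>2 fine D \<Longrightarrow>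
        norm ((\<Sum>(x, k)\<in>D. measure lborel k *\<^sub>R u (f x)) - y) < e"
      by simp_all
    \<comment> \<open>A division fine for both gauges lets the same Riemann sum \<open>R\<close>
      approximate both integrals.\<close>
    obtain D where D: "D tagged_division_of (cbox a b)" "(\<lambda>x. \<gamma>1 x \<inter> \<gamma>2 x) fine D"
      using fine_division_exists[OF gauge_Int[OF \<gamma>1(1) \<gamma>2(1)]] by blast
    have fine: "\<gamma>1 fine D" "\<gamma>2 fine D" using D(2) by (auto simp: fine_Int)
    have fin: "finite D" using D(1) by (rule tagged_division_of_finite)
    define R where "R x = (\<Sum>d\<in>D. complex_of_real (measure lborel (snd d)) * f (fst d) x)" for x
    have R: "R \<in> schwartz" unfolding R_def[abs_def] by (intro schwartz_sum schwartz_cmult fs)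
    have ER: "E R = (\<Sum>(x, k)\<in>D. measure lborel k *\<^sub>R E (f x))"
      unfolding E_def R_def[abs_def] by (subst seminorm_embed_sum[OF fin fs]) (simp add: split_beta)
    have uR: "u R = (\<Sum>(x, k)\<in>D. measure lborel k *\<^sub>R u (f x))"
      unfolding R_def[abs_def]
      by (subst tempered_sum[OF u]) (auto simp: split_beta tempered_cmult[OF u fs] scaleR_conv_of_real intro!: schwartz_cmult fs)
    have "norm (E R - E F0) \<le> norm (E R - z) + norm (z - E F0)"
      using norm_triangle_ineq[of "E R - z" "z - E F0"] by simp
    also have "\<dots> \<le> 2 * e" using \<gamma>1(2)[OF D(1) fine(1)] z(2) by (simp add: ER)
    finally have "norm (E (\<lambda>x. F0 x - R x)) \<le> 2 * e"
      by (simp add: E_def seminorm_embed_diff[OF F0 R] norm_minus_commute)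
    then have "norm (u (\<lambda>x. F0 x - R x)) \<le> C * (n * (2 * e))"
      using n C(1) by (intro order_trans[OF uE[OF schwartz_diff[OF F0 R]]] mult_left_mono)
    then have 1: "norm (u F0 - u R) \<le> C * (n * (2 * e))" by (simp add: tempered_diff[OF u F0 R])
    have 2: "norm (u R - y) < e" using \<gamma>2(2)[OF D(1) fine(2)] by (simp add: uR)
    have "u F0 - (LINT s|lborel. u (f s)) = (u F0 - u R) + ((u R - y) + (y - (LINT s|lborel. u (f s))))" by simp
    also have "norm \<dots> \<le> norm (u F0 - u R) + (norm (u R - y) + norm (y - (LINT s|lborel. u (f s))))"
      by (intro norm_triangle_mono order_refl norm_triangle_ineq)
    also have "\<dots> \<le> C * (n * (2 * e)) + (e + e)" using 1 2 y(2) by simp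
    finally show ?thesis by (simp add: algebra_simps)
  qed
  note small = this
  have K: "0 < C * n * 2 + 2" using C(1) n by (simp add: add_nonneg_pos)
  have "norm (u F0 - (LINT s|lborel. u (f s))) \<le> 0"
  proof (rule field_le_epsilon)
    fix e :: real assume "0 < e"
    then show "norm (u F0 - (LINT s|lborel. u (f s))) \<le> 0 + e"
      using small[of "e / (C * n * 2 + 2)"] K by simp
  qed
  then show "u (\<lambda>x. LINT s|lborel. f s x) = (LINT s|lborel. u (f s))" by (simp add: F0_def[abs_def])
qed

section \<open>Change of window\<close>

lemma lborel_integral_translate:
  fixes f :: "'a::euclidean_space \<Rightarrow> complex"
  assumes "f \<in> borel_measurable borel"
  shows "(LINT x|lborel. f (v + x)) = (LINT x|lborel. f x)"
proof -
  have "(LINT x|lborel. f x) = (LINT x|distr lborel borel ((+) v). f x)" by (simp add: lborel_distr_plus)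
  also have "\<dots> = (LINT x|lborel. f (v + x))" using assms by (simp add: integral_distr)
  finally show ?thesis ..
qed

text \<open>Reflection preserves the cube from \<open>- One\<close> to \<open>One\<close>, whose
  volume is finite and nonzero; hence the substitution constant is 1.\<close>

lemma lborel_integral_uminus:
  fixes f :: "'a::euclidean_space \<Rightarrow> complex"
  assumes "f \<in> borel_measurable borel"
  shows "(LINT x|lborel. f (- x)) = (LINT x|lborel. f x)"
proof -
  have lin: "linear (uminus :: 'a \<Rightarrow> 'a)" by (simp add: linear_uminus)
  have bij: "bij (uminus :: 'a \<Rightarrow> 'a)" by (rule o_bij[of uminus]) (auto simp: fun_eq_iff)
  obtain C :: real where C: "0 < C"
    and nn: "\<And>f. f \<in> borel_measurable borel \<Longrightarrow> (\<integral>\<^sup>+x. f (- x :: 'a) \<partial>lborel) = ennreal C * (\<integral>\<^sup>+x. f x \<partial>lborel)"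
    and int: "\<And>f::'a \<Rightarrow> complex. f \<in> borel_measurable borel \<Longrightarrow> (LINT x|lborel. f (- x)) = complex_of_real C * (LINT x|lborel. f x)"
    using lborel_linear_substitution[OF lin bij] by metis
  define B where "B = cbox (- One) (One :: 'a)"
  have "- x \<in> B \<longleftrightarrow> x \<in> B" for x by (auto simp: B_def mem_box)
  then have "indicator B (- x) = (indicator B x :: ennreal)" for x by (simp add: indicator_def)
  then have "emeasure lborel B = ennreal C * emeasure lborel B"
    using nn[of "indicator B"] by (simp add: B_def)
  moreover have "emeasure lborel B = ennreal (2 ^ DIM('a))"
  proof -
    have "prod ((\<bullet>) (One + One :: 'a)) Basis = (\<Prod>b\<in>(Basis :: 'a set). 2)"
      by (rule prod.cong) (auto simp: inner_add_left)
    then show ?thesis by (simp add: B_def emeasure_lborel_cbox_eq inner_diff_left)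
  qed
  ultimately have "C = 1" using C by (simp flip: ennreal_mult)
  then show ?thesis using int[OF assms] by simp
qed

lemma cnj_measurable [measurable (raw)]:
  assumes "f \<in> borel_measurable M"
  shows "(\<lambda>x. cnj (f x)) \<in> borel_measurable M"
  by (rule measurable_compose[OF assms borel_measurable_continuous_onI]) (intro continuous_intros)

text \<open>The short-time Fourier transform of \<open>f\<close> with window \<open>g\<close>, taken
  at position \<open>fst s\<close> and frequency \<open>- snd s\<close>.\<close>

definition tf_coeff :: "('a::euclidean_space \<Rightarrow> complex) \<Rightarrow> ('a \<Rightarrow> complex) \<Rightarrow> 'a \<times> 'a \<Rightarrow> complex" where
  "tf_coeff f g s = (LINT t|lborel. f t * cnj (tf_shift (fst s) (snd s) g t))"

lemma tf_coeff_schwartz: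
  "f \<in> schwartz \<Longrightarrow> g \<in> schwartz \<Longrightarrow> (\<lambda>t. f t * cnj (tf_shift y \<xi> g t)) \<in> schwartz"
  by (intro schwartz_mult schwartz_cnj schwartz_tf_shift)

lemma tf_coeff_integrable:
  "f \<in> schwartz \<Longrightarrow> g \<in> schwartz \<Longrightarrow> integrable lborel (\<lambda>t. f t * cnj (tf_shift y \<xi> g t))"
  by (intro schwartz_integrable tf_coeff_schwartz)

lemma tf_coeff_bounded:
  assumes f: "f \<in> schwartz" and g: "g \<in> schwartz"
  obtains C where "0 \<le> C" "\<And>s. norm (tf_coeff f g s) \<le> C"
proof -
  obtain D where D: "0 \<le> D" "\<And>x. norm (g x) \<le> D" using schwartz_bounded[OF g] by blast
  have "norm (tf_coeff f g s) \<le> (LINT t|lborel. norm (f t) * D)" for s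
  proof -
    have "norm (tf_coeff f g s) \<le> (LINT t|lborel. norm (f t * cnj (tf_shift (fst s) (snd s) g t)))"
      unfolding tf_coeff_def by simp
    also have "\<dots> \<le> (LINT t|lborel. norm (f t) * D)"
      using f by (intro integral_mono integrable_norm tf_coeff_integrable f g integrable_mult_left schwartz_integrable)
        (auto simp: norm_mult norm_tf_shift intro!: mult_left_mono D)
    finally show ?thesis .
  qed
  moreover have "0 \<le> (LINT t|lborel. norm (f t) * D)" using D by (intro Bochner_Integration.integral_nonneg) auto
  ultimately show thesis using that by blast
qed

lemma tf_coeff_continuous:
  assumes f: "f \<in> schwartz" and g: "g \<in> schwartz"
  shows "continuous_on UNIV (tf_coeff f g)"
proof (rule continuous_of_vanishing)
  fix s0
  obtain N where N: "N \<in> vanishing_weights s0"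
    "\<And>s x. (1 + norm x) ^ 0 * norm (iter_deriv [] (\<lambda>x. tf_shift (fst s) (snd s) g x - tf_shift (fst s0) (snd s0) g x) x) \<le> N s"
    using dominated_bound[OF dominated_tf_family_diff[OF tf_shift_tf_family[OF g]], of "[]" s0 0]
    by (metis UNIV_I lists.Nil)
  define I where "I = (LINT t|lborel. norm (f t))"
  have "norm (tf_coeff f g s - tf_coeff f g s0) \<le> I * N s" for s
  proof -
    have "tf_coeff f g s - tf_coeff f g s0
        = (LINT t|lborel. f t * cnj (tf_shift (fst s) (snd s) g t) - f t * cnj (tf_shift (fst s0) (snd s0) g t))"
      unfolding tf_coeff_def by (intro Bochner_Integration.integral_diff[symmetric] tf_coeff_integrable f g)
    also have "norm \<dots> \<le> (LINT t|lborel. norm (f t * cnj (tf_shift (fst s) (snd s) g t) - f t * cnj (tf_shift (fst s0) (snd s0) g t)))"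
      by simp
    also have "\<dots> \<le> (LINT t|lborel. norm (f t) * N s)"
    proof (intro integral_mono integrable_norm Bochner_Integration.integrable_diff tf_coeff_integrable f g
        integrable_mult_left schwartz_integrable)
      fix t
      have "norm (f t * cnj (tf_shift (fst s) (snd s) g t) - f t * cnj (tf_shift (fst s0) (snd s0) g t))
          = norm (f t) * norm (tf_shift (fst s) (snd s) g t - tf_shift (fst s0) (snd s0) g t)"
        by (simp add: norm_mult flip: right_diff_distrib complex_cnj_diff)
      also have "\<dots> \<le> norm (f t) * N s" using N(2)[where s = s and x = t] by (intro mult_left_mono) auto
      finally show "norm (f t * cnj (tf_shift (fst s) (snd s) g t) - f t * cnj (tf_shift (fst s0) (snd s0) g t)) \<le> norm (f t) * N s" .
    qed
    finally show ?thesis by (simp add: I_def)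
  qed
  moreover have "0 \<le> I" by (simp add: I_def)
  ultimately show "\<exists>N\<in>vanishing_weights s0. \<forall>s. norm (tf_coeff f g s - tf_coeff f g s0) \<le> N s"
    by (intro bexI[OF _ weight_cone_cmult[OF weight_cone_vanishing N(1), of I]]) auto
qed

text \<open>Writes the position as \<open>t - (t - fst s)\<close>: the first term falls on
  \<open>f\<close>, the second on the window.\<close>

lemma tf_coeff_coord_fst:
  assumes f: "f \<in> schwartz" and g: "g \<in> schwartz"
  shows "complex_of_real (fst s \<bullet> b) * tf_coeff f g s
    = tf_coeff (\<lambda>x. complex_of_real (x \<bullet> b) * f x) g s - tf_coeff f (\<lambda>x. complex_of_real (x \<bullet> b) * g x) s"
proof -
  have "complex_of_real (fst s \<bullet> b) * (f t * cnj (tf_shift (fst s) (snd s) g t))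
      = (complex_of_real (t \<bullet> b) * f t) * cnj (tf_shift (fst s) (snd s) g t)
        - f t * cnj (tf_shift (fst s) (snd s) (\<lambda>x. complex_of_real (x \<bullet> b) * g x) t)" for t
    by (simp add: tf_shift_def algebra_simps inner_diff_left)
  then show ?thesis
    unfolding tf_coeff_def integral_mult_right_zero[symmetric]
    using Bochner_Integration.integral_diff[OF tf_coeff_integrable[OF schwartz_coord[OF f, of b] g, of "fst s" "snd s"]
        tf_coeff_integrable[OF f schwartz_coord[OF g, of b], of "fst s" "snd s"]]
    by simp
qed

text \<open>Integration by parts: the frequency arises from differentiating the conjugated phase,
  and the derivative is moved to \<open>f\<close> and to \<open>g\<close>.\<close>

lemma tf_coeff_coord_snd:
  assumes f: "f \<in> schwartz" and g: "g \<in> schwartz" and b: "b \<in> Basis"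
  shows "complex_of_real (snd s \<bullet> b) * tf_coeff f g s
    = \<i> * (tf_coeff (partial_deriv b f) g s + tf_coeff f (partial_deriv b g) s)"
proof -
  define h where "h t = cnj (tf_shift (fst s) (snd s) g t)" for t
  have h: "h \<in> schwartz" unfolding h_def[abs_def] by (intro schwartz_cnj schwartz_tf_shift g)
  have dh: "partial_deriv b h t = cnj (tf_shift (fst s) (snd s) (partial_deriv b g) t)
      + \<i> * complex_of_real (b \<bullet> snd s) * h t" for t
    unfolding h_def[abs_def]
    using partial_deriv_eqI[OF has_derivative_cnj[OF has_derivative_tf_shift[OF g]], of b "fst s" "snd s" t] by simp
  have "0 = (LINT t|lborel. partial_deriv b (\<lambda>t. f t * h t) t)"
    by (simp add: schwartz_integral_partial_deriv[OF schwartz_mult[OF f h] b])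
  also have "\<dots> = (LINT t|lborel. (f t * cnj (tf_shift (fst s) (snd s) (partial_deriv b g) t)
      + partial_deriv b f t * cnj (tf_shift (fst s) (snd s) g t))
      + \<i> * complex_of_real (b \<bullet> snd s) * (f t * cnj (tf_shift (fst s) (snd s) g t)))"
  proof (rule Bochner_Integration.integral_cong[OF refl])
    fix t
    show "partial_deriv b (\<lambda>t. f t * h t) t = (f t * cnj (tf_shift (fst s) (snd s) (partial_deriv b g) t)
      + partial_deriv b f t * cnj (tf_shift (fst s) (snd s) g t))
      + \<i> * complex_of_real (b \<bullet> snd s) * (f t * cnj (tf_shift (fst s) (snd s) g t))"
      unfolding partial_deriv_mult[OF schwartz_differentiable[OF f] schwartz_differentiable[OF h]] dh
      by (simp add: h_def algebra_simps)
  qed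
  also have "\<dots> = (tf_coeff f (partial_deriv b g) s + tf_coeff (partial_deriv b f) g s)
      + \<i> * complex_of_real (b \<bullet> snd s) * tf_coeff f g s"
  proof -
    have i: "integrable lborel (\<lambda>t. f t * cnj (tf_shift (fst s) (snd s) (partial_deriv b g) t))"
      "integrable lborel (\<lambda>t. partial_deriv b f t * cnj (tf_shift (fst s) (snd s) g t))"
      "integrable lborel (\<lambda>t. f t * cnj (tf_shift (fst s) (snd s) g t))"
      by (intro tf_coeff_integrable schwartz_partial_deriv f g b)+
    show ?thesis
      unfolding tf_coeff_def Bochner_Integration.integral_add[OF Bochner_Integration.integrable_add[OF i(1,2)] integrable_mult_right[OF i(3)]]
        Bochner_Integration.integral_add[OF i(1,2)] integral_mult_right_zero ..
  qed
  finally have "tf_coeff f (partial_deriv b g) s + tf_coeff (partial_deriv b f) g s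
      = - (\<i> * complex_of_real (b \<bullet> snd s) * tf_coeff f g s)"
    by (simp add: eq_neg_iff_add_eq_0)
  then have "\<i> * (tf_coeff f (partial_deriv b g) s + tf_coeff (partial_deriv b f) g s)
      = \<i> * - (\<i> * complex_of_real (b \<bullet> snd s) * tf_coeff f g s)" by simp
  also have "\<dots> = complex_of_real (b \<bullet> snd s) * tf_coeff f g s" by (simp add: mult.assoc[symmetric])
  finally show ?thesis by (simp add: inner_commute add.commute)
qed

text \<open>Coordinates of phase space turn a coefficient into a combination of other coefficients.
  The span is closed under this, so boundedness of its members already gives rapid decay in position
  and frequency together.\<close>

inductive_set tf_coeff_span :: "('a::euclidean_space \<times> 'a \<Rightarrow> complex) set" where
  coeff: "f \<in> schwartz \<Longrightarrow> g \<in> schwartz \<Longrightarrow> tf_coeff f g \<in> tf_coeff_span"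
| add: "F \<in> tf_coeff_span \<Longrightarrow> G \<in> tf_coeff_span \<Longrightarrow> (\<lambda>s. F s + G s) \<in> tf_coeff_span"
| cmult: "F \<in> tf_coeff_span \<Longrightarrow> (\<lambda>s. c * F s) \<in> tf_coeff_span"

lemma tf_coeff_span_coord:
  assumes "F \<in> tf_coeff_span" and b: "b \<in> Basis"
  shows "(\<lambda>s. complex_of_real (fst s \<bullet> b) * F s) \<in> tf_coeff_span"
    and "(\<lambda>s. complex_of_real (snd s \<bullet> b) * F s) \<in> tf_coeff_span"
proof -
  have "(\<lambda>s. complex_of_real (fst s \<bullet> b) * F s) \<in> tf_coeff_span \<and> (\<lambda>s. complex_of_real (snd s \<bullet> b) * F s) \<in> tf_coeff_span"
    using assms(1)
  proof (induction rule: tf_coeff_span.induct)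
    case (coeff f g)
    have "(\<lambda>s. complex_of_real (fst s \<bullet> b) * tf_coeff f g s) = (\<lambda>s. tf_coeff (\<lambda>x. complex_of_real (x \<bullet> b) * f x) g s
        + (- 1) * tf_coeff f (\<lambda>x. complex_of_real (x \<bullet> b) * g x) s)"
      by (simp add: tf_coeff_coord_fst[OF coeff] fun_eq_iff)
    moreover have "(\<lambda>s. complex_of_real (snd s \<bullet> b) * tf_coeff f g s)
        = (\<lambda>s. \<i> * (tf_coeff (partial_deriv b f) g s + tf_coeff f (partial_deriv b g) s))"
      by (simp add: tf_coeff_coord_snd[OF coeff b] fun_eq_iff)
    moreover have "(\<lambda>s. tf_coeff (\<lambda>x. complex_of_real (x \<bullet> b) * f x) g s
        + (- 1) * tf_coeff f (\<lambda>x. complex_of_real (x \<bullet> b) * g x) s) \<in> tf_coeff_span"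
      by (intro tf_coeff_span.add tf_coeff_span.cmult tf_coeff_span.coeff schwartz_coord coeff)
    moreover have "(\<lambda>s. \<i> * (tf_coeff (partial_deriv b f) g s + tf_coeff f (partial_deriv b g) s)) \<in> tf_coeff_span"
      by (intro tf_coeff_span.add tf_coeff_span.cmult tf_coeff_span.coeff schwartz_partial_deriv coeff b)
    ultimately show ?case by (simp only:)
  next
    case (add F G)
    then show ?case by (auto simp: distrib_left intro: tf_coeff_span.add)
  next
    case (cmult F c)
    then show ?case by (auto simp: mult.left_commute[of _ c] intro: tf_coeff_span.cmult)
  qed
  then show "(\<lambda>s. complex_of_real (fst s \<bullet> b) * F s) \<in> tf_coeff_span"
    and "(\<lambda>s. complex_of_real (snd s \<bullet> b) * F s) \<in> tf_coeff_span" by auto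
qed

lemma tf_coeff_decay:
  fixes f g :: "'a::euclidean_space \<Rightarrow> complex"
  assumes f: "f \<in> schwartz" and g: "g \<in> schwartz"
  obtains C where "\<And>s. (1 + norm s) ^ k * norm (tf_coeff f g s) \<le> C"
proof -
  define X where "X = (\<lambda>F _::unit. F) ` (tf_coeff_span :: ('a \<times> 'a \<Rightarrow> complex) set)"
  have XI: "(\<lambda>_. F) \<in> X" if "F \<in> tf_coeff_span" for F unfolding X_def using that by (rule imageI)
  have "\<exists>N\<in>UNIV. \<forall>i\<in>UNIV. \<forall>s. (1 + norm s) ^ k * norm (tf_coeff f g s) \<le> N (i::unit)"
  proof (rule weighted_bound_coinduct[where X = X])
    show "(\<lambda>_. tf_coeff f g) \<in> X" by (intro XI tf_coeff_span.coeff f g)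
  next
    fix H assume "H \<in> X"
    then obtain F where F: "F \<in> tf_coeff_span" and H: "H = (\<lambda>_. F)" unfolding X_def by blast
    have "\<exists>C. \<forall>s. norm (F s) \<le> C" using F
    proof (induction rule: tf_coeff_span.induct)
      case (coeff f g)
      then show ?case using tf_coeff_bounded by metis
    next
      case (add F G)
      then obtain C D where "\<And>s. norm (F s) \<le> C" "\<And>s. norm (G s) \<le> D" by blast
      then have "norm (F s + G s) \<le> C + D" for s by (intro norm_triangle_mono)
      then show ?case by blast
    next
      case (cmult F c)
      then obtain C where "\<And>s. norm (F s) \<le> C" by blast
      then have "norm (c * F s) \<le> norm c * C" for s by (simp add: norm_mult mult_left_mono)
      then show ?case by blast
    qed
    then obtain C where "\<And>s. norm (F s) \<le> C" by blast
    then show "\<exists>N\<in>UNIV. \<forall>i\<in>UNIV. \<forall>s. norm (H i s) \<le> N i"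
      by (intro bexI[of _ "\<lambda>_. C"]) (auto simp: H)
    fix b :: "'a \<times> 'a" assume "b \<in> Basis"
    then consider b1 where "b1 \<in> Basis" "b = (b1, 0)" | b2 where "b2 \<in> Basis" "b = (0, b2)"
      unfolding Basis_prod_def by blast
    then show "\<exists>G\<in>X. \<forall>i\<in>UNIV. \<forall>s. G i s = complex_of_real (s \<bullet> b) * H i s"
    proof cases
      case 1
      show ?thesis by (rule bexI[OF _ XI[OF tf_coeff_span_coord(1)[OF F 1(1)]]]) (simp add: H 1(2) inner_prod_def)
    next
      case 2
      show ?thesis by (rule bexI[OF _ XI[OF tf_coeff_span_coord(2)[OF F 2(1)]]]) (simp add: H 2(2) inner_prod_def)
    qed
  qed simp
  then show thesis using that by blast
qed

text \<open>Shifts grow polynomially in every seminorm and coefficients decrease rapidly, so the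
  integrand of the expansion is integrable in every seminorm.\<close>

lemma tf_coeff_dominated:
  fixes f g :: "'a::euclidean_space \<Rightarrow> complex"
  assumes f: "f \<in> schwartz" and g: "g \<in> schwartz"
  shows "dominated integrable_weights UNIV (\<lambda>s x. tf_coeff f g s * tf_shift (fst s) (snd s) g x)"
proof (rule dominated_cmult_index[OF dominated_tf_family[OF tf_shift_tf_family[OF g]]])
  fix N :: "'a \<times> 'a \<Rightarrow> real" assume "N \<in> poly_weights"
  then obtain C k where C: "0 \<le> C" "\<And>s. N s \<le> C * (1 + norm s) ^ k" unfolding poly_weights_def by blast
  define n where "n = decay_exponent TYPE('a \<times> 'a)"
  \<comment> \<open>The power \<open>k\<close> compensates the growth of the shifts, the power
    \<open>n\<close> leaves an integrable bound.\<close>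
  obtain D where D: "\<And>s. (1 + norm s) ^ (k + n) * norm (tf_coeff f g s) \<le> D" using tf_coeff_decay[OF f g] by blast
  have "norm (tf_coeff f g s) * N s \<le> (C * D) * (1 / (1 + norm s) ^ n)" for s
  proof (rule le_decay)
    have "(1 + norm s) ^ n * (norm (tf_coeff f g s) * N s) \<le> (1 + norm s) ^ n * (norm (tf_coeff f g s) * (C * (1 + norm s) ^ k))"
      by (intro mult_left_mono C(2)) auto
    also have "\<dots> = C * ((1 + norm s) ^ (k + n) * norm (tf_coeff f g s))" by (simp add: power_add mult_ac)
    also have "\<dots> \<le> C * D" by (intro mult_left_mono D C(1))
    finally show "(1 + norm s) ^ n * (norm (tf_coeff f g s) * N s) \<le> C * D" .
  qed
  then show "(\<lambda>s. norm (tf_coeff f g s) * N s) \<in> integrable_weights"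
    unfolding integrable_weights_def n_def
    by (intro CollectI exI[of _ "\<lambda>s. (C * D) * (1 / (1 + norm s) ^ decay_exponent TYPE('a \<times> 'a))"] conjI
        integrable_mult_right integrable_decay allI)
qed

lemma tf_coeff_abs_integrable:
  fixes f g :: "'a::euclidean_space \<Rightarrow> complex"
  assumes f: "f \<in> schwartz" and g: "g \<in> schwartz"
  shows "integrable lborel (tf_coeff f g)"
proof -
  obtain C where C: "\<And>s. (1 + norm s) ^ decay_exponent TYPE('a \<times> 'a) * norm (tf_coeff f g s) \<le> C"
    using tf_coeff_decay[OF f g] by blast
  show ?thesis
    by (rule decay_bound_integrable(1)[OF borel_measurable_continuous_onI[OF tf_coeff_continuous[OF f g]] C])
qed

lemma tf_coeff_poly_growth:
  assumes "f \<in> schwartz" "g \<in> schwartz"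
  shows "poly_growth (tf_coeff f g)"
proof -
  obtain C where "0 \<le> C" "\<And>s. norm (tf_coeff f g s) \<le> C" using tf_coeff_bounded[OF assms] by blast
  then show ?thesis unfolding poly_growth_def using tf_coeff_continuous[OF assms]
    by (intro conjI exI[of _ C] exI[of _ 0]) auto
qed

text \<open>For fixed \<open>y\<close>, integration over the frequency is Fourier inversion for
  \<open>f\<close> times the conjugate of the translated window. It returns \<open>f x\<close> times
  the squared modulus of \<open>g (x - y)\<close>, whose integral over \<open>y\<close> does not
  depend on \<open>x\<close>.\<close>

lemma tf_coeff_inversion:
  fixes f g :: "'a::euclidean_space \<Rightarrow> complex"
  assumes f: "f \<in> schwartz" and g: "g \<in> schwartz"
    and inv: "\<And>f x. f \<in> (schwartz :: ('a \<Rightarrow> complex) set) \<Longrightarrow>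
       (LINT \<xi>|lborel. fourier f \<xi> * phase (- (x \<bullet> \<xi>))) = complex_of_real c * f x"
  shows "(LINT s|lborel. tf_coeff f g s * tf_shift (fst s) (snd s) g x)
    = complex_of_real c * (LINT t|lborel. g t * cnj (g t)) * f x"
proof -
  have [measurable]: "f \<in> borel_measurable borel" "g \<in> borel_measurable borel"
    using f g by (auto intro: schwartz_measurable)
  define F where "F s = tf_coeff f g s * tf_shift (fst s) (snd s) g x" for s
  have "continuous_on UNIV F"
  proof (rule continuous_of_vanishing)
    fix s0
    obtain N where N: "N \<in> vanishing_weights s0" "\<And>s x. (1 + norm x) ^ 0 * norm (iter_deriv []
        (\<lambda>x. tf_coeff f g s * tf_shift (fst s) (snd s) g x - tf_coeff f g s0 * tf_shift (fst s0) (snd s0) g x) x) \<le> N s"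
      using dominated_bound[OF dominated_tf_family_diff[OF tf_familyI[OF tf_coeff_poly_growth[OF f g] g]], of "[]" s0 0]
      by (metis UNIV_I lists.Nil)
    then show "\<exists>N\<in>vanishing_weights s0. \<forall>s. norm (F s - F s0) \<le> N s"
      by (intro bexI[OF _ N(1)]) (simp add: F_def)
  qed
  then have [measurable]: "F \<in> borel_measurable borel" by (rule borel_measurable_continuous_onI)
  obtain D where D: "0 \<le> D" "\<And>x. norm (g x) \<le> D" using schwartz_bounded[OF g] by blast
  have "norm (F s) \<le> norm (D * norm (tf_coeff f g s))" for s
    using mult_left_mono[OF D(2)[of "x - fst s"], of "norm (tf_coeff f g s)"] D(1) by (simp add: F_def norm_mult norm_tf_shift mult.commute)
  then have "integrable lborel F"
    by (intro Bochner_Integration.integrable_bound[OF integrable_mult_right[OF integrable_norm[OF tf_coeff_abs_integrable[OF f g]], of D]])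
      auto
  then have intF: "integrable (lborel \<Otimes>\<^sub>M lborel) F" by (simp add: lborel_prod)
  have inner: "(LINT \<xi>|lborel. F (y, \<xi>)) = complex_of_real c * f x * (cnj (g (x - y)) * g (x - y))" for y
  proof -
    define G where "G t = f t * cnj (tf_shift y 0 g t)" for t
    have G: "G \<in> schwartz" unfolding G_def[abs_def] by (rule tf_coeff_schwartz[OF f g])
    define H where "H \<xi> = fourier G \<xi> * phase (- (x \<bullet> \<xi>)) * g (x - y)" for \<xi>
    have [measurable]: "fourier G \<in> borel_measurable borel" by (intro schwartz_measurable schwartz_fourier G)
    have [measurable]: "H \<in> borel_measurable borel" unfolding H_def[abs_def] by measurable
    \<comment> \<open>Conjugating the shift reverses the sign of the frequency, hence the
      reflection.\<close>
    have "F (y, \<xi>) = H (- \<xi>)" for \<xi>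
      by (simp add: F_def H_def tf_coeff_def fourier_def G_def tf_shift_def cnj_phase mult_ac)
    then have "(LINT \<xi>|lborel. F (y, \<xi>)) = (LINT \<xi>|lborel. H (- \<xi>))" by simp
    also have "\<dots> = (LINT \<xi>|lborel. H \<xi>)" by (rule lborel_integral_uminus) simp
    also have "\<dots> = complex_of_real c * G x * g (x - y)" using inv[OF G, of x] by (simp add: H_def)
    finally show ?thesis by (simp add: G_def tf_shift_def mult_ac)
  qed
  have "(LINT s|lborel. F s) = (LINT s|(lborel \<Otimes>\<^sub>M lborel). F s)" by (simp add: lborel_prod)
  also have "\<dots> = (LINT y|lborel. LINT \<xi>|lborel. F (y, \<xi>))"
    by (rule lborel_pair.integral_fst'[OF intF, symmetric])
  also have "\<dots> = complex_of_real c * f x * (LINT y|lborel. cnj (g (x - y)) * g (x - y))" by (simp add: inner)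
  also have "(LINT y|lborel. cnj (g (x - y)) * g (x - y)) = (LINT y|lborel. cnj (g (x + y)) * g (x + y))"
    using lborel_integral_uminus[of "\<lambda>y. cnj (g (x + y)) * g (x + y)"] by simp
  also have "\<dots> = (LINT y|lborel. cnj (g y) * g y)" by (rule lborel_integral_translate) simp
  finally show ?thesis by (simp add: F_def mult_ac)
qed

text \<open>Shifting \<open>f\<close> translates its coefficients up to a phase, which the norm
  discards. This makes the kernel of the window change independent of the point of phase
  space.\<close>

lemma norm_tf_coeff_tf_shift:
  fixes f g :: "'a::euclidean_space \<Rightarrow> complex"
  assumes f: "f \<in> schwartz" and g: "g \<in> schwartz"
  shows "norm (tf_coeff (tf_shift y \<xi> f) g ((y, \<xi>) + s)) = norm (tf_coeff f g s)"
proof -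
  obtain z \<zeta> where s: "s = (z, \<zeta>)" by (cases s)
  have [measurable]: "f \<in> borel_measurable borel" "g \<in> borel_measurable borel"
    using f g by (auto intro: schwartz_measurable)
  have "tf_coeff (tf_shift y \<xi> f) g ((y, \<xi>) + s)
      = (LINT t|lborel. f (t - y) * phase (t \<bullet> \<xi>) * cnj (g (t - (y + z)) * phase (t \<bullet> (\<xi> + \<zeta>))))"
    by (simp add: tf_coeff_def tf_shift_def s)
  also have "\<dots> = (LINT t|lborel. f (y + t - y) * phase ((y + t) \<bullet> \<xi>) * cnj (g (y + t - (y + z)) * phase ((y + t) \<bullet> (\<xi> + \<zeta>))))"
    by (rule lborel_integral_translate[symmetric]) simp
  also have "\<dots> = (LINT t|lborel. phase (- (y \<bullet> \<zeta>)) * (f t * cnj (tf_shift z \<zeta> g t)))"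
  proof (rule Bochner_Integration.integral_cong[OF refl])
    fix t
    have "phase ((y + t) \<bullet> \<xi>) * phase (- ((y + t) \<bullet> (\<xi> + \<zeta>))) = phase (- (y \<bullet> \<zeta>)) * phase (- (t \<bullet> \<zeta>))"
      unfolding phase_add[symmetric] by (simp add: inner_add_left inner_add_right)
    then show "f (y + t - y) * phase ((y + t) \<bullet> \<xi>) * cnj (g (y + t - (y + z)) * phase ((y + t) \<bullet> (\<xi> + \<zeta>)))
        = phase (- (y \<bullet> \<zeta>)) * (f t * cnj (tf_shift z \<zeta> g t))"
      by (simp add: tf_shift_def cnj_phase mult_ac)
  qed
  also have "\<dots> = phase (- (y \<bullet> \<zeta>)) * tf_coeff f g s" by (simp add: tf_coeff_def s)
  finally show ?thesis by (simp add: norm_mult)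
qed

section \<open>Comparison of two windows\<close>

lemma tempered_tf_shift_continuous:
  assumes u: "u \<in> tempered" and g: "g \<in> schwartz"
  shows "continuous_on UNIV (\<lambda>s. u (tf_shift (fst s) (snd s) g))"
proof (rule continuous_of_vanishing)
  fix s0
  obtain N where N: "N \<in> vanishing_weights s0"
    "\<And>s. norm (u (\<lambda>x. tf_shift (fst s) (snd s) g x - tf_shift (fst s0) (snd s0) g x)) \<le> N s"
    using dominated_weight[OF weight_cone_vanishing dominated_tf_family_diff[OF tf_shift_tf_family[OF g]] tempered_weight[OF u]]
    by (metis UNIV_I)
  then show "\<exists>N\<in>vanishing_weights s0. \<forall>s. norm (u (tf_shift (fst s) (snd s) g) - u (tf_shift (fst s0) (snd s0) g)) \<le> N s"
    by (intro bexI[OF _ N(1)]) (simp add: tempered_diff[OF u schwartz_tf_shift[OF g] schwartz_tf_shift[OF g], symmetric])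
qed

text \<open>\<open>u\<close> is applied under the integral that expands the shifted \<open>h\<close>
  in shifts of \<open>g\<close>, and the variable is recentred at \<open>(y, \<xi>)\<close>. The
  constant is fixed before \<open>u\<close> and the point, so one kernel serves them all.\<close>

lemma tempered_window_expansion:
  fixes g h :: "'a::euclidean_space \<Rightarrow> complex"
  assumes g: "g \<in> schwartz" "g \<noteq> (\<lambda>x. 0)" and h: "h \<in> schwartz"
  obtains C :: real where "0 < C" "\<And>u y \<xi>. u \<in> tempered \<Longrightarrow>
    ennreal (norm (u (tf_shift y \<xi> h))) \<le> (\<integral>\<^sup>+s. ennreal (C * norm (tf_coeff h g s)) *
      ennreal (norm (u (tf_shift (y + fst s) (\<xi> + snd s) g))) \<partial>lborel)"
proof -
  obtain c where c: "0 < c" and inv: "\<And>f x. f \<in> (schwartz :: ('a \<Rightarrow> complex) set) \<Longrightarrow>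
       (LINT \<xi>|lborel. fourier f \<xi> * phase (- (x \<bullet> \<xi>))) = complex_of_real c * f x"
    using fourier_inversion[OF g] by metis
  obtain a where a: "g a \<noteq> 0" using g(2) by auto
  define P where "P = (LINT x|lborel. (norm (g x))\<^sup>2)"
  have P: "0 < P" "(LINT x|lborel. g x * cnj (g x)) = complex_of_real P"
    using schwartz_L2_pos[OF g(1) a] by (auto simp: P_def)
  \<comment> \<open>Inversion constant times squared norm of \<open>g\<close>: the factor with which
    the expansion reproduces a function.\<close>
  define K where "K = c * P"
  have K: "0 < K" using c P by (simp add: K_def)
  have "ennreal (norm (u (tf_shift y \<xi> h))) \<le> (\<integral>\<^sup>+s. ennreal (1 / K * norm (tf_coeff h g s)) *
      ennreal (norm (u (tf_shift (y + fst s) (\<xi> + snd s) g))) \<partial>lborel)" if u: "u \<in> tempered" for u y \<xi>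
  proof -
    define \<phi> where "\<phi> = tf_shift y \<xi> h"
    have \<phi>: "\<phi> \<in> schwartz" unfolding \<phi>_def by (rule schwartz_tf_shift[OF h])
    have eq: "(\<lambda>x. LINT s|lborel. tf_coeff \<phi> g s * tf_shift (fst s) (snd s) g x) = (\<lambda>x. complex_of_real K * \<phi> x)"
      by (simp add: tf_coeff_inversion[OF \<phi> g(1) inv] P(2) K_def)
    note ex = tempered_integral[OF u dominated_tf_family_diff[OF tf_familyI[OF tf_coeff_poly_growth[OF \<phi> g(1)] g(1)]]
        tf_coeff_dominated[OF \<phi> g(1)], unfolded eq, OF schwartz_cmult[OF \<phi>]]
    have mult: "u (\<lambda>x. tf_coeff \<phi> g s * tf_shift (fst s) (snd s) g x) = tf_coeff \<phi> g s * u (tf_shift (fst s) (snd s) g)" for s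
      by (rule tempered_cmult[OF u schwartz_tf_shift[OF g(1)]])
    have "complex_of_real K * u \<phi> = (LINT s|lborel. tf_coeff \<phi> g s * u (tf_shift (fst s) (snd s) g))"
      using ex(3) by (simp add: mult tempered_cmult[OF u \<phi>])
    then have "K * norm (u \<phi>) = norm (LINT s|lborel. tf_coeff \<phi> g s * u (tf_shift (fst s) (snd s) g))"
      using K by (metis norm_mult norm_of_real abs_of_pos)
    also have "ennreal \<dots> \<le> (\<integral>\<^sup>+s. ennreal (norm (tf_coeff \<phi> g s * u (tf_shift (fst s) (snd s) g))) \<partial>lborel)"
      using ex(2) by (intro integral_norm_bound_ennreal) (simp add: mult)
    also have "\<dots> = (\<integral>\<^sup>+s. ennreal (norm (tf_coeff \<phi> g ((y, \<xi>) + s) * u (tf_shift (fst ((y, \<xi>) + s)) (snd ((y, \<xi>) + s)) g))) \<partial>lborel)"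
      using borel_measurable_continuous_onI[OF tf_coeff_continuous[OF \<phi> g(1)]]
        borel_measurable_continuous_onI[OF tempered_tf_shift_continuous[OF u g(1)]]
      by (intro haar_measure_translation[OF haar_measure_lborel, symmetric]) measurable
    also have "\<dots> = (\<integral>\<^sup>+s. ennreal (norm (tf_coeff h g s)) * ennreal (norm (u (tf_shift (y + fst s) (\<xi> + snd s) g))) \<partial>lborel)"
      by (simp add: norm_mult \<phi>_def norm_tf_coeff_tf_shift[OF h g(1)] ennreal_mult)
    finally have le: "ennreal (K * norm (u \<phi>)) \<le> (\<integral>\<^sup>+s. ennreal (norm (tf_coeff h g s)) * ennreal (norm (u (tf_shift (y + fst s) (\<xi> + snd s) g))) \<partial>lborel)" .
    have "ennreal (norm (u \<phi>)) = ennreal (1 / K) * ennreal (K * norm (u \<phi>))"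
      using K by (simp flip: ennreal_mult)
    also have "\<dots> \<le> ennreal (1 / K) * (\<integral>\<^sup>+s. ennreal (norm (tf_coeff h g s)) * ennreal (norm (u (tf_shift (y + fst s) (\<xi> + snd s) g))) \<partial>lborel)"
      by (intro mult_left_mono le) auto
    also have "\<dots> = (\<integral>\<^sup>+s. ennreal (1 / K) * (ennreal (norm (tf_coeff h g s)) * ennreal (norm (u (tf_shift (y + fst s) (\<xi> + snd s) g)))) \<partial>lborel)"
    proof (rule nn_integral_cmult[symmetric])
      have "continuous_on UNIV (\<lambda>s. u (tf_shift (fst ((y, \<xi>) + s)) (snd ((y, \<xi>) + s)) g))"
        by (rule continuous_on_compose2[OF tempered_tf_shift_continuous[OF u g(1)]]) (auto intro!: continuous_intros)
      from borel_measurable_continuous_onI[OF this] borel_measurable_continuous_onI[OF tf_coeff_continuous[OF h g(1)]]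
      show "(\<lambda>s. ennreal (norm (tf_coeff h g s)) * ennreal (norm (u (tf_shift (y + fst s) (\<xi> + snd s) g)))) \<in> borel_measurable lborel"
        by simp
    qed
    also have "\<dots> = (\<integral>\<^sup>+s. ennreal (1 / K * norm (tf_coeff h g s)) * ennreal (norm (u (tf_shift (y + fst s) (\<xi> + snd s) g))) \<partial>lborel)"
      using K by (simp add: ennreal_mult mult.assoc del: times_divide_eq_left)
    finally show ?thesis by (simp add: \<phi>_def)
  qed
  then show thesis using K that[of "1 / K"] by simp
qed

text \<open>\<open>Lp_norm_affine\<close> would give this with an unspecified positive factor; Haar
  invariance gives the exact one.\<close>

lemma Lp_norm_translate:
  fixes f :: "'a::euclidean_space \<Rightarrow> ennreal"
  assumes [measurable]: "f \<in> borel_measurable borel"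
  shows "Lp_norm p lborel (\<lambda>x. f (x + v)) = Lp_norm p lborel f"
proof (cases "p = top")
  case True
  have "(AE x in lborel. f (x + v) \<le> c) \<longleftrightarrow> (AE x in lborel. f x \<le> c)" for c
  proof -
    have "(AE x in lborel. f x \<le> c) \<longleftrightarrow> (AE x in distr lborel borel ((+) v). f x \<le> c)" unfolding lborel_distr_plus ..
    also have "\<dots> \<longleftrightarrow> (AE x in lborel. f (v + x) \<le> c)" by (rule AE_distr_iff) simp_all
    finally show ?thesis by (simp add: add.commute)
  qed
  then have "esssup lborel (\<lambda>x. f (x + v)) \<le> c \<longleftrightarrow> esssup lborel f \<le> c" for c by (simp add: esssup_le_iff)
  then show ?thesis unfolding True Lp_norm_top by (meson antisym order_refl)
next
  case False
  then show ?thesis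
    using haar_measure_translation[OF haar_measure_lborel, of "\<lambda>x. ennreal_powr (f x) (enn2real p)" v]
    by (simp add: Lp_norm_finite add.commute)
qed

text \<open>Extends \<open>Lp_norm_cmult\<close> to the factor 0, since the kernel of the window
  change may have zeros.\<close>

lemma Lp_norm_cmult_le:
  assumes "f \<in> borel_measurable M" and "1 \<le> p" "0 \<le> c"
  shows "Lp_norm p M (\<lambda>x. ennreal c * f x) \<le> ennreal c * Lp_norm p M f"
proof (cases "c = 0")
  case True
  have "Lp_norm p M (\<lambda>x. 0) \<le> 0"
    using esssup_le_iff[of "\<lambda>x. 0" M 0] by (cases "p = top") (simp_all add: Lp_norm_top Lp_norm_finite)
  then show ?thesis using True by simp
qed (use assms in \<open>simp add: Lp_norm_cmult\<close>)

lemma windowed_fourier_eq: "windowed_fourier w u y \<xi> = u (tf_shift y \<xi> w)"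
  by (simp add: windowed_fourier_def tf_shift_def phase_def)

text \<open>Minkowski's inequality is used twice, for the inner norm in \<open>y\<close> and for the
  outer one in \<open>\<xi>\<close>. Translation invariance removes the kernel variable from each
  norm, and what remains is the \<open>L\<^sup>1\<close> norm of the kernel.\<close>

lemma modulation_norm_window:
  fixes g h :: "'a::euclidean_space \<Rightarrow> complex"
  assumes g: "g \<in> schwartz" "g \<noteq> (\<lambda>x. 0)" and h: "h \<in> schwartz" and p: "1 \<le> p" and q: "1 \<le> q"
  obtains C :: real where "0 \<le> C" "\<And>u. u \<in> tempered \<Longrightarrow> modulation_norm h p q u \<le> ennreal C * modulation_norm g p q u"
proof -
  obtain c where c: "0 < c" and expand: "\<And>u y \<xi>. u \<in> tempered \<Longrightarrow>
    ennreal (norm (u (tf_shift y \<xi> h))) \<le> (\<integral>\<^sup>+s. ennreal (c * norm (tf_coeff h g s)) *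
      ennreal (norm (u (tf_shift (y + fst s) (\<xi> + snd s) g))) \<partial>lborel)"
    by (rule tempered_window_expansion[OF g h]) blast
  define A where "A s = c * norm (tf_coeff h g s)" for s
  have A: "0 \<le> A s" for s using c by (simp add: A_def)
  have Aint: "integrable lborel A" unfolding A_def[abs_def]
    by (intro integrable_mult_right integrable_norm tf_coeff_abs_integrable h g)
  have [measurable]: "A \<in> borel_measurable borel" using borel_measurable_integrable[OF Aint] by simp
  define C where "C = (LINT s|lborel. A s)"
  have C: "(\<integral>\<^sup>+s. ennreal (A s) \<partial>lborel) = ennreal C" unfolding C_def
    by (rule nn_integral_eq_integral[OF Aint]) (simp add: A)
  have "0 \<le> C" unfolding C_def using A by (intro Bochner_Integration.integral_nonneg) auto
  moreover have "modulation_norm h p q u \<le> ennreal C * modulation_norm g p q u" if u: "u \<in> tempered" for u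
  proof -
    define V where "V s = ennreal (norm (u (tf_shift (fst s) (snd s) g)))" for s
    define H where "H s = ennreal (norm (u (tf_shift (fst s) (snd s) h)))" for s
    have [measurable]: "V \<in> borel_measurable borel" "H \<in> borel_measurable borel"
      unfolding V_def[abs_def] H_def[abs_def]
      using borel_measurable_continuous_onI[OF tempered_tf_shift_continuous[OF u g(1)]]
        borel_measurable_continuous_onI[OF tempered_tf_shift_continuous[OF u h]] by simp_all
    define U where "U \<xi> = Lp_norm p lborel (\<lambda>y. V (y, \<xi>))" for \<xi>
    have [measurable]: "U \<in> borel_measurable borel"
      using lborel.Lp_norm_measurable[of "\<lambda>\<xi> y. V (y, \<xi>)" "lborel :: 'a measure" p] by (simp add: U_def[abs_def])
    \<comment> \<open>At a fixed frequency, the inner norm for \<open>h\<close> is bounded by an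
      integral of the inner norms for \<open>g\<close> at shifted frequencies, weighted with the
      kernel.\<close>
    have HU: "Lp_norm p lborel (\<lambda>y. H (y, \<xi>)) \<le> (\<integral>\<^sup>+s. ennreal (A s) * U (\<xi> + snd s) \<partial>lborel)" for \<xi>
    proof -
      have "Lp_norm p lborel (\<lambda>y. H (y, \<xi>)) \<le> Lp_norm p lborel (\<lambda>y. \<integral>\<^sup>+s. ennreal (A s) * V (y + fst s, \<xi> + snd s) \<partial>lborel)"
      proof (rule Lp_norm_mono[OF _ _ p])
        show "(\<lambda>y. H (y, \<xi>)) \<in> borel_measurable lborel" by measurable
        show "H (y, \<xi>) \<le> (\<integral>\<^sup>+s. ennreal (A s) * V (y + fst s, \<xi> + snd s) \<partial>lborel)" for y
          using expand[OF u] by (simp add: H_def V_def A_def)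
      qed
      also have "\<dots> \<le> (\<integral>\<^sup>+s. Lp_norm p lborel (\<lambda>y. ennreal (A s) * V (y + fst s, \<xi> + snd s)) \<partial>lborel)"
      proof (rule lborel_pair.Lp_norm_nn_integral_le[OF _ p])
        have "(\<lambda>z. A (snd z)) \<in> borel_measurable (borel :: ('a \<times> 'a \<times> 'a) measure)"
          by (rule measurable_compose[of snd _ borel]) (auto intro!: borel_measurable_continuous_onI continuous_intros)
        moreover have "(\<lambda>z. V (fst z + fst (snd z), \<xi> + snd (snd z))) \<in> borel_measurable (borel :: ('a \<times> 'a \<times> 'a) measure)"
          by (rule measurable_compose[of "\<lambda>z. (fst z + fst (snd z), \<xi> + snd (snd z))" _ borel])
            (auto intro!: borel_measurable_continuous_onI continuous_intros)
        ultimately show "(\<lambda>(y, s). ennreal (A s) * V (y + fst s, \<xi> + snd s)) \<in> borel_measurable (lborel \<Otimes>\<^sub>M lborel)"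
          by (simp add: lborel_prod split_beta')
      qed
      also have "\<dots> \<le> (\<integral>\<^sup>+s. ennreal (A s) * U (\<xi> + snd s) \<partial>lborel)"
      proof (rule nn_integral_mono)
        fix s :: "'a \<times> 'a"
        have "Lp_norm p lborel (\<lambda>y. ennreal (A s) * V (y + fst s, \<xi> + snd s))
            \<le> ennreal (A s) * Lp_norm p lborel (\<lambda>y. V (y + fst s, \<xi> + snd s))"
          by (rule Lp_norm_cmult_le) (use p A in simp_all)
        also have "Lp_norm p lborel (\<lambda>y. V (y + fst s, \<xi> + snd s)) = U (\<xi> + snd s)"
          unfolding U_def by (rule Lp_norm_translate) simp
        finally show "Lp_norm p lborel (\<lambda>y. ennreal (A s) * V (y + fst s, \<xi> + snd s)) \<le> ennreal (A s) * U (\<xi> + snd s)" .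
      qed
      finally show ?thesis .
    qed
    have "modulation_norm h p q u = Lp_norm q lborel (\<lambda>\<xi>. Lp_norm p lborel (\<lambda>y. H (y, \<xi>)))"
      by (simp add: modulation_norm_def windowed_fourier_eq H_def)
    also have "\<dots> \<le> Lp_norm q lborel (\<lambda>\<xi>. \<integral>\<^sup>+s. ennreal (A s) * U (\<xi> + snd s) \<partial>lborel)"
      using HU q lborel.Lp_norm_measurable[of "\<lambda>\<xi> y. H (y, \<xi>)" "lborel :: 'a measure" p] by (intro Lp_norm_mono) simp_all
    also have "\<dots> \<le> (\<integral>\<^sup>+s. Lp_norm q lborel (\<lambda>\<xi>. ennreal (A s) * U (\<xi> + snd s)) \<partial>(lborel :: ('a \<times> 'a) measure))"
    proof (rule lborel_pair.Lp_norm_nn_integral_le[OF _ q])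
      have "(\<lambda>z. A (snd z)) \<in> borel_measurable (borel :: ('a \<times> 'a \<times> 'a) measure)"
        by (rule measurable_compose[of snd _ borel]) (auto intro!: borel_measurable_continuous_onI continuous_intros)
      moreover have "(\<lambda>z. U (fst z + snd (snd z))) \<in> borel_measurable (borel :: ('a \<times> 'a \<times> 'a) measure)"
        by (rule measurable_compose[of "\<lambda>z. fst z + snd (snd z)" _ borel])
          (auto intro!: borel_measurable_continuous_onI continuous_intros)
      ultimately show "(\<lambda>(\<xi>, s). ennreal (A s) * U (\<xi> + snd s)) \<in> borel_measurable (lborel \<Otimes>\<^sub>M lborel)"
        by (simp add: lborel_prod split_beta')
    qed
    also have "\<dots> \<le> (\<integral>\<^sup>+s. ennreal (A s) * Lp_norm q lborel U \<partial>lborel)"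
    proof (rule nn_integral_mono)
      fix s :: "'a \<times> 'a"
      have "Lp_norm q lborel (\<lambda>\<xi>. ennreal (A s) * U (\<xi> + snd s)) \<le> ennreal (A s) * Lp_norm q lborel (\<lambda>\<xi>. U (\<xi> + snd s))"
        by (rule Lp_norm_cmult_le) (use q A in simp_all)
      then show "Lp_norm q lborel (\<lambda>\<xi>. ennreal (A s) * U (\<xi> + snd s)) \<le> ennreal (A s) * Lp_norm q lborel U"
        by (simp add: Lp_norm_translate)
    qed
    also have "\<dots> = ennreal C * Lp_norm q lborel U" by (simp add: nn_integral_multc C)
    also have "Lp_norm q lborel U = modulation_norm g p q u"
      by (simp add: modulation_norm_def windowed_fourier_eq U_def[abs_def] V_def)
    finally show ?thesis .
  qed
  ultimately show thesis by (rule that)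
qed

section \<open>Operators covariant under time-frequency shifts\<close>

text \<open>\<open>Y\<close> and \<open>X\<close> are the position and frequency components of the map of phase space induced
  by \<open>A\<close>.\<close>

definition metaplectic :: "(('b::euclidean_space \<Rightarrow> complex) \<Rightarrow> 'a::euclidean_space \<Rightarrow> complex) \<Rightarrow>
    ('b \<Rightarrow> 'b \<Rightarrow> 'a) \<Rightarrow> ('b \<Rightarrow> 'b \<Rightarrow> 'a) \<Rightarrow> bool" where
  "metaplectic A Y X \<longleftrightarrow> schwartz_op A \<and> linear_op A \<and>
     (\<forall>f\<in>schwartz. \<forall>y \<xi>. \<exists>\<theta>. norm \<theta> = 1 \<and>
        A (tf_shift y \<xi> f) = (\<lambda>x. \<theta> * tf_shift (Y y \<xi>) (X y \<xi>) (A f) x))"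

lemma metaplectic_schwartz: "metaplectic A Y X \<Longrightarrow> f \<in> schwartz \<Longrightarrow> A f \<in> schwartz"
  unfolding metaplectic_def by (elim conjE) (rule schwartz_op_schwartz[of A f])

lemma metaplectic_linear: "metaplectic A Y X \<Longrightarrow> linear_op A"
  by (simp add: metaplectic_def)

lemma metaplectic_cmult: "metaplectic A Y X \<Longrightarrow> f \<in> schwartz \<Longrightarrow> A (\<lambda>x. c * f x) = (\<lambda>x. c * A f x)"
  by (simp add: metaplectic_def linear_op_def)

lemma metaplectic_covariant:
  assumes "metaplectic A Y X" "f \<in> schwartz"
  obtains \<theta> where "norm \<theta> = 1" "A (tf_shift y \<xi> f) = (\<lambda>x. \<theta> * tf_shift (Y y \<xi>) (X y \<xi>) (A f) x)"
  using assms unfolding metaplectic_def by meson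

lemma metaplectic_compose:
  fixes A :: "('b::euclidean_space \<Rightarrow> complex) \<Rightarrow> 'a::euclidean_space \<Rightarrow> complex"
    and B :: "('c::euclidean_space \<Rightarrow> complex) \<Rightarrow> 'b \<Rightarrow> complex"
  assumes A: "metaplectic A Y X" and B: "metaplectic B Y' X'"
  shows "metaplectic (\<lambda>f. A (B f)) (\<lambda>y \<xi>. Y (Y' y \<xi>) (X' y \<xi>)) (\<lambda>y \<xi>. X (Y' y \<xi>) (X' y \<xi>))"
  unfolding metaplectic_def
proof (intro conjI ballI allI)
  have "schwartz_op A" "schwartz_op B" using A B by (simp_all add: metaplectic_def)
  then show "schwartz_op (\<lambda>f. A (B f))" by (rule schwartz_op_compose)
  show "linear_op (\<lambda>f. A (B f))"
    using metaplectic_linear[OF A] metaplectic_linear[OF B] metaplectic_schwartz[OF B]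
    by (simp add: linear_op_def)
  fix f :: "'c \<Rightarrow> complex" and y \<xi> assume f: "f \<in> schwartz"
  obtain \<theta> where \<theta>: "norm \<theta> = 1" "B (tf_shift y \<xi> f) = (\<lambda>x. \<theta> * tf_shift (Y' y \<xi>) (X' y \<xi>) (B f) x)"
    using metaplectic_covariant[OF B f] by blast
  obtain \<kappa> where \<kappa>: "norm \<kappa> = 1" "A (tf_shift (Y' y \<xi>) (X' y \<xi>) (B f))
      = (\<lambda>x. \<kappa> * tf_shift (Y (Y' y \<xi>) (X' y \<xi>)) (X (Y' y \<xi>) (X' y \<xi>)) (A (B f)) x)"
    using metaplectic_covariant[OF A metaplectic_schwartz[OF B f]] by blast
  have "A (B (tf_shift y \<xi> f)) = (\<lambda>x. (\<theta> * \<kappa>) * tf_shift (Y (Y' y \<xi>) (X' y \<xi>)) (X (Y' y \<xi>) (X' y \<xi>)) (A (B f)) x)"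
    unfolding \<theta>(2) metaplectic_cmult[OF A schwartz_tf_shift[OF metaplectic_schwartz[OF B f]]] \<kappa>(2)
    by (simp add: mult.assoc)
  then show "\<exists>\<theta>. norm \<theta> = 1 \<and> A (B (tf_shift y \<xi> f))
      = (\<lambda>x. \<theta> * tf_shift (Y (Y' y \<xi>) (X' y \<xi>)) (X (Y' y \<xi>) (X' y \<xi>)) (A (B f)) x)"
    using \<theta>(1) \<kappa>(1) by (intro exI[of _ "\<theta> * \<kappa>"]) (simp add: norm_mult)
qed

lemma metaplectic_scale: "metaplectic (\<lambda>f x. c * f x) (\<lambda>y \<xi>. y) (\<lambda>y \<xi>. \<xi>)"
  unfolding metaplectic_def
  by (intro conjI schwartz_op_cmult[OF schwartz_op_id] ballI allI exI[of _ 1])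
    (auto simp: linear_op_def distrib_left tf_shift_def fun_eq_iff)

lemma metaplectic_linear_comp:
  fixes S :: "'a::euclidean_space \<Rightarrow> 'b::euclidean_space"
  assumes lin: "linear S" and bij: "bij S"
  shows "metaplectic (\<lambda>f x. f (S x)) (\<lambda>y \<xi>. inv S y) (\<lambda>y \<xi>. adjoint S \<xi>)"
  unfolding metaplectic_def
proof (intro conjI schwartz_op_linear_comp[OF lin bij] ballI allI exI[of _ 1])
  fix f :: "'b \<Rightarrow> complex" and y \<xi>
  have "S (x - inv S y) = S x - y" for x
    using bij by (simp add: linear_diff[OF lin] bij_is_surj surj_f_inv_f)
  then show "(\<lambda>x. tf_shift y \<xi> f (S x)) = (\<lambda>x. 1 * tf_shift (inv S y) (adjoint S \<xi>) (\<lambda>x. f (S x)) x)"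
    by (simp add: tf_shift_def adjoint_works[OF lin])
qed (auto simp: linear_op_def)

text \<open>A quarter turn of phase space: translation becomes modulation and modulation becomes
  translation. Bringing them back into the order of \<open>tf_shift\<close> costs
  \<open>phase (y \<bullet> \<xi>)\<close>.\<close>

lemma metaplectic_fourier: "metaplectic fourier (\<lambda>y \<xi>. - \<xi>) (\<lambda>y \<xi>. y)"
  unfolding metaplectic_def
proof (intro conjI schwartz_op_fourier ballI allI)
  show "linear_op fourier" by (simp add: linear_op_def fun_eq_iff fourier_add fourier_cmult)
  fix f :: "'a \<Rightarrow> complex" and y \<xi> :: 'a assume f: "f \<in> schwartz"
  have [measurable]: "f \<in> borel_measurable borel" by (rule schwartz_measurable[OF f])
  have "fourier (tf_shift y \<xi> f) \<zeta> = phase (y \<bullet> \<xi>) * tf_shift (- \<xi>) y (fourier f) \<zeta>" for \<zeta>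
  proof -
    have "fourier (tf_shift y \<xi> f) \<zeta> = (LINT x|lborel. f (x - y) * phase (x \<bullet> \<xi>) * phase (x \<bullet> \<zeta>))"
      by (simp add: fourier_def tf_shift_def)
    also have "\<dots> = (LINT x|lborel. f (y + x - y) * phase ((y + x) \<bullet> \<xi>) * phase ((y + x) \<bullet> \<zeta>))"
      by (rule lborel_integral_translate[symmetric]) simp
    also have "\<dots> = (LINT x|lborel. phase (y \<bullet> (\<xi> + \<zeta>)) * (f x * phase (x \<bullet> (\<xi> + \<zeta>))))"
      by (simp add: inner_add_left inner_add_right phase_add mult_ac)
    also have "\<dots> = phase (y \<bullet> (\<xi> + \<zeta>)) * fourier f (\<xi> + \<zeta>)" by (simp add: fourier_def)
    finally show ?thesis by (simp add: tf_shift_def inner_add_right phase_add inner_commute add.commute mult_ac)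
  qed
  then show "\<exists>\<theta>. norm \<theta> = 1 \<and> fourier (tf_shift y \<xi> f) = (\<lambda>x. \<theta> * tf_shift (- \<xi>) y (fourier f) x)"
    by (intro exI[of _ "phase (y \<bullet> \<xi>)"]) (simp add: fun_eq_iff)
qed

text \<open>Polarisation of the quadratic exponent: its value at \<open>x\<close> is its value at
  \<open>x - y\<close>, minus its value at \<open>y\<close>, plus a term linear in \<open>x\<close>
  that acts as a further modulation. Only the symmetric part of \<open>K\<close> enters this
  term.\<close>

lemma metaplectic_chirp:
  fixes K :: "'a::euclidean_space \<Rightarrow> 'a"
  assumes lin: "linear K"
  shows "metaplectic (\<lambda>f x. phase (x \<bullet> K x / 2) * f x) (\<lambda>y \<xi>. y) (\<lambda>y \<xi>. \<xi> + (1 / 2) *\<^sub>R (K y + adjoint K y))"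
  unfolding metaplectic_def
proof (intro conjI schwartz_op_chirp[OF lin] ballI allI)
  show "linear_op (\<lambda>f x. phase (x \<bullet> K x / 2) * f x)"
    by (simp add: linear_op_def fun_eq_iff algebra_simps)
  fix f :: "'a \<Rightarrow> complex" and y \<xi> :: 'a
  have eq: "phase (x \<bullet> K x / 2) = phase (- (y \<bullet> K y / 2)) * phase ((x - y) \<bullet> K (x - y) / 2)
      * phase (x \<bullet> ((1 / 2) *\<^sub>R (K y + adjoint K y)))" for x
  proof -
    have "x \<bullet> adjoint K y = y \<bullet> K x" by (simp add: adjoint_works[OF lin] inner_commute)
    then have "x \<bullet> K x / 2 = - (y \<bullet> K y / 2) + (x - y) \<bullet> K (x - y) / 2 + x \<bullet> ((1 / 2) *\<^sub>R (K y + adjoint K y))"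
      by (simp add: linear_diff[OF lin] inner_diff_left inner_diff_right inner_add_right field_simps)
    then show ?thesis by (simp only: phase_add)
  qed
  have "phase (x \<bullet> K x / 2) * tf_shift y \<xi> f x = phase (- (y \<bullet> K y / 2))
      * tf_shift y (\<xi> + (1 / 2) *\<^sub>R (K y + adjoint K y)) (\<lambda>x. phase (x \<bullet> K x / 2) * f x) x" for x
    unfolding tf_shift_def inner_add_right[of x \<xi>] phase_add eq[of x] by (simp only: mult_ac)
  then show "\<exists>\<theta>. norm \<theta> = 1 \<and> (\<lambda>x. phase (x \<bullet> K x / 2) * tf_shift y \<xi> f x)
      = (\<lambda>x. \<theta> * tf_shift y (\<xi> + (1 / 2) *\<^sub>R (K y + adjoint K y)) (\<lambda>x. phase (x \<bullet> K x / 2) * f x) x)"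
    by (intro exI[of _ "phase (- (y \<bullet> K y / 2))"]) (simp only: norm_phase simp_thms)
qed

section \<open>Modulation norms under covariant operators\<close>

lemma bij_adjoint:
  fixes S :: "'a::euclidean_space \<Rightarrow> 'b::euclidean_space"
  assumes lin: "linear S" and bij: "bij S"
  shows "bij (adjoint S)"
proof (rule o_bij)
  have lin': "linear (inv S)" by (rule linear_inv[OF lin bij])
  show "adjoint (inv S) \<circ> adjoint S = id"
  proof
    fix y
    have "x \<bullet> adjoint (inv S) (adjoint S y) = x \<bullet> y" for x
      using bij by (simp add: adjoint_works[OF lin] adjoint_works[OF lin'] bij_is_surj surj_f_inv_f)
    then have "adjoint (inv S) (adjoint S y) = y" by (rule iffD1[OF vector_eq_ldot, OF allI])
    then show "(adjoint (inv S) \<circ> adjoint S) y = id y" by simp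
  qed
  show "adjoint S \<circ> adjoint (inv S) = id"
  proof
    fix y
    have "x \<bullet> adjoint S (adjoint (inv S) y) = x \<bullet> y" for x
      using bij by (simp add: adjoint_works[OF lin] adjoint_works[OF lin'] bij_is_inj)
    then have "adjoint S (adjoint (inv S) y) = y" by (rule iffD1[OF vector_eq_ldot, OF allI])
    then show "(adjoint S \<circ> adjoint (inv S)) y = id y" by simp
  qed
qed

text \<open>The frequency component is free of \<open>y\<close>. At each \<open>\<xi>\<close> the
  inner norm therefore sees an affine substitution in \<open>y\<close>, in which
  \<open>D \<xi>\<close> is a mere translation; afterwards the outer norm sees the substitution
  \<open>N\<close>. Unimodular phases disappear in the absolute value.\<close>

lemma modulation_norm_pullback:
  fixes A :: "('b::euclidean_space \<Rightarrow> complex) \<Rightarrow> 'a::euclidean_space \<Rightarrow> complex"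
  assumes A: "metaplectic A (\<lambda>y \<xi>. L y + D \<xi>) (\<lambda>y \<xi>. N \<xi>)"
    and L: "linear L" "bij L" and N: "linear N" "bij N" and p: "1 \<le> p" and q: "1 \<le> q"
  obtains C :: real where "0 < C" "\<And>u w. u \<in> tempered \<Longrightarrow> w \<in> schwartz \<Longrightarrow>
    modulation_norm w p q (pullback A u) = ennreal C * modulation_norm (A w) p q u"
proof -
  obtain c where c: "0 < c" "\<And>f v. f \<in> borel_measurable borel \<Longrightarrow>
     Lp_norm p lborel (\<lambda>x. f (L x + v)) = ennreal c * Lp_norm p lborel f"
    by (rule Lp_norm_affine[OF L p]) blast
  obtain d where d: "0 < d" "\<And>f v. f \<in> borel_measurable borel \<Longrightarrow>
     Lp_norm q lborel (\<lambda>x. f (N x + v)) = ennreal d * Lp_norm q lborel f"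
    by (rule Lp_norm_affine[OF N q]) blast
  have "modulation_norm w p q (pullback A u) = ennreal (c * d) * modulation_norm (A w) p q u"
    if u: "u \<in> tempered" and w: "w \<in> schwartz" for u w
  proof -
    define V where "V s = ennreal (norm (u (tf_shift (fst s) (snd s) (A w))))" for s
    have Aw: "A w \<in> schwartz" by (rule metaplectic_schwartz[OF A w])
    have [measurable]: "V \<in> borel_measurable borel"
      unfolding V_def[abs_def]
      using borel_measurable_continuous_onI[OF tempered_tf_shift_continuous[OF u Aw]] by simp
    define U where "U \<xi> = Lp_norm p lborel (\<lambda>y. V (y, \<xi>))" for \<xi>
    have [measurable]: "U \<in> borel_measurable borel"
      using lborel.Lp_norm_measurable[of "\<lambda>\<xi> y. V (y, \<xi>)" "lborel :: 'a measure" p] by (simp add: U_def[abs_def])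
    have N_meas: "N \<in> borel_measurable borel" by (rule linear_borel_measurable[OF N(1)])
    have wf: "ennreal (norm (windowed_fourier w (pullback A u) y \<xi>)) = V (L y + D \<xi>, N \<xi>)" for y \<xi>
    proof -
      obtain \<theta> where \<theta>: "norm \<theta> = 1" "A (tf_shift y \<xi> w) = (\<lambda>x. \<theta> * tf_shift (L y + D \<xi>) (N \<xi>) (A w) x)"
        using metaplectic_covariant[OF A w] by blast
      have "windowed_fourier w (pullback A u) y \<xi> = \<theta> * u (tf_shift (L y + D \<xi>) (N \<xi>) (A w))"
        by (simp add: windowed_fourier_eq pullback_def schwartz_tf_shift[OF w] \<theta>(2) tempered_cmult[OF u schwartz_tf_shift[OF Aw]])
      then show ?thesis using \<theta>(1) by (simp add: V_def norm_mult)
    qed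
    have "modulation_norm w p q (pullback A u) = Lp_norm q lborel (\<lambda>\<xi>. Lp_norm p lborel (\<lambda>y. V (L y + D \<xi>, N \<xi>)))"
      by (simp add: modulation_norm_def wf)
    also have "\<dots> = Lp_norm q lborel (\<lambda>\<xi>. ennreal c * U (N \<xi>))"
      using c(2)[of "\<lambda>y. V (y, N _)"] by (simp add: U_def)
    also have "\<dots> = ennreal c * Lp_norm q lborel (\<lambda>\<xi>. U (N \<xi>))"
      using measurable_compose[OF N_meas, of U borel] by (intro Lp_norm_cmult q c) simp
    also have "Lp_norm q lborel (\<lambda>\<xi>. U (N \<xi>)) = ennreal d * Lp_norm q lborel U"
      using d(2)[of U 0] by simp
    also have "Lp_norm q lborel U = modulation_norm (A w) p q u"
      by (simp add: modulation_norm_def windowed_fourier_eq U_def[abs_def] V_def)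
    finally show ?thesis using c(1) d(1) by (simp add: ennreal_mult mult.assoc)
  qed
  then show thesis using that[of "c * d"] c(1) d(1) by simp
qed

lemma pullback_pullback:
  assumes "\<And>f. f \<in> schwartz \<Longrightarrow> A f \<in> schwartz"
  shows "pullback A (pullback B u) = pullback (\<lambda>f. B (A f)) u"
  using assms by (auto simp: pullback_def fun_eq_iff)

lemma dist_comp_pullback:
  fixes S :: "'a::euclidean_space \<Rightarrow> 'b::euclidean_space"
  assumes u: "u \<in> tempered" and S: "linear S" "bij S"
  shows "dist_comp u S = pullback (\<lambda>f x. complex_of_real (1 / jacobian S) * f (inv S x)) u"
proof
  fix \<phi> :: "'a \<Rightarrow> complex"
  have "(\<lambda>x. \<phi> (inv S x)) \<in> schwartz" if "\<phi> \<in> schwartz"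
    by (rule schwartz_op_schwartz[OF schwartz_op_linear_comp[OF linear_inv[OF S] bij_imp_bij_inv[OF S(2)]] that])
  then show "dist_comp u S \<phi> = pullback (\<lambda>f x. complex_of_real (1 / jacobian S) * f (inv S x)) u \<phi>"
    using tempered_cmult[OF u, of "\<lambda>x. \<phi> (inv S x)" "complex_of_real (1 / jacobian S)"]
    by (simp add: dist_comp_def pullback_def comp_def)
qed

section \<open>The symplectic Fourier transform\<close>

text \<open>Through the inner product the form becomes a skew matrix \<open>B\<close>; up to
  normalisation, the symplectic Fourier transform is then the ordinary one evaluated at
  \<open>B \<xi>\<close>.\<close>

lemma symplectic_form_matrix:
  fixes \<sigma> :: "'a::euclidean_space \<Rightarrow> 'a \<Rightarrow> real"
  assumes "symplectic_form \<sigma>"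
  obtains B where "linear B" "bij B" "\<And>\<xi> \<eta>. \<sigma> \<xi> \<eta> = B \<xi> \<bullet> \<eta>" "\<And>\<xi> \<eta>. B \<xi> \<bullet> \<eta> = - (\<xi> \<bullet> B \<eta>)"
proof -
  have bil: "bilinear \<sigma>" and skew: "\<And>\<xi> \<eta>. \<sigma> \<xi> \<eta> = - \<sigma> \<eta> \<xi>" and nondeg: "\<And>\<xi>. (\<forall>\<eta>. \<sigma> \<xi> \<eta> = 0) \<Longrightarrow> \<xi> = 0"
    using assms unfolding symplectic_form_def by blast+
  define B where "B \<xi> = (\<Sum>b\<in>Basis. \<sigma> \<xi> b *\<^sub>R b)" for \<xi>
  have lin: "linear B"
    unfolding B_def using bil
    by (intro linearI) (auto simp: bilinear_ladd bilinear_lmul scaleR_left_distrib sum.distrib scaleR_sum_right)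
  have B: "\<sigma> \<xi> \<eta> = B \<xi> \<bullet> \<eta>" for \<xi> \<eta>
  proof -
    have "linear (\<sigma> \<xi>)" using bil by (simp add: bilinear_def)
    have "\<sigma> \<xi> \<eta> = \<sigma> \<xi> (\<Sum>b\<in>Basis. (\<eta> \<bullet> b) *\<^sub>R b)" by (simp add: euclidean_representation)
    also have "\<dots> = (\<Sum>b\<in>Basis. (\<eta> \<bullet> b) * \<sigma> \<xi> b)"
      by (simp add: linear_sum[OF \<open>linear (\<sigma> \<xi>)\<close>] linear_scale[OF \<open>linear (\<sigma> \<xi>)\<close>])
    also have "\<dots> = B \<xi> \<bullet> \<eta>" by (simp add: B_def inner_sum_right inner_commute[of _ \<eta>] mult.commute)
    finally show ?thesis .
  qed
  have "B \<xi> = 0 \<Longrightarrow> \<xi> = 0" for \<xi> using nondeg[of \<xi>] by (simp add: B)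
  then have "inj B" using lin by (simp add: linear_injective_0)
  then have "bij B" using linear_injective_imp_surjective[OF lin] by (simp add: bij_def)
  moreover have "B \<xi> \<bullet> \<eta> = - (\<xi> \<bullet> B \<eta>)" for \<xi> \<eta> using skew[of \<xi> \<eta>] by (simp add: B inner_commute)
  ultimately show thesis using lin B that by blast
qed

text \<open>The definite description is justified by
  \<open>B (T' \<xi>) \<bullet> \<eta> = B \<xi> \<bullet> T \<eta>\<close>, which forces
  \<open>T' = inv B \<circ> (adjoint T \<circ> B)\<close> as \<open>B\<close> is invertible.\<close>

lemma sympl_adjoint_linear:
  fixes \<sigma> :: "'a::euclidean_space \<Rightarrow> 'a \<Rightarrow> real"
  assumes \<sigma>: "symplectic_form \<sigma>" and T: "linear T"
  shows "linear (sympl_adjoint \<sigma> T)"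
proof -
  obtain B where B: "linear B" "bij B" "\<And>\<xi> \<eta>. \<sigma> \<xi> \<eta> = B \<xi> \<bullet> \<eta>" "\<And>\<xi> \<eta>. B \<xi> \<bullet> \<eta> = - (\<xi> \<bullet> B \<eta>)"
    by (rule symplectic_form_matrix[OF \<sigma>]) (rule that)
  define T' where "T' = inv B \<circ> (adjoint T \<circ> B)"
  have T': "\<sigma> (T' \<xi>) \<eta> = \<sigma> \<xi> (T \<eta>)" for \<xi> \<eta>
    using B(2) adjoint_works[OF T, of \<eta> "B \<xi>"]
    by (simp add: B(3) T'_def bij_is_surj surj_f_inv_f inner_commute)
  have "sympl_adjoint \<sigma> T = T'" unfolding sympl_adjoint_def
  proof (rule the_equality)
    show "\<forall>\<xi> \<eta>. \<sigma> (T' \<xi>) \<eta> = \<sigma> \<xi> (T \<eta>)" by (simp only: T' simp_thms)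
    fix T'' assume "\<forall>\<xi> \<eta>. \<sigma> (T'' \<xi>) \<eta> = \<sigma> \<xi> (T \<eta>)"
    then have eq: "B (T'' \<xi>) \<bullet> \<eta> = B (T' \<xi>) \<bullet> \<eta>" for \<xi> \<eta> using T' by (simp add: B(3))
    have "B (T'' \<xi>) = B (T' \<xi>)" for \<xi> by (rule iffD1[OF vector_eq_rdot, OF allI]) (rule eq)
    then show "T'' = T'" using B(2) by (simp add: fun_eq_iff bij_is_inj inj_eq)
  qed
  moreover have "linear T'" unfolding T'_def
    by (intro linear_compose B(1) adjoint_linear[OF T] linear_inv[OF B(1,2)])
  ultimately show ?thesis by simp
qed

lemma density_const_integral:
  fixes f :: "'a::euclidean_space \<Rightarrow> complex"
  assumes "f \<in> borel_measurable borel" "0 < C"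
  shows "(LINT x|density lborel (\<lambda>_. ennreal C). f x) = complex_of_real C * (LINT x|lborel. f x)"
  using assms by (simp add: integral_density scaleR_conv_of_real)

lemma sympl_fourier_wrt_density:
  fixes a :: "'a::euclidean_space \<Rightarrow> complex"
  assumes a: "a \<in> schwartz" and C: "0 < C" and \<sigma>: "\<And>\<xi> \<eta>. \<sigma> \<xi> \<eta> = B \<xi> \<bullet> \<eta>"
  shows "sympl_fourier_wrt (density lborel (\<lambda>_. ennreal C)) \<sigma> a = (\<lambda>\<xi>. complex_of_real C * fourier a (B \<xi>))"
proof
  fix \<xi>
  have [measurable]: "a \<in> borel_measurable borel" by (rule schwartz_measurable[OF a])
  have "sympl_fourier_wrt (density lborel (\<lambda>_. ennreal C)) \<sigma> a \<xi>
      = (LINT \<eta>|density lborel (\<lambda>_. ennreal C). a \<eta> * phase (\<eta> \<bullet> B \<xi>))"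
    by (simp add: sympl_fourier_wrt_def \<sigma> phase_def inner_commute mult.commute)
  also have "\<dots> = complex_of_real C * fourier a (B \<xi>)"
    unfolding fourier_def by (rule density_const_integral[OF _ C]) simp
  finally show "sympl_fourier_wrt (density lborel (\<lambda>_. ennreal C)) \<sigma> a \<xi> = complex_of_real C * fourier a (B \<xi>)" .
qed

lemma schwartz_fourier_comp:
  fixes B :: "'a::euclidean_space \<Rightarrow> 'a"
  assumes "linear B" "bij B" "a \<in> schwartz"
  shows "(\<lambda>\<xi>. complex_of_real C * fourier a (B \<xi>)) \<in> schwartz"
  using schwartz_op_schwartz[OF schwartz_op_linear_comp[OF assms(1,2)] schwartz_fourier[OF assms(3)]]
  by (rule schwartz_cmult)

text \<open>The normalisation \<open>C\<close> is forced by \<open>C\<^sup>2 d c = 1\<close>, where \<open>c\<close> is the constant of the inversion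
  formula and \<open>d\<close> the Jacobian factor of \<open>B\<close>.\<close>

lemma sympl_measure_density:
  fixes \<sigma> :: "'a::euclidean_space \<Rightarrow> 'a \<Rightarrow> real" and \<psi> :: "'a \<Rightarrow> complex"
  assumes \<psi>: "\<psi> \<in> schwartz" "\<psi> \<noteq> (\<lambda>x. 0)"
    and B: "linear B" "bij B" and \<sigma>: "\<And>\<xi> \<eta>. \<sigma> \<xi> \<eta> = B \<xi> \<bullet> \<eta>" and skew: "\<And>\<xi> \<eta>. B \<xi> \<bullet> \<eta> = - (\<xi> \<bullet> B \<eta>)"
  obtains C :: real where "0 < C" "sympl_measure \<sigma> = density lborel (\<lambda>_. ennreal C)"
    "\<And>a. a \<in> schwartz \<Longrightarrow> (\<lambda>\<xi>. complex_of_real C * fourier (\<lambda>\<eta>. complex_of_real C * fourier a (B \<eta>)) (B \<xi>)) = a"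
proof -
  obtain c where c: "0 < c" and inv: "\<And>f x. f \<in> (schwartz :: ('a \<Rightarrow> complex) set) \<Longrightarrow>
       (LINT \<xi>|lborel. fourier f \<xi> * phase (- (x \<bullet> \<xi>))) = complex_of_real c * f x"
    and planch: "\<And>f g. f \<in> (schwartz :: ('a \<Rightarrow> complex) set) \<Longrightarrow> g \<in> schwartz \<Longrightarrow>
       (LINT \<xi>|lborel. fourier f \<xi> * cnj (fourier g \<xi>)) = complex_of_real c * (LINT x|lborel. f x * cnj (g x))"
    by (rule fourier_inversion[OF \<psi>]) blast
  have [measurable]: "B \<in> borel_measurable borel" by (rule linear_borel_measurable[OF B(1)])
  obtain d where d: "0 < d" "\<And>f :: 'a \<Rightarrow> complex. f \<in> borel_measurable borel \<Longrightarrow>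
      (LINT x|lborel. f (B x)) = complex_of_real d * (LINT x|lborel. f x)"
    by (rule lborel_linear_substitution[OF B]) blast
  have meas: "a \<in> borel_measurable borel" "fourier a \<in> borel_measurable borel" if "a \<in> schwartz" for a :: "'a \<Rightarrow> complex"
    using that by (auto intro: schwartz_measurable schwartz_fourier)
  \<comment> \<open>Skewness of \<open>B\<close> turns the outer kernel into the inverse kernel
    \<open>phase (- (\<xi> \<bullet> B \<eta>))\<close>; substituting \<open>B\<close> contributes
    \<open>d\<close>, and inversion contributes \<open>c\<close>.\<close>
  have twice: "complex_of_real C * fourier (\<lambda>\<eta>. complex_of_real C * fourier a (B \<eta>)) (B \<xi>) = complex_of_real (C\<^sup>2 * d * c) * a \<xi>"
    if a: "a \<in> schwartz" for C a \<xi>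
  proof -
    have [measurable]: "fourier a \<in> borel_measurable borel" by (rule meas(2)[OF a])
    have "fourier (\<lambda>\<eta>. complex_of_real C * fourier a (B \<eta>)) (B \<xi>)
        = complex_of_real C * (LINT \<eta>|lborel. fourier a (B \<eta>) * phase (- (\<xi> \<bullet> B \<eta>)))"
      unfolding fourier_cmult by (simp add: fourier_def[of "\<lambda>\<eta>. fourier a (B \<eta>)"] skew[symmetric] inner_commute)
    also have "(LINT \<eta>|lborel. fourier a (B \<eta>) * phase (- (\<xi> \<bullet> B \<eta>)))
        = complex_of_real d * (LINT \<zeta>|lborel. fourier a \<zeta> * phase (- (\<xi> \<bullet> \<zeta>)))"
      by (rule d(2)) simp
    finally show ?thesis by (simp add: inv[OF a] power2_eq_square)
  qed
  define C where "C = 1 / sqrt (d * c)"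
  have C: "0 < C" "C\<^sup>2 * d * c = 1"
    using c d(1) by (simp_all add: C_def power_divide)
  define \<mu> where "\<mu> = density (lborel :: 'a measure) (\<lambda>_. ennreal C)"
  have invol: "sympl_fourier_wrt (density lborel (\<lambda>_. ennreal C')) \<sigma> (sympl_fourier_wrt (density lborel (\<lambda>_. ennreal C')) \<sigma> a)
      = (\<lambda>\<xi>. complex_of_real (C'\<^sup>2 * d * c) * a \<xi>)" if "0 < C'" "a \<in> schwartz" for C' a
    unfolding sympl_fourier_wrt_density[OF that(2,1) \<sigma>]
      sympl_fourier_wrt_density[OF schwartz_fourier_comp[OF B that(2)] that(1) \<sigma>] twice[OF that(2)] ..
  have "sympl_measure \<sigma> = \<mu>" unfolding sympl_measure_def
  proof (rule the_equality, intro conjI ballI)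
    show "haar_measure \<mu>" unfolding \<mu>_def by (rule haar_measure_density[OF C(1)])
    show "sympl_fourier_wrt \<mu> \<sigma> (sympl_fourier_wrt \<mu> \<sigma> a) = a" if "a \<in> schwartz" for a
      unfolding \<mu>_def invol[OF C(1) that] using C(2) by simp
    fix a b :: "'a \<Rightarrow> complex" assume a: "a \<in> schwartz" and b: "b \<in> schwartz"
    have [measurable]: "a \<in> borel_measurable borel" "b \<in> borel_measurable borel"
        "fourier a \<in> borel_measurable borel" "fourier b \<in> borel_measurable borel"
      using meas a b by auto
    have "(LINT \<xi>|\<mu>. sympl_fourier_wrt \<mu> \<sigma> a \<xi> * cnj (sympl_fourier_wrt \<mu> \<sigma> b \<xi>))
       = (LINT \<xi>|\<mu>. complex_of_real (C\<^sup>2) * (fourier a (B \<xi>) * cnj (fourier b (B \<xi>))))"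
      unfolding \<mu>_def sympl_fourier_wrt_density[OF a C(1) \<sigma>] sympl_fourier_wrt_density[OF b C(1) \<sigma>]
      by (simp add: power2_eq_square mult_ac)
    also have "\<dots> = complex_of_real C * (LINT \<xi>|lborel. complex_of_real (C\<^sup>2) * (fourier a (B \<xi>) * cnj (fourier b (B \<xi>))))"
      unfolding \<mu>_def by (rule density_const_integral[OF _ C(1)]) simp
    also have "(LINT \<xi>|lborel. complex_of_real (C\<^sup>2) * (fourier a (B \<xi>) * cnj (fourier b (B \<xi>))))
        = complex_of_real d * (LINT \<xi>|lborel. complex_of_real (C\<^sup>2) * (fourier a \<xi> * cnj (fourier b \<xi>)))"
      by (rule d(2)) simp
    \<comment> \<open>The same product occurs as for involutivity, so one normalisation gives both
      properties; the remaining factor \<open>C\<close> belongs to the measure.\<close>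
    also have "\<dots> = complex_of_real (C\<^sup>2 * d * c) * (LINT x|lborel. a x * cnj (b x))"
      by (simp add: planch[OF a b])
    also have "\<dots> = (LINT x|lborel. a x * cnj (b x))" by (simp only: C(2) of_real_1 mult_1_left)
    also have "complex_of_real C * \<dots> = (LINT \<xi>|\<mu>. a \<xi> * cnj (b \<xi>))"
      unfolding \<mu>_def by (rule density_const_integral[OF _ C(1), symmetric]) simp
    finally show "(LINT \<xi>|\<mu>. sympl_fourier_wrt \<mu> \<sigma> a \<xi> * cnj (sympl_fourier_wrt \<mu> \<sigma> b \<xi>)) = (LINT \<xi>|\<mu>. a \<xi> * cnj (b \<xi>))" .
  next
    fix \<nu> assume \<nu>: "haar_measure \<nu> \<and>
      (\<forall>a\<in>schwartz. sympl_fourier_wrt \<nu> \<sigma> (sympl_fourier_wrt \<nu> \<sigma> a) = a) \<and>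
      (\<forall>a\<in>schwartz. \<forall>b\<in>schwartz.
        (LINT \<xi>|\<nu>. sympl_fourier_wrt \<nu> \<sigma> a \<xi> * cnj (sympl_fourier_wrt \<nu> \<sigma> b \<xi>)) =
        (LINT \<xi>|\<nu>. a \<xi> * cnj (b \<xi>)))"
    then obtain C' where C': "0 < C'" "\<nu> = density lborel (\<lambda>_. ennreal C')" using haar_measure_eq_lborel by blast
    \<comment> \<open>Involutivity for \<open>\<nu>\<close>, evaluated on \<open>\<psi>\<close> at a
      point where it does not vanish, determines the square of the density.\<close>
    obtain x where x: "\<psi> x \<noteq> 0" using \<psi>(2) by auto
    have "(\<lambda>\<xi>. complex_of_real (C'\<^sup>2 * d * c) * \<psi> \<xi>) = \<psi>"
      using \<nu> \<psi>(1) invol[OF C'(1) \<psi>(1)] C'(2) by simp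
    from fun_cong[OF this, of x] x have "complex_of_real (C'\<^sup>2 * d * c) = 1" by simp
    then have "C'\<^sup>2 * d * c = 1" by (simp only: of_real_eq_1_iff)
    with C(2) have "C'\<^sup>2 = C\<^sup>2" using c d(1) by (metis mult.assoc mult_right_cancel zero_neq_one mult_zero_right)
    then have "C' = C" using C(1) C'(1) by (simp add: power2_eq_iff_nonneg)
    then show "\<nu> = \<mu>" by (simp add: C'(2) \<mu>_def)
  qed
  moreover have "(\<lambda>\<xi>. complex_of_real C * fourier (\<lambda>\<eta>. complex_of_real C * fourier a (B \<eta>)) (B \<xi>)) = a" if "a \<in> schwartz" for a
    using twice[OF that, of C] C(2) by (simp add: fun_eq_iff)
  ultimately show thesis using C(1) that by (simp add: \<mu>_def)
qed


lemma fourier_reflect: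
  assumes "f \<in> schwartz"
  shows "fourier (\<lambda>x. f (- x)) (- \<xi>) = fourier f \<xi>"
proof -
  have [measurable]: "f \<in> borel_measurable borel" by (rule schwartz_measurable[OF assms])
  have "fourier (\<lambda>x. f (- x)) (- \<xi>) = (LINT x|lborel. f (- x) * phase ((- x) \<bullet> \<xi>))" by (simp add: fourier_def)
  also have "\<dots> = (LINT x|lborel. f x * phase (x \<bullet> \<xi>))" by (rule lborel_integral_uminus) simp
  finally show ?thesis by (simp add: fourier_def)
qed

section \<open>The map between symbols\<close>

text \<open>On phase space, the multiplier \<open>\<lambda>(D)\<close> is a conjugate of the shear \<open>(y, \<xi>) \<mapsto> (y, \<xi> + H y)\<close> of the
  chirp by the Fourier transform, that is, a shear \<open>(y, \<xi>) \<mapsto> (y + D \<xi>, \<xi>)\<close> of the position.\<close>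

lemma Lambda_w_pullback:
  fixes \<sigma> :: "'a::euclidean_space \<Rightarrow> 'a \<Rightarrow> real" and \<psi> :: "'a \<Rightarrow> complex"
  assumes \<sigma>: "symplectic_form \<sigma>" and T: "linear T" and bijS: "bij (\<lambda>\<xi>. T \<xi> + sympl_adjoint \<sigma> T \<xi>)"
    and \<psi>: "\<psi> \<in> schwartz" "\<psi> \<noteq> (\<lambda>x. 0)"
  obtains A A' :: "('a \<Rightarrow> complex) \<Rightarrow> 'a \<Rightarrow> complex" and L N D Y X where
    "metaplectic A (\<lambda>y \<xi>. L y + D \<xi>) (\<lambda>y \<xi>. N \<xi>)" "linear L" "bij L" "linear N" "bij N"
    "metaplectic A' Y X" "\<And>f. f \<in> schwartz \<Longrightarrow> A (A' f) = f" "\<And>f. f \<in> schwartz \<Longrightarrow> A' (A f) = f"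
    "\<And>u. u \<in> tempered \<Longrightarrow> Lambda_w \<sigma> T u = pullback A u"
proof -
  obtain B where B: "linear B" "bij B" and \<sigma>B: "\<And>\<xi> \<eta>. \<sigma> \<xi> \<eta> = B \<xi> \<bullet> \<eta>"
    and skew: "\<And>\<xi> \<eta>. B \<xi> \<bullet> \<eta> = - (\<xi> \<bullet> B \<eta>)"
    by (rule symplectic_form_matrix[OF \<sigma>]) (rule that)
  obtain C where C: "0 < C" and \<mu>: "sympl_measure \<sigma> = density lborel (\<lambda>_. ennreal C)"
    and invol: "\<And>a. a \<in> schwartz \<Longrightarrow> (\<lambda>\<xi>. complex_of_real C * fourier (\<lambda>\<eta>. complex_of_real C * fourier a (B \<eta>)) (B \<xi>)) = a"
    by (rule sympl_measure_density[OF \<psi> B \<sigma>B skew]) (rule that)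
  \<comment> \<open>The minus sign stems from transposition: on distributions, the transform of the
    test function is evaluated at the reflected point.\<close>
  define nB where "nB x = - B x" for x
  have nB: "linear nB" "bij nB"
  proof -
    have nB_def': "nB = (\<lambda>x. - x) \<circ> B" by (simp add: nB_def fun_eq_iff)
    show "linear nB" unfolding nB_def' by (rule linear_compose[OF B(1) linear_uminus])
    have "bij (\<lambda>x::'a. - x)" by (rule o_bij[of uminus]) (auto simp: fun_eq_iff)
    then show "bij nB" unfolding nB_def' by (rule bij_comp[OF B(2)])
  qed
  have nB_inv: "nB (inv nB x) = x" "inv nB (nB x) = x" for x
    using nB(2) by (simp_all add: bij_is_surj surj_f_inv_f bij_is_inj)
  have adj: "adjoint nB z = - nB z" for z
  proof (rule iffD1[OF vector_eq_ldot, OF allI])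
    show "x \<bullet> adjoint nB z = x \<bullet> (- nB z)" for x
      using skew[of x z] by (simp add: adjoint_works[OF nB(1)] nB_def)
  qed
  define G where "G f = (\<lambda>x. complex_of_real C * fourier f (nB x))" for f
  have mG: "metaplectic G (\<lambda>y \<xi>. inv nB (- \<xi>)) (\<lambda>y \<xi>. adjoint nB y)"
    using metaplectic_compose[OF metaplectic_scale[of "complex_of_real C"]
        metaplectic_compose[OF metaplectic_linear_comp[OF nB] metaplectic_fourier]]
    unfolding G_def[abs_def] .
  \<comment> \<open>The two reflections in \<open>G (G f)\<close> cancel, so \<open>G\<close>
    inherits involutivity from the symplectic Fourier transform.\<close>
  have GG: "G (G f) = f" if f: "f \<in> schwartz" for f
  proof -
    define h where "h \<eta> = complex_of_real C * fourier f (B \<eta>)" for \<eta>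
    have h: "h \<in> schwartz" unfolding h_def[abs_def] by (rule schwartz_fourier_comp[OF B f])
    have Gf: "G f = (\<lambda>\<eta>. h (- \<eta>))" by (simp add: G_def h_def nB_def linear_neg[OF B(1)])
    have "G (G f) = (\<lambda>\<xi>. complex_of_real C * fourier h (B \<xi>))"
      unfolding Gf by (simp add: G_def nB_def fourier_reflect[OF h])
    then show ?thesis using invol[OF f] by (simp add: h_def[abs_def])
  qed
  \<comment> \<open>From \<open>\<sigma> x (T x) = B x \<bullet> T x = x \<bullet> adjoint B (T
    x)\<close>: with this \<open>K\<close> the chirp is \<open>lambda_fun\<close>.\<close>
  define K where "K x = adjoint B (T x)" for x
  have K_comp: "K = adjoint B \<circ> T" by (simp add: K_def fun_eq_iff)
  have K: "linear K" unfolding K_comp by (rule linear_compose[OF T adjoint_linear[OF B(1)]])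
  have K': "linear (\<lambda>x. - K x)" using linear_compose[OF K linear_uminus] by (simp add: comp_def)
  define M where "M f = (\<lambda>x. phase (x \<bullet> K x / 2) * f x)" for f
  define M' where "M' f = (\<lambda>x. phase (x \<bullet> (- K x) / 2) * f x)" for f
  note mM = metaplectic_chirp[OF K, folded M_def[abs_def]]
  note mM' = metaplectic_chirp[OF K', folded M'_def[abs_def]]
  have MM': "M (M' f) = f" "M' (M f) = f" for f
    using phase_minus by (simp_all add: M_def M'_def mult.assoc[symmetric])
  have lam: "lambda_fun \<sigma> T x = phase (x \<bullet> K x / 2)" for x
    by (simp add: lambda_fun_def phase_def K_def adjoint_works[OF B(1)] \<sigma>B)
  define S where "S \<xi> = T \<xi> + sympl_adjoint \<sigma> T \<xi>" for \<xi>
  have S: "linear S" "bij S"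
    unfolding S_def[abs_def] by (rule linear_compose_add[OF T sympl_adjoint_linear[OF \<sigma> T]], rule bijS)
  have S_inv: "linear (inv S)" "bij (inv S)" by (rule linear_inv[OF S], rule bij_imp_bij_inv[OF S(2)])
  have S_canc: "S (inv S x) = x" "inv S (S x) = x" for x
    using S(2) by (simp_all add: bij_is_surj surj_f_inv_f bij_is_inj)
  define c where "c = complex_of_real (1 / jacobian S)"
  have c: "c \<noteq> 0" using jacobian_pos[OF S] by (simp add: c_def)
  define P where "P f = (\<lambda>x. c * f (inv S x))" for f :: "'a \<Rightarrow> complex"
  define Q where "Q f = (\<lambda>x. (1 / c) * f (S x))" for f :: "'a \<Rightarrow> complex"
  have mP: "metaplectic P (\<lambda>y \<xi>. S y) (\<lambda>y \<xi>. adjoint (inv S) \<xi>)"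
    using metaplectic_compose[OF metaplectic_scale[of c] metaplectic_linear_comp[OF S_inv]]
    unfolding P_def[abs_def] inv_inv_eq[OF S(2)] .
  note mQ = metaplectic_compose[OF metaplectic_scale[of "1 / c"] metaplectic_linear_comp[OF S], folded Q_def[abs_def]]
  have PQ: "P (Q f) = f" "Q (P f) = f" for f using c by (simp_all add: P_def Q_def S_canc)
  define N where "N = adjoint (inv S)"
  have N: "linear N" "bij N" unfolding N_def by (rule adjoint_linear[OF S_inv(1)], rule bij_adjoint[OF S_inv])
  define H where "H y = (1 / 2) *\<^sub>R (K y + adjoint K y)" for y
  define D where "D \<xi> = inv nB (- H (inv nB (- N \<xi>)))" for \<xi>
  \<comment> \<open>The substitution \<open>P\<close> acts first although composition with
    \<open>S\<close> is the last operation on distributions, because transposition reverses the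
    order.\<close>
  define A where "A f = G (M (G (P f)))" for f
  define A' where "A' f = Q (G (M' (G f)))" for f
  have lin_inv: "linear (inv nB)" by (rule linear_inv[OF nB])
  \<comment> \<open>Position after the second quarter turn: the two turns restore
    \<open>S y\<close>, and the shear of the chirp enters through the frequency alone.\<close>
  have pos: "inv nB (- (adjoint nB (S y) + (1 / 2) *\<^sub>R (K (inv nB (- adjoint (inv S) \<xi>)) + adjoint K (inv nB (- adjoint (inv S) \<xi>)))))
      = S y + D \<xi>" for y \<xi>
  proof -
    have "- (- nB (S y) + H (inv nB (- N \<xi>))) = nB (S y) + - H (inv nB (- N \<xi>))" by simp
    then have "inv nB (- (- nB (S y) + H (inv nB (- N \<xi>)))) = S y + D \<xi>"
      by (simp only: linear_add[OF lin_inv] nB_inv D_def)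
    then show ?thesis by (simp only: adj N_def H_def)
  qed
  have freq: "adjoint nB (inv nB (- adjoint (inv S) \<xi>)) = N \<xi>" for \<xi>
    by (simp add: adj nB_inv N_def)
  have mA: "metaplectic A (\<lambda>y \<xi>. S y + D \<xi>) (\<lambda>y \<xi>. N \<xi>)"
    using metaplectic_compose[OF mG metaplectic_compose[OF mM metaplectic_compose[OF mG mP]]]
    unfolding A_def[abs_def] pos freq .
  note mA' = metaplectic_compose[OF mQ metaplectic_compose[OF mG metaplectic_compose[OF mM' mG]], folded A'_def[abs_def]]
  have Gs: "G f \<in> schwartz" if "f \<in> schwartz" for f by (rule metaplectic_schwartz[OF mG that])
  have Ms: "M f \<in> schwartz" "M' f \<in> schwartz" if "f \<in> schwartz" for f
    by (rule metaplectic_schwartz[OF mM that], rule metaplectic_schwartz[OF mM' that])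
  have Ps: "P f \<in> schwartz" if "f \<in> schwartz" for f by (rule metaplectic_schwartz[OF mP that])
  have AA': "A (A' f) = f" if f: "f \<in> schwartz" for f
    by (simp add: A_def A'_def PQ GG[OF Ms(2)[OF Gs[OF f]]] MM' GG[OF f])
  have A'A: "A' (A f) = f" if f: "f \<in> schwartz" for f
    by (simp add: A_def A'_def PQ GG[OF Ms(1)[OF Gs[OF Ps[OF f]]]] MM' GG[OF Ps[OF f]])
  have sf: "(\<lambda>\<eta>. sympl_fourier \<sigma> \<phi> (- \<eta>)) = G \<phi>" if "\<phi> \<in> schwartz" for \<phi>
    unfolding sympl_fourier_def \<mu> sympl_fourier_wrt_density[OF that C \<sigma>B]
    by (simp add: G_def nB_def linear_neg[OF B(1)])
  have dsf: "dist_sympl_fourier \<sigma> v = pullback G v" for v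
    by (simp add: dist_sympl_fourier_def pullback_def fun_eq_iff sf)
  have dm: "dist_mult (lambda_fun \<sigma> T) v = pullback M v" for v
    by (simp add: dist_mult_def pullback_def fun_eq_iff lam M_def)
  have "Lambda_w \<sigma> T u = pullback A u" if u: "u \<in> tempered" for u
  proof -
    have op: "schwartz_op G" "linear_op G" "schwartz_op M" "linear_op M"
      using mG mM by (simp_all add: metaplectic_def)
    have t: "pullback G (pullback M (pullback G u)) \<in> tempered"
      by (intro tempered_pullback op u)
    have "Lambda_w \<sigma> T u = dist_comp (pullback G (pullback M (pullback G u))) S"
      by (simp add: Lambda_w_def lambda_D_def dsf dm S_def[abs_def])
    also have "\<dots> = pullback P (pullback G (pullback M (pullback G u)))"
      unfolding dist_comp_pullback[OF t S] P_def[abs_def] c_def ..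
    also have "\<dots> = pullback A u"
      by (simp add: pullback_pullback Ps Gs Ms A_def[abs_def])
    finally show ?thesis .
  qed
  with mA S N mA' AA' A'A show thesis by (rule that)
qed

theorem theorem5p11:
  fixes \<sigma> :: "'a::euclidean_space \<Rightarrow> 'a \<Rightarrow> real"
    and T :: "'a \<Rightarrow> 'a"
    and J :: "'a \<Rightarrow> real ^ 'n"
    and w :: "real ^ 'n \<Rightarrow> complex"
    and p q :: ennreal
  assumes "symplectic_form \<sigma>"
    and "linear T"
    and "bij (\<lambda>\<xi>. T \<xi> + sympl_adjoint \<sigma> T \<xi>)"
    and "linear J" and "bij J"
    and "w \<in> test_functions" and "w \<noteq> (\<lambda>x. 0)"
    and "1 \<le> p" and "1 \<le> q"
  shows "(\<forall>u\<in>tempered. u \<in> modulation_space_via J p q \<longleftrightarrow>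
            Lambda_w \<sigma> T u \<in> modulation_space_via J p q)
       \<and> bounded_isomorphism_on (modulation_space_via J p q)
            (modulation_norm_via J w p q) (Lambda_w \<sigma> T)"
proof -
  note p = assms(8) and q = assms(9)
  have J: "linear (inv J)" "bij (inv J)" by (rule linear_inv[OF assms(4,5)], rule bij_imp_bij_inv[OF assms(5)])
  define c where "c = complex_of_real (1 / jacobian (inv J))"
  have c: "c \<noteq> 0" using jacobian_pos[OF J] by (simp add: c_def)
  \<comment> \<open>Transport along \<open>J\<close> is itself covariant under shifts, so norms on
    the coordinate space become norms on \<open>'a\<close> with window \<open>R v\<close>.\<close>
  define R where "R f = (\<lambda>x. c * f (J x))" for f :: "real ^ 'n \<Rightarrow> complex"
  have mR: "metaplectic R (\<lambda>y \<xi>. inv J y + 0) (\<lambda>y \<xi>. adjoint J \<xi>)"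
    using metaplectic_compose[OF metaplectic_scale[of c] metaplectic_linear_comp[OF assms(4,5)]]
    unfolding R_def[abs_def] by simp
  have R_op: "schwartz_op R" "linear_op R" using mR by (simp_all add: metaplectic_def)
  have R_pull: "dist_comp u (inv J) = pullback R u" if "u \<in> tempered" for u
    unfolding dist_comp_pullback[OF that J] R_def[abs_def] c_def inv_inv_eq[OF assms(5)] ..
  obtain CR where CR: "0 < CR" "\<And>u v. u \<in> tempered \<Longrightarrow> v \<in> schwartz \<Longrightarrow>
      modulation_norm v p q (pullback R u) = ennreal CR * modulation_norm (R v) p q u"
    by (rule modulation_norm_pullback[OF mR J adjoint_linear[OF assms(4)] bij_adjoint[OF assms(4,5)] p q]) (rule that)
  have R_nz: "R v \<noteq> (\<lambda>x. 0)" if "v \<noteq> (\<lambda>x. 0)" for v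
  proof
    assume "R v = (\<lambda>x. 0)"
    then have "v (J x) = 0" for x using c by (simp add: R_def fun_eq_iff)
    then have "v y = 0" for y using bij_is_surj[OF assms(5)] by (metis surjD)
    then show False using that by auto
  qed
  have Rs: "R v \<in> schwartz" if "v \<in> schwartz" for v by (rule metaplectic_schwartz[OF mR that])
  \<comment> \<open>The reference window on \<open>'a\<close>; it also serves as the nonzero
    Schwartz function behind the Fourier normalisation.\<close>
  define g where "g = R w"
  have ws: "w \<in> schwartz" by (rule test_functions_schwartz[OF assms(6)])
  have g: "g \<in> schwartz" "g \<noteq> (\<lambda>x. 0)" unfolding g_def by (rule Rs[OF ws], rule R_nz[OF assms(7)])
  define m where "m u = modulation_norm g p q u" for u
  have via: "modulation_norm_via J w p q u = ennreal CR * m u" if "u \<in> tempered" for u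
    by (simp add: modulation_norm_via_def R_pull[OF that] CR(2)[OF that ws] m_def g_def)
  define V where "V = modulation_space_via J p q"
  \<comment> \<open>Membership provides some window \<open>v\<close>, not the given one; the change
    of window replaces \<open>R v\<close> by the fixed \<open>g\<close>.\<close>
  have V: "u \<in> V \<longleftrightarrow> u \<in> tempered \<and> m u < top" for u
  proof
    assume "u \<in> V"
    then have u: "u \<in> tempered" and "dist_comp u (inv J) \<in> modulation_space p q"
      by (simp_all add: V_def modulation_space_via_def)
    then obtain v where v: "v \<in> test_functions" "v \<noteq> (\<lambda>x. 0)" "modulation_norm v p q (pullback R u) < \<infinity>"
      unfolding modulation_space_def R_pull[OF u] by blast
    have vs: "v \<in> schwartz" by (rule test_functions_schwartz[OF v(1)])
    have "ennreal CR * modulation_norm (R v) p q u < top" using v(3) CR(2)[OF u vs] by simp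
    then have fin: "modulation_norm (R v) p q u < top" using CR(1) by (auto simp: ennreal_mult_less_top)
    obtain C where "modulation_norm g p q u \<le> ennreal C * modulation_norm (R v) p q u"
      using modulation_norm_window[OF Rs[OF vs] R_nz[OF v(2)] g(1) p q] u by metis
    also have "\<dots> < top" using fin by (simp add: ennreal_mult_less_top)
    finally show "u \<in> tempered \<and> m u < top" using u by (simp add: m_def)
  next
    assume u: "u \<in> tempered \<and> m u < top"
    have "modulation_norm w p q (pullback R u) < \<infinity>"
      using u CR(2)[OF _ ws] by (simp add: m_def g_def ennreal_mult_less_top)
    moreover have "pullback R u \<in> tempered" by (rule tempered_pullback[OF R_op]) (use u in simp)
    ultimately have "pullback R u \<in> modulation_space p q"
      unfolding modulation_space_def using assms(6,7) by blast
    then show "u \<in> V" using u R_pull by (simp add: V_def modulation_space_via_def)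
  qed
  obtain A A' :: "('a \<Rightarrow> complex) \<Rightarrow> 'a \<Rightarrow> complex" and L N D Y X
    where mA: "metaplectic A (\<lambda>y \<xi>. L y + D \<xi>) (\<lambda>y \<xi>. N \<xi>)" and L: "linear L" "bij L" and N: "linear N" "bij N"
      and mA': "metaplectic A' Y X" and AA': "\<And>f. f \<in> schwartz \<Longrightarrow> A (A' f) = f"
      and A'A: "\<And>f. f \<in> schwartz \<Longrightarrow> A' (A f) = f"
      and Lam: "\<And>u. u \<in> tempered \<Longrightarrow> Lambda_w \<sigma> T u = pullback A u"
    by (rule Lambda_w_pullback[OF assms(1,2,3) g]) (rule that)
  have A_op: "schwartz_op A" "linear_op A" "schwartz_op A'" "linear_op A'" using mA mA' by (simp_all add: metaplectic_def)
  have As: "A f \<in> schwartz" "A' f \<in> schwartz" if "f \<in> schwartz" for f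
    by (rule metaplectic_schwartz[OF mA that], rule metaplectic_schwartz[OF mA' that])
  have LamT: "Lambda_w \<sigma> T u \<in> tempered" if "u \<in> tempered" for u
    unfolding Lam[OF that] by (rule tempered_pullback[OF A_op(1,2) that])
  obtain CA where CA: "0 < CA" "\<And>u v. u \<in> tempered \<Longrightarrow> v \<in> schwartz \<Longrightarrow>
      modulation_norm v p q (pullback A u) = ennreal CA * modulation_norm (A v) p q u"
    by (rule modulation_norm_pullback[OF mA L N p q]) (rule that)
  \<comment> \<open>The comparison of windows is needed in both directions, so \<open>A g\<close>
    must be nonzero too; \<open>A'\<close> recovers \<open>g\<close> from it.\<close>
  have Ag: "A g \<noteq> (\<lambda>x. 0)"
  proof
    assume "A g = (\<lambda>x. 0)"
    then have "g = A' (\<lambda>x. 0)" using A'A[OF g(1)] by simp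
    also have "\<dots> = (\<lambda>x. 0)"
      using metaplectic_cmult[OF mA' schwartz_zero, of 0] by simp
    finally show False using g(2) by simp
  qed
  obtain C1 where C1: "0 \<le> C1" "\<And>u. u \<in> tempered \<Longrightarrow> modulation_norm (A g) p q u \<le> ennreal C1 * modulation_norm g p q u"
    by (rule modulation_norm_window[OF g As(1)[OF g(1)] p q]) (rule that)
  obtain C2 where C2: "0 \<le> C2" "\<And>u. u \<in> tempered \<Longrightarrow> modulation_norm g p q u \<le> ennreal C2 * modulation_norm (A g) p q u"
    by (rule modulation_norm_window[OF As(1)[OF g(1)] Ag g(1) p q]) (rule that)
  note C1 = C1[folded m_def] and C2 = C2[folded m_def]
  have mL: "m (Lambda_w \<sigma> T u) = ennreal CA * modulation_norm (A g) p q u" if "u \<in> tempered" for u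
    unfolding Lam[OF that] m_def by (rule CA(2)[OF that g(1)])
  have up: "m (Lambda_w \<sigma> T u) \<le> ennreal (CA * C1) * m u" if "u \<in> tempered" for u
    using mult_left_mono[OF C1(2)[OF that], of "ennreal CA"] CA(1) C1(1)
    by (simp add: mL[OF that] ennreal_mult mult.assoc)
  have down: "m u \<le> ennreal (C2 * (1 / CA)) * m (Lambda_w \<sigma> T u)" if "u \<in> tempered" for u
  proof -
    have one: "ennreal (1 / CA) * ennreal CA = 1" using CA(1) by (simp flip: ennreal_mult)
    have "ennreal (C2 * (1 / CA)) * (ennreal CA * z) = ennreal C2 * z" for z
    proof -
      have "ennreal (C2 * (1 / CA)) * (ennreal CA * z) = ennreal C2 * (ennreal (1 / CA) * ennreal CA) * z"
        using C2(1) CA(1) by (simp only: ennreal_mult zero_le_divide_1_iff less_imp_le mult.assoc)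
      then show ?thesis by (simp only: one mult_1_right)
    qed
    then show ?thesis using C2(2)[OF that] by (simp add: mL[OF that])
  qed
  have iff: "u \<in> V \<longleftrightarrow> Lambda_w \<sigma> T u \<in> V" if u: "u \<in> tempered" for u
  proof -
    have "m (Lambda_w \<sigma> T u) < top" if "m u < top"
      using le_less_trans[OF up[OF u]] that by (simp add: ennreal_mult_less_top)
    moreover have "m u < top" if "m (Lambda_w \<sigma> T u) < top"
      using le_less_trans[OF down[OF u]] that by (simp add: ennreal_mult_less_top)
    ultimately show ?thesis using u LamT[OF u] V by blast
  qed
  have VT: "u \<in> tempered" if "u \<in> V" for u using V that by blast
  have bij: "bij_betw (Lambda_w \<sigma> T) V V"
  proof (rule bij_betwI[where g = "pullback A'"])
    show "Lambda_w \<sigma> T \<in> V \<rightarrow> V" using iff VT by blast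
    have right_inv: "Lambda_w \<sigma> T (pullback A' v) = v" if v: "v \<in> tempered" for v
    proof -
      have "pullback A (pullback A' v) = v"
        by (auto simp: pullback_pullback As fun_eq_iff pullback_def A'A tempered_outside[OF v])
      then show ?thesis using Lam[OF tempered_pullback[OF A_op(3,4) v]] by simp
    qed
    \<comment> \<open>The equivalence of membership, read backwards at \<open>pullback A' v\<close>,
      gives stability under the inverse.\<close>
    show "pullback A' \<in> V \<rightarrow> V"
    proof
      fix v assume v: "v \<in> V"
      then show "pullback A' v \<in> V"
        using iff[OF tempered_pullback[OF A_op(3,4) VT[OF v]]] right_inv[OF VT[OF v]] by simp
    qed
    show "Lambda_w \<sigma> T (pullback A' v) = v" if "v \<in> V" for v by (rule right_inv[OF VT[OF that]])
    show "pullback A' (Lambda_w \<sigma> T u) = u" if u: "u \<in> V" for u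
      unfolding Lam[OF VT[OF u]]
      by (auto simp: pullback_pullback As fun_eq_iff pullback_def AA' tempered_outside[OF VT[OF u]])
  qed
  \<comment> \<open>Every factor of \<open>Lambda_w\<close> acts by transposition, so linearity
    follows by unfolding, for arbitrary functionals.\<close>
  have add: "Lambda_w \<sigma> T (\<lambda>\<phi>. u \<phi> + v \<phi>) = (\<lambda>\<phi>. Lambda_w \<sigma> T u \<phi> + Lambda_w \<sigma> T v \<phi>)" for u v
    by (auto simp: Lambda_w_def lambda_D_def dist_comp_def dist_sympl_fourier_def dist_mult_def fun_eq_iff add_divide_distrib)
  have scale: "Lambda_w \<sigma> T (\<lambda>\<phi>. a * u \<phi>) = (\<lambda>\<phi>. a * Lambda_w \<sigma> T u \<phi>)" for a u
    by (auto simp: Lambda_w_def lambda_D_def dist_comp_def dist_sympl_fourier_def dist_mult_def fun_eq_iff)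
  have bounds: "\<exists>C::real. \<forall>u\<in>V. modulation_norm_via J w p q (Lambda_w \<sigma> T u) \<le> ennreal C * modulation_norm_via J w p q u"
    "\<exists>C::real. \<forall>u\<in>V. modulation_norm_via J w p q u \<le> ennreal C * modulation_norm_via J w p q (Lambda_w \<sigma> T u)"
  proof -
    have "modulation_norm_via J w p q (Lambda_w \<sigma> T u) \<le> ennreal (CA * C1) * modulation_norm_via J w p q u" if "u \<in> V" for u
      using mult_left_mono[OF up[OF VT[OF that]], of "ennreal CR"]
      by (simp add: via[OF VT[OF that]] via[OF LamT[OF VT[OF that]]] mult.left_commute)
    then show "\<exists>C::real. \<forall>u\<in>V. modulation_norm_via J w p q (Lambda_w \<sigma> T u) \<le> ennreal C * modulation_norm_via J w p q u"
      by blast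
    have "modulation_norm_via J w p q u \<le> ennreal (C2 * (1 / CA)) * modulation_norm_via J w p q (Lambda_w \<sigma> T u)" if "u \<in> V" for u
      using mult_left_mono[OF down[OF VT[OF that]], of "ennreal CR"]
      by (simp add: via[OF VT[OF that]] via[OF LamT[OF VT[OF that]]] mult.left_commute)
    then show "\<exists>C::real. \<forall>u\<in>V. modulation_norm_via J w p q u \<le> ennreal C * modulation_norm_via J w p q (Lambda_w \<sigma> T u)"
      by blast
  qed
  have "bounded_isomorphism_on V (modulation_norm_via J w p q) (Lambda_w \<sigma> T)"
    unfolding bounded_isomorphism_on_def using bij bounds by (simp add: add scale)
  then show ?thesis using iff unfolding V_def by blast
qed

end
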